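(* Let $n\ge 2$, let $G$ be an open set in $\mathbb{R}^n$, and let $\delta\in(0,1)$ and a constant $C>0$ be given. Then the following three conditions (with the same constant $C$) are equivalent. (A) The fractional Sobolev inequality $$\bigg(\int_G |u(x)|^{n/(n-\delta)}\,dx\bigg)^{(n-\delta)/n}\le C\int_G\int_G \frac{|u(x)-u(y)|}{|x-y|^{n+\delta}}\,dy\,dx$$ holds for all measurable functions $u:G\to\mathbb{R}$ with compact support in $G$. (B) The fractional isocapacitary inequality $$|K|^{(n-\delta)/n}\le C\,\mathrm{cap}_{\delta,1}(K,G)$$ holds for every compact set $K$ in $G$. (C) The fractional isoperimetric inequality $$|D|^{(n-\delta)/n}\le 2C\,P_\delta(D,G)$$ holds for every open set $D\subset\subset G$ whose boundary $\partial D$ is an $(n-1)$-dimensional $C^\infty$-manifold in $G$.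
   Context: $|A|$ denotes the Lebesgue $n$-measure of a measurable set $A\subset\mathbb{R}^n$. $D\subset\subset G$ means that the closure $\overline{D}$ is a compact subset of $G$. Double integrals of non-negative functions may take the value $+\infty$. $C_0(G)$ is the family of all continuous functions $u:G\to\mathbb{R}$ with compact support in $G$. For a compact set $K\subset G$, the fractional $(\delta,1)$-capacity is $$\mathrm{cap}_{\delta,1}(K,G)=\inf_u \int_G\int_G\frac{|u(x)-u(y)|}{|x-y|^{n+\delta}}\,dy\,dx,$$ where the infimum is taken over all $u\in C_0(G)$ such that $u(x)\ge 1$ for each $x\in K$. For a measurable set $A\subset G$, the fractional $\delta$-perimeter of $A$ with respect to $G$ is $$P_\delta(A,G)=\int_A\int_{G\setminus A}\frac{1}{|x-y|^{n+\delta}}\,dy\,dx\in[0,\infty].$$ A closed set $\Gamma\subset G$ is an $(n-1)$-dimensional $C^\infty$-manifold in $G$ if for each point $x\in\Gamma$ there exist open sets $U\subset\mathbb{R}^{n-1}$ and $V\subset\mathbb{R}$, a smooth function $g:U\to V$, and a rotation $\psi$ of $\mathbb{R}^n$ about the point $x$, such that $x=\psi(x)\in\psi(U\times V)$ and $\Gamma\cap\psi(U\times V)=\{\psi(y,g(y)) : y\in U\}$. *)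

theory Defs
  imports "HOL-Analysis.Analysis"
begin

text \<open>Throughout, $n$ is \<open>CARD('n)\<close> and $R^n$ is \<open>real ^ 'n\<close>. Integrals of non-negative functions are
  taken in \<open>ennreal\<close>. On the diagonal the kernels below have denominator \<open>0 powr s = 0\<close>, so that
  the value there is \<open>0\<close>; the diagonal is a null set.\<close>

text \<open>The power of an extended non-negative real; only exponents \<open>p > 0\<close> are used.\<close>

definition enn_powr :: "ennreal \<Rightarrow> real \<Rightarrow> ennreal" where
  "enn_powr a p = (if a = \<infinity> then \<infinity> else ennreal (enn2real a powr p))"

definition has_compact_support_in :: "(real ^ 'n) set \<Rightarrow> (real ^ 'n \<Rightarrow> real) \<Rightarrow> bool" where
  "has_compact_support_in G u \<longleftrightarrow>
     compact (closure (support_on G u)) \<and> closure (support_on G u) \<subseteq> G"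

text \<open>A function \<open>u : G \<rightarrow> R\<close> is represented by a total function; its values outside \<open>G\<close> are never used.\<close>

definition C0_functions :: "(real ^ 'n) set \<Rightarrow> (real ^ 'n \<Rightarrow> real) set" where
  "C0_functions G = {u. continuous_on G u \<and> has_compact_support_in G u}"

definition frac_seminorm :: "real \<Rightarrow> (real ^ 'n) set \<Rightarrow> (real ^ 'n \<Rightarrow> real) \<Rightarrow> ennreal" where
  "frac_seminorm \<delta> G u =
     (\<integral>\<^sup>+x\<in>G. (\<integral>\<^sup>+y\<in>G. ennreal (\<bar>u x - u y\<bar> / norm (x - y) powr (real CARD('n) + \<delta>))
        \<partial>lebesgue) \<partial>lebesgue)"

definition frac_capacity :: "real \<Rightarrow> (real ^ 'n) set \<Rightarrow> (real ^ 'n) set \<Rightarrow> ennreal" where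
  "frac_capacity \<delta> K G = (INF u \<in> {u \<in> C0_functions G. \<forall>x\<in>K. 1 \<le> u x}. frac_seminorm \<delta> G u)"

definition frac_perimeter :: "real \<Rightarrow> (real ^ 'n) set \<Rightarrow> (real ^ 'n) set \<Rightarrow> ennreal" where
  "frac_perimeter \<delta> A G =
     (\<integral>\<^sup>+x\<in>A. (\<integral>\<^sup>+y\<in>G - A. ennreal (1 / norm (x - y) powr (real CARD('n) + \<delta>))
        \<partial>lebesgue) \<partial>lebesgue)"

text \<open>\<open>Ck_on m f S\<close> says that \<open>f\<close> is of class $C^m$ on the open set \<open>S\<close>: all iterated partial
  derivatives up to order \<open>m\<close> exist and are continuous.\<close>

fun Ck_on :: "nat \<Rightarrow> ('a::euclidean_space \<Rightarrow> real) \<Rightarrow> 'a set \<Rightarrow> bool" where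
  "Ck_on 0 f S \<longleftrightarrow> continuous_on S f"
| "Ck_on (Suc m) f S \<longleftrightarrow>
     f differentiable_on S \<and> (\<forall>b\<in>Basis. Ck_on m (\<lambda>x. frechet_derivative f (at x) b) S)"

definition smooth_on :: "('a::euclidean_space \<Rightarrow> real) \<Rightarrow> 'a set \<Rightarrow> bool" where
  "smooth_on f S \<longleftrightarrow> (\<forall>m. Ck_on m f S)"

text \<open>The splitting of $R^n$ into $R^{n-1}$ and $R$: having distinguished a coordinate \<open>k\<close>, the
  factor $R^{n-1}$ is the coordinate hyperplane \<open>coord_hyperplane k\<close>, and \<open>(y, t)\<close> is the point
  \<open>y + axis k t\<close>. The index type carries no order, so there is no last coordinate; which \<open>k\<close> is
  distinguished makes no difference to the manifolds defined below, because for $n \ge 2$ rotations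
  carry any coordinate axis to any other.\<close>

definition coord_hyperplane :: "'n::finite \<Rightarrow> (real ^ 'n) set" where
  "coord_hyperplane k = {y. y $ k = 0}"

definition hyperplane_proj :: "'n::finite \<Rightarrow> real ^ 'n \<Rightarrow> real ^ 'n" where
  "hyperplane_proj k z = z - axis k (z $ k)"

definition split_product :: "'n::finite \<Rightarrow> (real ^ 'n) set \<Rightarrow> real set \<Rightarrow> (real ^ 'n) set" where
  "split_product k U V = {y + axis k t | y t. y \<in> U \<and> t \<in> V}"

text \<open>A function \<open>g\<close> on a relatively open subset \<open>U\<close> of the hyperplane is smooth iff the function
  \<open>(y, t) \<mapsto> g y\<close> is smooth on the open cylinder over \<open>U\<close>.\<close>

definition smooth_on_hyperplane ::
    "'n::finite \<Rightarrow> (real ^ 'n \<Rightarrow> real) \<Rightarrow> (real ^ 'n) set \<Rightarrow> bool" where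
  "smooth_on_hyperplane k g U \<longleftrightarrow> smooth_on (\<lambda>z. g (hyperplane_proj k z)) (split_product k U UNIV)"

definition rotation_about :: "real ^ 'n \<Rightarrow> (real ^ 'n \<Rightarrow> real ^ 'n) \<Rightarrow> bool" where
  "rotation_about x \<psi> \<longleftrightarrow> (\<exists>A. rotation_matrix A \<and> (\<forall>z. \<psi> z = x + A *v (z - x)))"

text \<open>\<open>\<Gamma>\<close> is an $(n-1)$-dimensional smooth manifold in \<open>G\<close>; closedness is relative to \<open>G\<close>.\<close>

definition smooth_hypersurface_in :: "(real ^ 'n) set \<Rightarrow> (real ^ 'n) set \<Rightarrow> bool" where
  "smooth_hypersurface_in \<Gamma> G \<longleftrightarrow>
     closedin (top_of_set G) \<Gamma> \<and>
     (\<forall>x\<in>\<Gamma>. \<exists>k U V g \<psi>.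
        openin (top_of_set (coord_hyperplane k)) U \<and> open V \<and>
        g ` U \<subseteq> V \<and> smooth_on_hyperplane k g U \<and>
        rotation_about x \<psi> \<and>
        x \<in> \<psi> ` split_product k U V \<and>
        \<Gamma> \<inter> \<psi> ` split_product k U V = {\<psi> (y + axis k (g y)) | y. y \<in> U})"

definition frac_Sobolev_inequality :: "real \<Rightarrow> (real ^ 'n) set \<Rightarrow> real \<Rightarrow> bool" where
  "frac_Sobolev_inequality \<delta> G C \<longleftrightarrow>
     (\<forall>u. u \<in> borel_measurable (lebesgue_on G) \<and> has_compact_support_in G u \<longrightarrow>
        enn_powr
          (\<integral>\<^sup>+x\<in>G. ennreal (\<bar>u x\<bar> powr (real CARD('n) / (real CARD('n) - \<delta>))) \<partial>lebesgue)
          ((real CARD('n) - \<delta>) / real CARD('n))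
        \<le> ennreal C * frac_seminorm \<delta> G u)"

definition frac_isocapacitary_inequality :: "real \<Rightarrow> (real ^ 'n) set \<Rightarrow> real \<Rightarrow> bool" where
  "frac_isocapacitary_inequality \<delta> G C \<longleftrightarrow>
     (\<forall>K. compact K \<and> K \<subseteq> G \<longrightarrow>
        enn_powr (emeasure lebesgue K) ((real CARD('n) - \<delta>) / real CARD('n))
        \<le> ennreal C * frac_capacity \<delta> K G)"

definition frac_isoperimetric_inequality :: "real \<Rightarrow> (real ^ 'n) set \<Rightarrow> real \<Rightarrow> bool" where
  "frac_isoperimetric_inequality \<delta> G C \<longleftrightarrow>
     (\<forall>D. open D \<and> compact (closure D) \<and> closure D \<subseteq> G \<and> smooth_hypersurface_in (frontier D) G \<longrightarrow>
        enn_powr (emeasure lebesgue D) ((real CARD('n) - \<delta>) / real CARD('n))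
        \<le> ennreal (2 * C) * frac_perimeter \<delta> D G)"

end

theory Submission
  imports Defs
begin

text \<open>
  All three conditions are equivalent to the isoperimetric inequality for arbitrary Borel sets \<open>E\<close>
  contained in a compact subset of \<open>G\<close>. It implies the Sobolev inequality by the coarea formula
  and Hoelder's inequality on the superlevel sets. Conversely, mollify the indicator of \<open>E\<close>: the
  energy of the mollification \<open>f\<close> is at most twice the perimeter of \<open>E\<close> up to a small error,
  since the perimeter in \<open>G\<close> is upper semicontinuous under small translations of \<open>E\<close>.
  Feeding \<open>f\<close> into the capacity gives one implication. For the other, approximate \<open>f\<close> on a large
  ball by a polynomial \<open>P\<close> in the Lipschitz norm; by the coarea formula some superlevel set of \<open>P\<close>
  has perimeter not much larger than that of \<open>E\<close>. Sard's theorem is not needed: after subtracting from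
  \<open>P\<close> a small generic linear form, almost every level is regular, because the image of
  \<open>x \<mapsto> (\<nabla>P x, P x - \<nabla>P x \<bullet> x)\<close> is null, its domain having one dimension less than its target.
\<close>

subsection \<open>The Riesz kernel, energy and perimeter\<close>

text \<open>The factor 2 in front of \<open>C\<close> is the ratio between the energy of an
  indicator, which counts every pair of points in both orders, and the perimeter, which counts it
  once. The obstacle is the diagonal: the kernel of order \<open>p = n + \<delta>\<close> is not
  integrable there, so uniformly close functions may have very different energies. If the difference
  is \<eta>-Lipschitz, however, one power of the distance is gained: the energies then differ by at
  most \<eta> times an integral of the kernel of order \<open>p - 1\<close>, and
  \<open>p - 1 < n\<close> because \<open>\<delta> < 1\<close>. This is why polynomials must
  approximate in the Lipschitz norm. That approximation is one-dimensional. The mollifier is a C^1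
  profile of the squared distance; approximating the derivative of the profile by a polynomial and
  integrating gives Lipschitz control, and convolving a polynomial in the squared distance with an
  indicator gives a polynomial again. A polynomial does not have compact support. It is therefore
  cut off below a small positive level; above that level its superlevel sets inside a large ball
  stay in a compact subset of \<open>G\<close>.\<close>

definition riesz :: "real \<Rightarrow> 'a::real_normed_vector \<Rightarrow> ennreal" where
  "riesz p z = ennreal (1 / norm z powr p)"

text \<open>Integration is over \<open>lborel\<close>, with indicators as factors of the integrand,
  so that Fubini and the measurability prover for products apply. The perimeter is
  \<open>interaction p A (G - A)\<close>.\<close>

definition interaction :: "real \<Rightarrow> 'a::euclidean_space set \<Rightarrow> 'a set \<Rightarrow> ennreal" where
  "interaction p A B = (\<integral>\<^sup>+x. \<integral>\<^sup>+y. indicator A x * indicator B y * riesz p (x - y) \<partial>lborel \<partial>lborel)"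

definition energy :: "real \<Rightarrow> 'a::euclidean_space set \<Rightarrow> ('a \<Rightarrow> real) \<Rightarrow> ennreal" where
  "energy p G u = (\<integral>\<^sup>+x. \<integral>\<^sup>+y. indicator G x * indicator G y * ennreal \<bar>u x - u y\<bar> * riesz p (x - y)
     \<partial>lborel \<partial>lborel)"

lemma borel_measurable_riesz [measurable]:
  "riesz p \<in> borel_measurable (borel :: 'a::euclidean_space measure)"
  unfolding riesz_def by measurable

lemma riesz_minus_commute: "riesz p (x - y) = riesz p (y - x)"
  by (simp add: riesz_def norm_minus_commute)

lemma riesz_pred: "z \<noteq> 0 \<Longrightarrow> ennreal (norm z) * riesz p z = riesz (p - 1) z"
  by (simp add: riesz_def ennreal_mult'[symmetric] powr_diff)

lemma riesz_pred_le: "ennreal (norm z) * riesz p z \<le> riesz (p - 1) z"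
  by (cases "z = 0") (auto simp: riesz_pred)

text \<open>An \<open>nn_integral\<close> is a supremum over simple functions, and completing the
  measure changes these only on null sets. Hence the passage from \<open>lebesgue\<close> to
  \<open>lborel\<close> is valid for arbitrary \<open>u\<close>.\<close>

lemma frac_seminorm_eq_energy:
  fixes G :: "(real ^ 'n) set"
  shows "frac_seminorm \<delta> G u = energy (real CARD('n) + \<delta>) G u"
proof -
  have 1: "(\<integral>\<^sup>+y. indicator G x * indicator G y * ennreal \<bar>u x - u y\<bar> * riesz (real CARD('n) + \<delta>) (x - y) \<partial>lborel)
     = (\<integral>\<^sup>+y\<in>G. ennreal (\<bar>u x - u y\<bar> / norm (x - y) powr (real CARD('n) + \<delta>)) \<partial>lborel) * indicator G x" for x
    by (cases "x \<in> G") (auto intro!: nn_integral_cong simp: riesz_def indicator_def ennreal_mult'[symmetric])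
  show ?thesis
    unfolding frac_seminorm_def energy_def 1 by (simp add: nn_integral_completion)
qed

lemma frac_perimeter_eq_interaction:
  fixes G :: "(real ^ 'n) set"
  shows "frac_perimeter \<delta> A G = interaction (real CARD('n) + \<delta>) A (G - A)"
proof -
  have 1: "(\<integral>\<^sup>+y. indicator A x * indicator (G - A) y * riesz (real CARD('n) + \<delta>) (x - y) \<partial>lborel)
     = (\<integral>\<^sup>+y\<in>G - A. ennreal (1 / norm (x - y) powr (real CARD('n) + \<delta>)) \<partial>lborel) * indicator A x" for x
    by (cases "x \<in> A") (auto intro!: nn_integral_cong simp: riesz_def indicator_def)
  show ?thesis
    unfolding frac_perimeter_def interaction_def 1 by (simp add: nn_integral_completion)
qed

lemma lborel_distr_reflect:
  "distr lborel borel (\<lambda>z. c - z) = (lborel :: 'a::euclidean_space measure)"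
  using lborel_affine[of "-1" c] by (simp add: density_1)

lemma nn_integral_lborel_reflect:
  assumes [measurable]: "f \<in> borel_measurable (borel :: 'a::euclidean_space measure)"
  shows "(\<integral>\<^sup>+z. f (c - z) \<partial>lborel) = (\<integral>\<^sup>+z. f z \<partial>lborel)"
  by (subst (2) lborel_distr_reflect[of c, symmetric], subst nn_integral_distr) auto

lemma nn_integral_lborel_translate:
  assumes [measurable]: "f \<in> borel_measurable (borel :: 'a::euclidean_space measure)"
  shows "(\<integral>\<^sup>+z. f (z - c) \<partial>lborel) = (\<integral>\<^sup>+z. f z \<partial>lborel)"
  by (subst (2) lborel_distr_plus[of "-c", symmetric], subst nn_integral_distr) auto

lemma integral_lborel_reflect:
  fixes f :: "'a::euclidean_space \<Rightarrow> real"
  assumes [measurable]: "f \<in> borel_measurable borel"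
  shows "(\<integral>z. f (c - z) \<partial>lborel) = (\<integral>z. f z \<partial>lborel)"
  by (subst (2) lborel_distr_reflect[of c, symmetric], subst integral_distr) auto

section \<open>Integrability of the kernel at infinity and at the origin\<close>

lemma nn_integral_riesz_annulus_le:
  fixes p :: real
  assumes "0 < r" "0 \<le> p"
  shows "(\<integral>\<^sup>+z. indicator {z. r \<le> norm z \<and> norm z \<le> 2 * r} z * riesz p (z::'a::euclidean_space) \<partial>lborel)
    \<le> ennreal (unit_ball_vol DIM('a) * 2 ^ DIM('a) * r powr (DIM('a) - p))"
proof -
  have "(\<integral>\<^sup>+z. indicator {z. r \<le> norm z \<and> norm z \<le> 2 * r} z * riesz p (z::'a) \<partial>lborel)
    \<le> (\<integral>\<^sup>+z. ennreal (1 / r powr p) * indicator (cball 0 (2 * r)) (z::'a) \<partial>lborel)"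
    using assms
    by (intro nn_integral_mono)
       (auto simp: indicator_def riesz_def intro!: ennreal_leI divide_left_mono powr_mono2 mult_pos_pos)
  also have "\<dots> = ennreal (1 / r powr p) * emeasure lborel (cball (0::'a) (2 * r))"
    by (subst nn_integral_cmult_indicator) auto
  also have "\<dots> = ennreal (1 / r powr p) * ennreal (unit_ball_vol DIM('a) * (2 * r) ^ DIM('a))"
    using assms by (subst emeasure_cball) auto
  also have "\<dots> = ennreal (unit_ball_vol DIM('a) * 2 ^ DIM('a) * r powr (DIM('a) - p))"
    using assms by (subst ennreal_mult'[symmetric])
      (auto simp: powr_diff powr_realpow power_mult_distrib field_simps)
  finally show ?thesis .
qed

text \<open>On the annulus of radius r the kernel is at most \<open>r powr (- p)\<close> and the
  volume is of order \<open>r ^ DIM('a)\<close>, so the annuli of radii \<open>r * b ^ i\<close>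
  contribute a geometric series of ratio \<open>b powr (DIM('a) - p)\<close>. Taking
  \<open>b = 2\<close> treats infinity (p above the dimension), \<open>b = 1/2\<close> the origin (p
  below it).\<close>

lemma nn_integral_riesz_annuli_finite:
  fixes p :: real
  assumes "0 < r" "0 \<le> p" "0 < b" "b powr (DIM('a) - p) < 1"
    and S: "S \<subseteq> (\<Union>i. {z. r * b ^ i \<le> norm z \<and> norm z \<le> 2 * (r * b ^ i)})"
  shows "(\<integral>\<^sup>+z. indicator S z * riesz p (z::'a::euclidean_space) \<partial>lborel) < \<infinity>"
proof -
  let ?A = "\<lambda>i. {z::'a. r * b ^ i \<le> norm z \<and> norm z \<le> 2 * (r * b ^ i)}"
  let ?s = "\<lambda>i::nat. unit_ball_vol DIM('a) * 2 ^ DIM('a) * r powr (DIM('a) - p) * (b powr (DIM('a) - p)) ^ i"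
  have "(\<integral>\<^sup>+z. indicator S z * riesz p (z::'a) \<partial>lborel)
    \<le> (\<integral>\<^sup>+z. (\<Sum>i. indicator (?A i) z * riesz p z) \<partial>lborel)"
  proof (intro nn_integral_mono)
    fix z :: 'a
    show "indicator S z * riesz p z \<le> (\<Sum>i. indicator (?A i) z * riesz p z)"
    proof (cases "z \<in> S")
      case True
      then obtain i where i: "z \<in> ?A i" using S by blast
      have "(\<Sum>i\<in>{i}. indicator (?A i) z * riesz p z) \<le> (\<Sum>i. indicator (?A i) z * riesz p z)"
        by (intro sum_le_suminf) auto
      with i True show ?thesis by simp
    qed simp
  qed
  also have "\<dots> = (\<Sum>i. \<integral>\<^sup>+z. indicator (?A i) z * riesz p z \<partial>lborel)"
    by (intro nn_integral_suminf) measurable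
  also have "\<dots> \<le> (\<Sum>i. ennreal (?s i))"
  proof (intro suminf_le)
    fix i
    have e: "(r * b ^ i) powr (DIM('a) - p) = r powr (DIM('a) - p) * (b powr (DIM('a) - p)) ^ i"
      using assms by (simp add: powr_mult powr_powr powr_realpow[symmetric] mult_ac)
    show "(\<integral>\<^sup>+z. indicator (?A i) z * riesz p z \<partial>lborel) \<le> ennreal (?s i)"
      using nn_integral_riesz_annulus_le[of "r * b ^ i" p, where 'a='a] assms by (simp add: e mult_ac)
  qed auto
  also have "\<dots> = ennreal (\<Sum>i. ?s i)"
    using assms by (intro suminf_ennreal2) (auto intro!: summable_mult summable_geometric)
  also have "\<dots> < \<infinity>" by simp
  finally show ?thesis .
qed

lemma riesz_integrable_at_infinity:
  assumes "real DIM('a) < p" "0 < d"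
  shows "(\<integral>\<^sup>+z. indicator {z. d \<le> norm z} z * riesz p (z::'a::euclidean_space) \<partial>lborel) < \<infinity>"
proof (rule nn_integral_riesz_annuli_finite[of d p 2])
  show "{z::'a. d \<le> norm z} \<subseteq> (\<Union>i. {z. d * 2 ^ i \<le> norm z \<and> norm z \<le> 2 * (d * 2 ^ i)})"
  proof
    fix z :: 'a assume "z \<in> {z. d \<le> norm z}"
    then have z: "1 \<le> norm z / d" using \<open>0 < d\<close> by simp
    define i where "i = nat \<lfloor>log 2 (norm z / d)\<rfloor>"
    have l: "0 \<le> log 2 (norm z / d)" using z by simp
    have "real i \<le> log 2 (norm z / d)" "log 2 (norm z / d) \<le> real i + 1"
      using l unfolding i_def by linarith+
    then have "2 powr real i \<le> norm z / d" "norm z / d \<le> 2 powr (real i + 1)"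
      using z by (simp_all add: le_log_iff log_le_iff)
    then show "z \<in> (\<Union>i. {z. d * 2 ^ i \<le> norm z \<and> norm z \<le> 2 * (d * 2 ^ i)})"
      using \<open>0 < d\<close> by (intro UN_I[of i]) (auto simp: powr_realpow powr_add field_simps)
  qed
  have "2 powr (DIM('a) - p) < 2 powr 0" using assms by (intro powr_less_mono) auto
  then show "2 powr (DIM('a) - p) < 1" by simp
  show "0 \<le> p" using assms by (meson le_less_trans less_imp_le of_nat_0_le_iff)
qed (use assms in auto)

lemma riesz_locally_integrable:
  assumes "0 \<le> p" "p < real DIM('a)" "0 < d"
  shows "(\<integral>\<^sup>+z. indicator (cball 0 d) z * riesz p (z::'a::euclidean_space) \<partial>lborel) < \<infinity>"
proof -
  \<comment> \<open>The origin lies in none of the shrinking annuli and is removed as a null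
    set.\<close>
  have "(\<integral>\<^sup>+z. indicator (cball 0 d) z * riesz p (z::'a) \<partial>lborel)
    = (\<integral>\<^sup>+z. indicator (cball 0 d - {0}) z * riesz p (z::'a) \<partial>lborel)"
    by (intro nn_integral_cong_AE AE_I[of _ _ "{0}"]) (auto simp: indicator_def)
  also have "\<dots> < \<infinity>"
  proof (rule nn_integral_riesz_annuli_finite[of d p "1/2"])
    show "cball 0 d - {0} \<subseteq> (\<Union>i. {z::'a. d * (1/2) ^ i \<le> norm z \<and> norm z \<le> 2 * (d * (1/2) ^ i)})"
    proof
      fix z :: 'a assume z: "z \<in> cball 0 d - {0}"
      then have z: "1 \<le> d / norm z" "0 < norm z" by auto
      define i where "i = nat \<lceil>log 2 (d / norm z)\<rceil>"
      have z': "0 < d / norm z" using \<open>0 < d\<close> z by simp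
      then have l: "0 \<le> log 2 (d / norm z)" using z(1) zero_le_log_cancel_iff[of 2 "d / norm z"] by linarith
      have "real i - 1 \<le> log 2 (d / norm z)" "log 2 (d / norm z) \<le> real i"
        using l unfolding i_def by linarith+
      then have "2 powr (real i - 1) \<le> d / norm z" "d / norm z \<le> 2 powr real i"
        using z' by (simp_all add: le_log_iff log_le_iff)
      then show "z \<in> (\<Union>i. {z. d * (1/2) ^ i \<le> norm z \<and> norm z \<le> 2 * (d * (1/2) ^ i)})"
        using \<open>0 < d\<close> z by (intro UN_I[of i]) (auto simp: powr_realpow powr_diff power_divide field_simps)
    qed
    have "(1/2::real) powr (DIM('a) - p) < (1/2) powr 0" using assms by (intro powr_less_mono') auto
    then show "(1/2::real) powr (DIM('a) - p) < 1" by simp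
  qed (use assms in auto)
  finally show ?thesis .
qed

text \<open>Squeeze \<open>E\<close> between a compact \<open>K\<close> and an open \<open>U\<close>
  with \<open>U - K\<close> of measure at most e/2. A shift shorter than the distance from
  \<open>K\<close> to the complement of \<open>U\<close> can change membership in \<open>E\<close>
  only if x or \<open>x - z\<close> lies in \<open>U - K\<close>.\<close>

lemma translation_continuous_indicator:
  fixes E :: "'a::euclidean_space set"
  assumes E: "E \<in> sets borel" "bounded E" and "0 < e"
  obtains d where "0 < d"
    "\<And>z. norm z < d \<Longrightarrow> (\<integral>\<^sup>+x. ennreal \<bar>indicator E (x - z) - indicator E x\<bar> \<partial>lborel) \<le> ennreal e"
proof -
  have EL: "E \<in> sets lebesgue" using E by auto
  have e4: "0 < e / 4" using \<open>0 < e\<close> by simp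
  obtain K where K: "closed K" "K \<subseteq> E" "E - K \<in> lmeasurable" "emeasure lebesgue (E - K) < ennreal (e/4)"
    by (rule sets_lebesgue_inner_closed[OF EL e4])
  obtain U where U: "open U" "E \<subseteq> U" "U - E \<in> lmeasurable" "emeasure lebesgue (U - E) < ennreal (e/4)"
    by (rule sets_lebesgue_outer_open[OF EL e4])
  have "compact K" using K E(2) bounded_subset compact_eq_bounded_closed by blast
  then obtain d where d: "0 < d" "(\<Union>x\<in>K. ball x d) \<subseteq> U"
    using compact_subset_open_imp_ball_epsilon_subset[of K U] K U by blast
  have [measurable]: "K \<in> sets borel" "U \<in> sets borel" "E \<in> sets borel" using K U E by auto
  have "emeasure lborel (U - K) \<le> emeasure lborel (U - E) + emeasure lborel (E - K)"
    using K U by (intro order_trans[OF emeasure_mono emeasure_subadditive]) auto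
  also have "\<dots> \<le> ennreal (e/4) + ennreal (e/4)"
    using K U by (intro add_mono) auto
  finally have UK: "emeasure lborel (U - K) \<le> ennreal (e/2)"
    using \<open>0 < e\<close> by (simp add: ennreal_plus[symmetric] del: ennreal_plus)
  show thesis
  proof (rule that[OF d(1)])
    fix z :: 'a assume z: "norm z < d"
    have "(\<integral>\<^sup>+x. ennreal \<bar>indicator E (x - z) - indicator E x\<bar> \<partial>lborel)
      \<le> (\<integral>\<^sup>+x. indicator (U - K) x + indicator (U - K) (x - z) \<partial>lborel)"
    proof (intro nn_integral_mono)
      fix x
      have "x \<in> K \<Longrightarrow> x - z \<in> U" using d z by (force simp: dist_norm)
      moreover have "x - z \<in> K \<Longrightarrow> x \<in> U" using d z by (force simp: dist_norm)
      ultimately show "ennreal \<bar>indicator E (x - z) - indicator E x\<bar> \<le> indicator (U - K) x + indicator (U - K) (x - z)"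
        using K U by (auto simp: indicator_def)
    qed
    also have "\<dots> = (\<integral>\<^sup>+x. indicator (U - K) x \<partial>lborel) + (\<integral>\<^sup>+x. indicator (U - K) (x - z) \<partial>lborel)"
      by (intro nn_integral_add) measurable
    also have "\<dots> = emeasure lborel (U - K) + emeasure lborel (U - K)"
      by (subst nn_integral_lborel_translate) auto
    also have "\<dots> \<le> ennreal (e/2) + ennreal (e/2)" by (intro add_mono UK)
    also have "\<dots> = ennreal e" using \<open>0 < e\<close> by (simp add: ennreal_plus[symmetric] del: ennreal_plus)
    finally show "(\<integral>\<^sup>+x. ennreal \<bar>indicator E (x - z) - indicator E x\<bar> \<partial>lborel) \<le> ennreal e" .
  qed
qed

subsection \<open>Mollification of indicator functions\<close>

lemma nn_integral_lborel_double_add: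
  fixes f g :: "'a::euclidean_space \<Rightarrow> 'b::euclidean_space \<Rightarrow> ennreal"
  assumes [measurable]: "(\<lambda>(x, y). f x y) \<in> borel_measurable (lborel \<Otimes>\<^sub>M lborel)"
    "(\<lambda>(x, y). g x y) \<in> borel_measurable (lborel \<Otimes>\<^sub>M lborel)"
  shows "(\<integral>\<^sup>+x. \<integral>\<^sup>+y. f x y + g x y \<partial>lborel \<partial>lborel)
    = (\<integral>\<^sup>+x. \<integral>\<^sup>+y. f x y \<partial>lborel \<partial>lborel) + (\<integral>\<^sup>+x. \<integral>\<^sup>+y. g x y \<partial>lborel \<partial>lborel)"
  by (simp add: nn_integral_add)

lemma nn_integral_lborel_swap:
  fixes f :: "'a::euclidean_space \<Rightarrow> 'b::euclidean_space \<Rightarrow> ennreal"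
  assumes "(\<lambda>(x, y). f x y) \<in> borel_measurable (lborel \<Otimes>\<^sub>M lborel)"
  shows "(\<integral>\<^sup>+x. \<integral>\<^sup>+y. f x y \<partial>lborel \<partial>lborel) = (\<integral>\<^sup>+y. \<integral>\<^sup>+x. f x y \<partial>lborel \<partial>lborel)"
  by (rule lborel_pair.Fubini'[OF assms, symmetric])

lemma nn_integral_convolution_mult:
  fixes h F :: "'a::euclidean_space \<Rightarrow> ennreal"
  assumes [measurable]: "h \<in> borel_measurable borel" "F \<in> borel_measurable borel"
  shows "(\<integral>\<^sup>+x. \<integral>\<^sup>+y. h x * F (x - y) \<partial>lborel \<partial>lborel) = (\<integral>\<^sup>+x. h x \<partial>lborel) * (\<integral>\<^sup>+w. F w \<partial>lborel)"
proof -
  have "(\<integral>\<^sup>+y. h x * F (x - y) \<partial>lborel) = h x * (\<integral>\<^sup>+w. F w \<partial>lborel)" for x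
    by (subst nn_integral_cmult) (auto simp: nn_integral_lborel_reflect)
  then show ?thesis by (simp add: nn_integral_multc)
qed

text \<open>The part of the kernel near the diagonal only sees points of \<open>G\<close> and is translation
  invariant; the remaining part is integrable, so there the \<open>L\<^sup>1\<close>-modulus of continuity enters.\<close>

lemma perimeter_translate_le:
  fixes E G :: "'a::euclidean_space set" and p :: real
  assumes [measurable]: "E \<in> sets borel" "G \<in> sets borel"
    and nbd: "\<And>x y. x \<in> E \<Longrightarrow> dist x y < d \<Longrightarrow> y \<in> G"
  defines "h \<equiv> \<lambda>z x. ennreal \<bar>indicator E (x - z) - indicator E x\<bar>"
    and "F \<equiv> \<lambda>w::'a. indicator {w. d \<le> norm w} w * riesz p w"
  shows "(\<integral>\<^sup>+x. \<integral>\<^sup>+y. indicator E (x - z) * indicator (- E) (y - z) * indicator G y * riesz p (x - y) \<partial>lborel \<partial>lborel)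
    \<le> interaction p E (G - E) + 2 * ((\<integral>\<^sup>+x. h z x \<partial>lborel) * (\<integral>\<^sup>+w. F w \<partial>lborel))"
proof -
  define N where "N = (\<lambda>w::'a. indicator {w. norm w < d} w * riesz p w)"
  have [measurable]: "N \<in> borel_measurable borel" "F \<in> borel_measurable borel" "h z \<in> borel_measurable borel"
    unfolding N_def F_def h_def by measurable
  have NF: "riesz p w = N w + F w" for w by (auto simp: N_def F_def indicator_def)
  \<comment> \<open>In the near part the factor \<open>indicator G y\<close> is dropped, which makes
    it translation invariant. In the far part each shifted indicator is replaced by the unshifted
    one at the cost of \<open>h\<close>.\<close>
  have "(\<integral>\<^sup>+x. \<integral>\<^sup>+y. indicator E (x - z) * indicator (- E) (y - z) * indicator G y * riesz p (x - y) \<partial>lborel \<partial>lborel)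
    \<le> (\<integral>\<^sup>+x. \<integral>\<^sup>+y. (indicator E (x - z) * indicator (- E) (y - z) * N ((x - z) - (y - z))
         + indicator E x * indicator (G - E) y * F (x - y)) + (h z x * F (x - y) + h z y * F (y - x)) \<partial>lborel \<partial>lborel)"
  proof (intro nn_integral_mono)
    fix x y :: 'a
    have "F (y - x) = F (x - y)" by (simp add: F_def riesz_minus_commute norm_minus_commute indicator_def)
    then show "indicator E (x - z) * indicator (- E) (y - z) * indicator G y * riesz p (x - y)
      \<le> (indicator E (x - z) * indicator (- E) (y - z) * N ((x - z) - (y - z))
         + indicator E x * indicator (G - E) y * F (x - y)) + (h z x * F (x - y) + h z y * F (y - x))"
      by (auto simp: NF indicator_def h_def)
  qed
  also have "\<dots> = (\<integral>\<^sup>+x. \<integral>\<^sup>+y. indicator E (x - z) * indicator (- E) (y - z) * N ((x - z) - (y - z)) \<partial>lborel \<partial>lborel)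
         + (\<integral>\<^sup>+x. \<integral>\<^sup>+y. indicator E x * indicator (G - E) y * F (x - y) \<partial>lborel \<partial>lborel)
         + ((\<integral>\<^sup>+x. \<integral>\<^sup>+y. h z x * F (x - y) \<partial>lborel \<partial>lborel) + (\<integral>\<^sup>+x. \<integral>\<^sup>+y. h z y * F (y - x) \<partial>lborel \<partial>lborel))"
    by (subst nn_integral_lborel_double_add, measurable)+
  also have "(\<integral>\<^sup>+x. \<integral>\<^sup>+y. indicator E (x - z) * indicator (- E) (y - z) * N ((x - z) - (y - z)) \<partial>lborel \<partial>lborel)
      = (\<integral>\<^sup>+x. \<integral>\<^sup>+y. indicator E (x - z) * indicator (- E) y * N ((x - z) - y) \<partial>lborel \<partial>lborel)"
    by (rule nn_integral_cong,
        rule nn_integral_lborel_translate[where f="\<lambda>y. indicator E (_ - z) * indicator (- E) y * N ((_ - z) - y)"]) measurable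
  also have "\<dots> = (\<integral>\<^sup>+x. \<integral>\<^sup>+y. indicator E x * indicator (- E) y * N (x - y) \<partial>lborel \<partial>lborel)"
    by (rule nn_integral_lborel_translate[where f="\<lambda>x. \<integral>\<^sup>+y. indicator E x * indicator (- E) y * N (x - y) \<partial>lborel"]) measurable
  \<comment> \<open>After shifting back, x lies in \<open>E\<close> and y is closer than d to it, so
    \<open>nbd\<close> restores the factor for \<open>G\<close>.\<close>
  also have "\<dots> = (\<integral>\<^sup>+x. \<integral>\<^sup>+y. indicator E x * indicator (G - E) y * N (x - y) \<partial>lborel \<partial>lborel)"
    using nbd by (intro nn_integral_cong) (auto simp: N_def indicator_def dist_norm)
  also have "(\<integral>\<^sup>+x. \<integral>\<^sup>+y. h z y * F (y - x) \<partial>lborel \<partial>lborel) = (\<integral>\<^sup>+x. \<integral>\<^sup>+y. h z x * F (x - y) \<partial>lborel \<partial>lborel)"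
    by (rule nn_integral_lborel_swap) measurable
  also have "(\<integral>\<^sup>+x. \<integral>\<^sup>+y. indicator E x * indicator (G - E) y * N (x - y) \<partial>lborel \<partial>lborel)
      + (\<integral>\<^sup>+x. \<integral>\<^sup>+y. indicator E x * indicator (G - E) y * F (x - y) \<partial>lborel \<partial>lborel) = interaction p E (G - E)"
    unfolding interaction_def NF
    by (subst nn_integral_lborel_double_add[symmetric]) (measurable, simp add: distrib_left)
  finally show ?thesis
    by (simp add: nn_integral_convolution_mult mult_2)
qed

text \<open>The convolution of \<phi> with the indicator, with the shift placed on the set: this
  exhibits it as a \<phi>-average of indicators of translates of \<open>E\<close>.\<close>

definition mollification :: "('a::euclidean_space \<Rightarrow> real) \<Rightarrow> 'a set \<Rightarrow> 'a \<Rightarrow> real" where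
  "mollification \<phi> E x = (\<integral>z. \<phi> z * indicator E (x - z) \<partial>lborel)"

text \<open>The energy is convex: the increment of an average is at most the average of the
  increments. By Fubini the energy of the mollification is at most the \<phi>-average of the
  energies of the translated indicators.\<close>

lemma energy_mollification_le:
  fixes E G :: "'a::euclidean_space set"
  assumes [measurable]: "E \<in> sets borel" "G \<in> sets borel"
    and \<phi>: "integrable lborel \<phi>" "\<And>z. 0 \<le> \<phi> z"
  shows "energy p G (mollification \<phi> E) \<le> (\<integral>\<^sup>+z. ennreal (\<phi> z) * (2 *
    (\<integral>\<^sup>+x. \<integral>\<^sup>+y. indicator E (x - z) * indicator (- E) (y - z) * indicator G y * riesz p (x - y) \<partial>lborel \<partial>lborel)) \<partial>lborel)"
proof -
  have [measurable]: "\<phi> \<in> borel_measurable borel" using \<phi> by auto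
  have int: "integrable lborel (\<lambda>z. \<phi> z * indicator E (x - z))" for x
    by (rule Bochner_Integration.integrable_bound[OF \<phi>(1)]) (auto simp: indicator_def)
  have diff: "ennreal \<bar>mollification \<phi> E x - mollification \<phi> E y\<bar>
      \<le> (\<integral>\<^sup>+z. ennreal (\<phi> z) * ennreal \<bar>indicator E (x - z) - indicator E (y - z)\<bar> \<partial>lborel)" for x y
  proof -
    have "mollification \<phi> E x - mollification \<phi> E y = (\<integral>z. \<phi> z * indicator E (x - z) - \<phi> z * indicator E (y - z) \<partial>lborel)"
      unfolding mollification_def by (rule Bochner_Integration.integral_diff[symmetric]) (rule int)+
    then have "ennreal \<bar>mollification \<phi> E x - mollification \<phi> E y\<bar>
       \<le> (\<integral>\<^sup>+z. ennreal (norm (\<phi> z * indicator E (x - z) - \<phi> z * indicator E (y - z))) \<partial>lborel)"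
      using integral_norm_bound_ennreal[of lborel "\<lambda>z. \<phi> z * indicator E (x - z) - \<phi> z * indicator E (y - z)"] int by auto
    also have "\<dots> = (\<integral>\<^sup>+z. ennreal (\<phi> z) * ennreal \<bar>indicator E (x - z) - indicator E (y - z)\<bar> \<partial>lborel)"
      using \<phi> by (intro nn_integral_cong) (simp add: ennreal_mult'[symmetric] abs_mult right_diff_distrib[symmetric])
    finally show ?thesis .
  qed
  let ?g = "\<lambda>x y z. indicator G x * indicator G y * (ennreal (\<phi> z) * ennreal \<bar>indicator E (x - z) - indicator E (y - z)\<bar>) * riesz p (x - y)"
  let ?q = "\<lambda>x y z. indicator E (x - z) * indicator (- E) (y - z) * indicator G y * riesz p (x - y)"
  have "energy p G (mollification \<phi> E) \<le> (\<integral>\<^sup>+x. \<integral>\<^sup>+y. indicator G x * indicator G y *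
      (\<integral>\<^sup>+z. ennreal (\<phi> z) * ennreal \<bar>indicator E (x - z) - indicator E (y - z)\<bar> \<partial>lborel) * riesz p (x - y) \<partial>lborel \<partial>lborel)"
    unfolding energy_def by (intro nn_integral_mono mult_mono diff) auto
  also have "\<dots> = (\<integral>\<^sup>+x. \<integral>\<^sup>+y. \<integral>\<^sup>+z. ?g x y z \<partial>lborel \<partial>lborel \<partial>lborel)"
    by (simp add: nn_integral_cmult nn_integral_multc)
  also have "\<dots> = (\<integral>\<^sup>+x. \<integral>\<^sup>+z. \<integral>\<^sup>+y. ?g x y z \<partial>lborel \<partial>lborel \<partial>lborel)"
    by (intro nn_integral_cong nn_integral_lborel_swap) measurable
  also have "\<dots> = (\<integral>\<^sup>+z. \<integral>\<^sup>+x. \<integral>\<^sup>+y. ?g x y z \<partial>lborel \<partial>lborel \<partial>lborel)"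
    by (intro nn_integral_lborel_swap) measurable
  \<comment> \<open>The two indicators differ iff exactly one of x, y lies in the translate; the two
    possibilities have equal integrals by symmetry, hence the factor 2.\<close>
  also have "\<dots> \<le> (\<integral>\<^sup>+z. \<integral>\<^sup>+x. \<integral>\<^sup>+y. ennreal (\<phi> z) * ?q x y z + ennreal (\<phi> z) * ?q y x z \<partial>lborel \<partial>lborel \<partial>lborel)"
    by (intro nn_integral_mono) (auto simp: indicator_def riesz_minus_commute)
  also have "\<dots> = (\<integral>\<^sup>+z. (\<integral>\<^sup>+x. \<integral>\<^sup>+y. ennreal (\<phi> z) * ?q x y z \<partial>lborel \<partial>lborel)
       + (\<integral>\<^sup>+x. \<integral>\<^sup>+y. ennreal (\<phi> z) * ?q y x z \<partial>lborel \<partial>lborel) \<partial>lborel)"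
    by (intro nn_integral_cong nn_integral_lborel_double_add) measurable
  also have "\<dots> = (\<integral>\<^sup>+z. (\<integral>\<^sup>+x. \<integral>\<^sup>+y. ennreal (\<phi> z) * ?q x y z \<partial>lborel \<partial>lborel)
       + (\<integral>\<^sup>+x. \<integral>\<^sup>+y. ennreal (\<phi> z) * ?q x y z \<partial>lborel \<partial>lborel) \<partial>lborel)"
    by (intro nn_integral_cong arg_cong2[of _ _ _ _ "(+)"] refl nn_integral_lborel_swap) measurable
  also have "\<dots> = (\<integral>\<^sup>+z. ennreal (\<phi> z) * (2 * (\<integral>\<^sup>+x. \<integral>\<^sup>+y. ?q x y z \<partial>lborel \<partial>lborel)) \<partial>lborel)"
    by (simp add: nn_integral_cmult mult_2 distrib_left)
  finally show ?thesis .
qed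

text \<open>As \<phi> has integral 1, \<open>indicator E x\<close> is the \<phi>-average of a
  constant, and the same averaging argument applies.\<close>

lemma mollification_L1_le:
  fixes E :: "'a::euclidean_space set"
  assumes [measurable]: "E \<in> sets borel"
    and \<phi>: "integrable lborel \<phi>" "\<And>z. 0 \<le> \<phi> z" "(\<integral>z. \<phi> z \<partial>lborel) = 1"
  shows "(\<integral>\<^sup>+x. ennreal \<bar>mollification \<phi> E x - indicator E x\<bar> \<partial>lborel)
    \<le> (\<integral>\<^sup>+z. ennreal (\<phi> z) * (\<integral>\<^sup>+x. ennreal \<bar>indicator E (x - z) - indicator E x\<bar> \<partial>lborel) \<partial>lborel)"
proof -
  have [measurable]: "\<phi> \<in> borel_measurable borel" using \<phi> by auto
  have int: "integrable lborel (\<lambda>z. \<phi> z * indicator E (x - z))" for x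
    by (rule Bochner_Integration.integrable_bound[OF \<phi>(1)]) (auto simp: indicator_def)
  have diff: "ennreal \<bar>mollification \<phi> E x - indicator E x\<bar>
      \<le> (\<integral>\<^sup>+z. ennreal (\<phi> z) * ennreal \<bar>indicator E (x - z) - indicator E x\<bar> \<partial>lborel)" for x
  proof -
    have "mollification \<phi> E x - indicator E x = (\<integral>z. \<phi> z * indicator E (x - z) - \<phi> z * indicator E x \<partial>lborel)"
      unfolding mollification_def using \<phi> by (subst Bochner_Integration.integral_diff) (auto intro: int)
    then have "ennreal \<bar>mollification \<phi> E x - indicator E x\<bar>
       \<le> (\<integral>\<^sup>+z. ennreal (norm (\<phi> z * indicator E (x - z) - \<phi> z * indicator E x)) \<partial>lborel)"
      using integral_norm_bound_ennreal[of lborel "\<lambda>z. \<phi> z * indicator E (x - z) - \<phi> z * indicator E x"] int \<phi> by auto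
    also have "\<dots> = (\<integral>\<^sup>+z. ennreal (\<phi> z) * ennreal \<bar>indicator E (x - z) - indicator E x\<bar> \<partial>lborel)"
      using \<phi> by (intro nn_integral_cong) (simp add: ennreal_mult'[symmetric] abs_mult right_diff_distrib[symmetric])
    finally show ?thesis .
  qed
  have "(\<integral>\<^sup>+x. ennreal \<bar>mollification \<phi> E x - indicator E x\<bar> \<partial>lborel)
    \<le> (\<integral>\<^sup>+x. \<integral>\<^sup>+z. ennreal (\<phi> z) * ennreal \<bar>indicator E (x - z) - indicator E x\<bar> \<partial>lborel \<partial>lborel)"
    by (intro nn_integral_mono diff)
  also have "\<dots> = (\<integral>\<^sup>+z. \<integral>\<^sup>+x. ennreal (\<phi> z) * ennreal \<bar>indicator E (x - z) - indicator E x\<bar> \<partial>lborel \<partial>lborel)"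
    by (intro nn_integral_lborel_swap) measurable
  also have "\<dots> = (\<integral>\<^sup>+z. ennreal (\<phi> z) * (\<integral>\<^sup>+x. ennreal \<bar>indicator E (x - z) - indicator E x\<bar> \<partial>lborel) \<partial>lborel)"
    by (simp add: nn_integral_cmult)
  finally show ?thesis .
qed

text \<open>Squaring the positive part makes the profile a C^1 function of the squared norm. The use
  of the squared norm, itself a polynomial, is what later turns convolutions of polynomial profiles
  into polynomials.\<close>

definition bump :: "real \<Rightarrow> 'a::euclidean_space \<Rightarrow> real" where
  "bump \<epsilon> z = (max 0 (1 - (norm z)\<^sup>2 / \<epsilon>\<^sup>2))\<^sup>2"

definition mollifier :: "real \<Rightarrow> 'a::euclidean_space \<Rightarrow> real" where
  "mollifier \<epsilon> z = bump \<epsilon> z / (\<integral>z. bump \<epsilon> (z::'a) \<partial>lborel)"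

lemma continuous_on_bump [continuous_intros]:
  "continuous_on S g \<Longrightarrow> continuous_on S (\<lambda>x. bump \<epsilon> (g x :: 'a::euclidean_space))"
  unfolding bump_def by (cases "\<epsilon> = 0") (auto intro!: continuous_intros)

lemma bump_nonneg: "0 \<le> bump \<epsilon> z" by (simp add: bump_def)

lemma bump_eq_0: "0 < \<epsilon> \<Longrightarrow> \<epsilon> \<le> norm z \<Longrightarrow> bump \<epsilon> z = 0"
  by (simp add: bump_def max_def power_mono)

lemma bump_le_1: "bump \<epsilon> z \<le> 1"
  unfolding bump_def by (rule power_le_one) auto

lemma borel_measurable_bump [measurable]: "bump \<epsilon> \<in> borel_measurable (borel :: 'a::euclidean_space measure)"
  by (intro borel_measurable_continuous_onI continuous_intros)

lemma integrable_indicator_bounded: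
  "E \<in> sets borel \<Longrightarrow> bounded E \<Longrightarrow> integrable lborel (indicator E :: 'a::euclidean_space \<Rightarrow> real)"
  by (intro integrable_real_indicator) (auto dest: emeasure_bounded_finite)

lemma integrable_bump: "0 < \<epsilon> \<Longrightarrow> integrable lborel (bump \<epsilon> :: 'a::euclidean_space \<Rightarrow> real)"
proof (rule Bochner_Integration.integrable_bound[of _ "indicator (cball 0 \<epsilon>) :: 'a \<Rightarrow> real"])
  show "integrable lborel (indicator (cball 0 \<epsilon>) :: 'a \<Rightarrow> real)"
    by (intro integrable_indicator_bounded) auto
  assume "0 < \<epsilon>"
  then show "AE z in lborel. norm (bump \<epsilon> z) \<le> norm (indicator (cball 0 \<epsilon>) (z::'a) :: real)"
    by (intro AE_I2) (auto simp: bump_nonneg bump_le_1 bump_eq_0 indicator_def)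
qed auto

lemma integral_bump_pos:
  assumes "0 < \<epsilon>" shows "0 < (\<integral>z. bump \<epsilon> (z::'a::euclidean_space) \<partial>lborel)"
proof -
  \<comment> \<open>The value at norm \<epsilon>/2 is \<open>(1 - 1/4)\<^sup>2 = 9/16\<close>, a
    lower bound on the half ball.\<close>
  have "0 < (\<integral>z. indicator (ball (0::'a) (\<epsilon>/2)) z * (9/16::real) \<partial>lborel)"
    using assms content_ball_pos[of "\<epsilon>/2" "0::'a"] by simp
  also have "\<dots> \<le> (\<integral>z. bump \<epsilon> (z::'a) \<partial>lborel)"
  proof (rule integral_mono)
    show "integrable lborel (\<lambda>z. indicator (ball (0::'a) (\<epsilon>/2)) z * (9/16::real))"
      by (intro integrable_mult_left integrable_indicator_bounded) auto
    show "indicator (ball (0::'a) (\<epsilon>/2)) z * (9/16) \<le> bump \<epsilon> z" for z :: 'a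
    proof (cases "z \<in> ball (0::'a) (\<epsilon>/2)")
      case True
      then have "norm z \<le> \<epsilon> / 2" by simp
      then have "(norm z)\<^sup>2 \<le> (\<epsilon>/2)\<^sup>2" by (intro power_mono) auto
      then have "(norm z)\<^sup>2 / \<epsilon>\<^sup>2 \<le> 1/4" using assms by (simp add: field_simps)
      then have "3/4 \<le> max 0 (1 - (norm z)\<^sup>2 / \<epsilon>\<^sup>2)" by linarith
      then have "(3/4)\<^sup>2 \<le> bump \<epsilon> z" unfolding bump_def by (rule power_mono) simp
      with True show ?thesis by (simp add: power2_eq_square)
    qed (simp add: bump_nonneg)
  qed (use assms integrable_bump in auto)
  finally show ?thesis .
qed

lemma mollifier:
  assumes "0 < \<epsilon>"
  shows "integrable lborel (mollifier \<epsilon> :: 'a::euclidean_space \<Rightarrow> real)"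
    and "0 \<le> mollifier \<epsilon> (z::'a)"
    and "(\<integral>z. mollifier \<epsilon> (z::'a) \<partial>lborel) = 1"
    and "\<epsilon> \<le> norm (z::'a) \<Longrightarrow> mollifier \<epsilon> z = 0"
    and "continuous_on UNIV (mollifier \<epsilon> :: 'a \<Rightarrow> real)"
  using assms integral_bump_pos[OF assms, where 'a='a] integrable_bump[OF assms, where 'a='a] bump_eq_0[OF assms, of z]
  unfolding mollifier_def by (auto simp: bump_nonneg intro!: continuous_intros)

text \<open>The substitution \<open>y = x - z\<close> moves the variable x from the set into the
  kernel, where continuity and polynomial approximation are available.\<close>

lemma mollification_conv:
  fixes E :: "'a::euclidean_space set"
  assumes [measurable]: "E \<in> sets borel" "\<phi> \<in> borel_measurable borel"
  shows "mollification \<phi> E x = (\<integral>y. indicator E y * \<phi> (x - y) \<partial>lborel)"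
proof -
  have "(\<integral>y. indicator E y * \<phi> (x - y) \<partial>lborel) = (\<integral>z. indicator E (x - z) * \<phi> (x - (x - z)) \<partial>lborel)"
    by (rule integral_lborel_reflect[of "\<lambda>y. indicator E y * \<phi> (x - y)" x, symmetric]) measurable
  then show ?thesis by (simp add: mollification_def mult.commute)
qed

lemma mollification_range:
  assumes [measurable]: "E \<in> sets borel" and "0 < \<epsilon>"
  shows "0 \<le> mollification (mollifier \<epsilon>) E (x :: 'a::euclidean_space)" "mollification (mollifier \<epsilon>) E x \<le> 1"
proof -
  note m = mollifier[OF \<open>0 < \<epsilon>\<close>, where 'a='a]
  have [measurable]: "mollifier \<epsilon> \<in> borel_measurable (borel :: 'a measure)" using m(1) by auto
  have i: "integrable lborel (\<lambda>z. mollifier \<epsilon> z * indicator E (x - z))"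
    using m(2) by (intro Bochner_Integration.integrable_bound[OF m(1)]) (auto simp: indicator_def)
  have "mollification (mollifier \<epsilon>) E x \<le> (\<integral>z. mollifier \<epsilon> (z::'a) \<partial>lborel)"
    unfolding mollification_def by (intro integral_mono) (use i m in \<open>auto simp: indicator_def\<close>)
  then show "mollification (mollifier \<epsilon>) E x \<le> 1" unfolding m(3) .
  show "0 \<le> mollification (mollifier \<epsilon>) E x"
    unfolding mollification_def using m
    by (intro Bochner_Integration.integral_nonneg) auto
qed

lemma mollification_support:
  assumes "0 < \<epsilon>" "mollification (mollifier \<epsilon>) E x \<noteq> 0"
  obtains y where "y \<in> E" "dist y x < \<epsilon>"
proof -
  have "\<exists>z. mollifier \<epsilon> z * indicator E (x - z) \<noteq> (0::real)"
    using assms(2) unfolding mollification_def by (metis (no_types, lifting) Bochner_Integration.integral_zero Bochner_Integration.integral_cong)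
  then obtain z where "mollifier \<epsilon> z \<noteq> 0" "x - z \<in> E" by (auto simp: indicator_def split: if_splits)
  with mollifier(4)[OF \<open>0 < \<epsilon>\<close>, of z] show thesis
    by (intro that[of "x - z"]) (auto simp: dist_norm norm_minus_commute not_le[symmetric])
qed

lemma integrable_indicator_mult_bounded:
  fixes E :: "'a::euclidean_space set" and h :: "'a \<Rightarrow> real"
  assumes [measurable]: "E \<in> sets borel" "h \<in> borel_measurable borel"
    and "bounded E" "\<And>y. y \<in> E \<Longrightarrow> \<bar>h y\<bar> \<le> B"
  shows "integrable lborel (\<lambda>y. indicator E y * h y)"
proof (rule Bochner_Integration.integrable_bound[of _ "\<lambda>y. indicator E y * B"])
  show "integrable lborel (\<lambda>y. indicator E y * B)"
    using assms by (intro integrable_mult_left integrable_indicator_bounded) auto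
  show "AE y in lborel. norm (indicator E y * h y) \<le> norm (indicator E y * B)"
    using assms(4) by (intro AE_I2) (auto simp: indicator_def intro: order_trans[OF _ abs_ge_self])
qed auto

lemma continuous_on_mollification:
  fixes E :: "'a::euclidean_space set"
  assumes [measurable]: "E \<in> sets borel" and "bounded E" "0 < \<epsilon>"
  shows "continuous_on UNIV (mollification (mollifier \<epsilon>) E)"
proof -
  have c: "continuous_on UNIV (mollifier \<epsilon> :: 'a \<Rightarrow> real)" by (rule mollifier) fact
  have [measurable]: "mollifier \<epsilon> \<in> borel_measurable (borel :: 'a measure)"
    using c by (rule borel_measurable_continuous_onI)
  define B where "B = 1 / (\<integral>z. bump \<epsilon> (z::'a) \<partial>lborel)"
  have B: "\<bar>mollifier \<epsilon> z\<bar> \<le> B" for z :: 'a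
    unfolding mollifier_def B_def using integral_bump_pos[OF \<open>0 < \<epsilon>\<close>, where 'a='a] bump_le_1[of \<epsilon> z] bump_nonneg[of \<epsilon> z]
    by (simp add: divide_right_mono)
  show ?thesis
    unfolding continuous_on_sequentially
  proof safe
    fix X :: "nat \<Rightarrow> 'a" and x assume X: "X \<longlonglongrightarrow> x"
    have "(\<lambda>n. \<integral>y. indicator E y * mollifier \<epsilon> (X n - y) \<partial>lborel) \<longlonglongrightarrow> (\<integral>y. indicator E y * mollifier \<epsilon> (x - y) \<partial>lborel)"
    proof (rule integral_dominated_convergence[where w="\<lambda>y. indicator E y * B"])
      show "integrable lborel (\<lambda>y. indicator E y * B)"
        using integrable_indicator_mult_bounded[of E "\<lambda>_. B" "\<bar>B\<bar>"] \<open>bounded E\<close> by simp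
      show "AE y in lborel. (\<lambda>n. indicator E y * mollifier \<epsilon> (X n - y)) \<longlonglongrightarrow> indicator E y * mollifier \<epsilon> (x - y)"
      proof (intro AE_I2 tendsto_intros)
        fix y
        have "isCont (mollifier \<epsilon>) (x - y)" using c by (simp add: continuous_on_eq_continuous_at)
        then show "(\<lambda>n. mollifier \<epsilon> (X n - y)) \<longlonglongrightarrow> mollifier \<epsilon> (x - y)"
          by (rule isCont_tendsto_compose) (intro tendsto_intros X)
      qed
      show "AE y in lborel. norm (indicator E y * mollifier \<epsilon> (X n - y)) \<le> indicator E y * B" for n
        using B by (intro AE_I2) (auto simp: indicator_def)
    qed auto
    then show "(mollification (mollifier \<epsilon>) E \<circ> X) \<longlonglongrightarrow> mollification (mollifier \<epsilon>) E x"
      by (simp add: mollification_conv comp_def)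
  qed
qed

text \<open>The closed neighbourhood is the Minkowski sum of \<open>K\<close> and a closed
  ball.\<close>

lemma compact_cball_neighborhood:
  fixes K :: "'a::euclidean_space set"
  assumes "compact K" shows "compact (\<Union>x\<in>K. cball x e)"
proof -
  have "(\<Union>x\<in>K. cball x e) = {x + y |x y. x \<in> K \<and> y \<in> cball 0 e}"
    by (auto simp: dist_norm) (metis add_diff_cancel_left' diff_add_cancel norm_minus_commute add.commute)+
  then show ?thesis using compact_sums[OF assms compact_cball[of 0 e]] by simp
qed

lemma mollification_approx:
  fixes E G K :: "'a::euclidean_space set"
  assumes [measurable]: "E \<in> sets borel" and "open G" "compact K" "E \<subseteq> K" "K \<subseteq> G"
    and p: "real DIM('a) < p" and "0 < e"
  obtains \<epsilon> where "0 < \<epsilon>" "(\<Union>x\<in>K. cball x \<epsilon>) \<subseteq> G"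
    "energy p G (mollification (mollifier \<epsilon>) E) \<le> 2 * interaction p E (G - E) + ennreal e"
    "(\<integral>\<^sup>+x. ennreal \<bar>mollification (mollifier \<epsilon>) E x - indicator E x\<bar> \<partial>lborel) \<le> ennreal e"
proof -
  have [measurable]: "G \<in> sets borel" using \<open>open G\<close> by simp
  obtain d where d: "0 < d" "(\<Union>x\<in>K. cball x d) \<subseteq> G"
    using compact_subset_open_imp_cball_epsilon_subset[of K G] assms by blast
  define M where "M = (\<integral>\<^sup>+w. indicator {w. d \<le> norm w} w * riesz p (w::'a) \<partial>lborel)"
  have "M < \<infinity>" unfolding M_def by (rule riesz_integrable_at_infinity[OF p d(1)])
  then obtain m where m: "M = ennreal m" "0 \<le> m" by (cases M) auto
  \<comment> \<open>The far-part error is \<open>4 * m * e'\<close>: one factor 2 comes from the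
    energy, the other from \<open>perimeter_translate_le\<close>. The summand 1 covers
    \<open>m = 0\<close> and also yields \<open>e' \<le> e\<close>.\<close>
  define e' where "e' = e / (4 * m + 1)"
  have e': "0 < e'" "e' \<le> e" "4 * m * e' \<le> e"
    using m \<open>0 < e\<close> by (auto simp: e'_def field_simps add_pos_nonneg)
  have "bounded E" using assms compact_imp_bounded bounded_subset by blast
  then obtain d' where d': "0 < d'"
    "\<And>z. norm z < d' \<Longrightarrow> (\<integral>\<^sup>+x. ennreal \<bar>indicator E (x - z) - indicator E x\<bar> \<partial>lborel) \<le> ennreal e'"
    using translation_continuous_indicator[OF assms(1) _ e'(1)] by blast
  define \<epsilon> where "\<epsilon> = min d d'"
  have \<epsilon>: "0 < \<epsilon>" "\<epsilon> \<le> d" "\<epsilon> \<le> d'" using d d' by (auto simp: \<epsilon>_def)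
  \<comment> \<open>The mollifier vanishes for \<open>norm z \<ge> \<epsilon>\<close>, hence for
    \<open>norm z \<ge> d'\<close>, so integrands need comparing only for short shifts.\<close>
  have small: "ennreal (mollifier \<epsilon> z) * a \<le> ennreal (mollifier \<epsilon> z) * b" if "norm z < d' \<Longrightarrow> a \<le> b" for z :: 'a and a b
    using that mollifier(4)[OF \<epsilon>(1), of z] \<epsilon> by (cases "norm z < d'") (auto intro: mult_left_mono)
  have int1: "(\<integral>\<^sup>+z. ennreal (mollifier \<epsilon> z) * c \<partial>(lborel :: 'a measure)) = c" for c
    using mollifier[OF \<epsilon>(1), where 'a='a] by (simp add: nn_integral_multc nn_integral_eq_integral)
  show thesis
  proof
    show "0 < \<epsilon>" by fact
    show "(\<Union>x\<in>K. cball x \<epsilon>) \<subseteq> G" using d \<epsilon> by fastforce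
    have "energy p G (mollification (mollifier \<epsilon>) E) \<le> (\<integral>\<^sup>+z. ennreal (mollifier \<epsilon> z) * (2 *
      (\<integral>\<^sup>+x. \<integral>\<^sup>+y. indicator E (x - z) * indicator (- E) (y - z) * indicator G y * riesz p (x - y) \<partial>lborel \<partial>lborel)) \<partial>lborel)"
      using mollifier[OF \<epsilon>(1)] by (intro energy_mollification_le) auto
    also have "\<dots> \<le> (\<integral>\<^sup>+z. ennreal (mollifier \<epsilon> (z::'a)) * (2 * interaction p E (G - E) + ennreal e) \<partial>lborel)"
    proof (intro nn_integral_mono small)
      fix z :: 'a assume z: "norm z < d'"
      have "(\<integral>\<^sup>+x. \<integral>\<^sup>+y. indicator E (x - z) * indicator (- E) (y - z) * indicator G y * riesz p (x - y) \<partial>lborel \<partial>lborel)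
        \<le> interaction p E (G - E) + 2 * ((\<integral>\<^sup>+x. ennreal \<bar>indicator E (x - z) - indicator E x\<bar> \<partial>lborel) * M)"
        unfolding M_def using d \<open>E \<subseteq> K\<close> by (intro perimeter_translate_le) (auto simp: subset_eq dist_commute)
      also have "\<dots> \<le> interaction p E (G - E) + 2 * (ennreal e' * ennreal m)"
        using d'(2)[OF z] m by (intro add_left_mono mult_left_mono mult_mono) auto
      finally have "2 * (\<integral>\<^sup>+x. \<integral>\<^sup>+y. indicator E (x - z) * indicator (- E) (y - z) * indicator G y * riesz p (x - y) \<partial>lborel \<partial>lborel)
        \<le> 2 * (interaction p E (G - E) + 2 * (ennreal e' * ennreal m))"
        by (rule mult_left_mono) simp
      also have "\<dots> = 2 * interaction p E (G - E) + ennreal (4 * m * e')"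
        using e' m by (simp add: distrib_left ennreal_mult'' ennreal_mult' mult_ac flip: ennreal_numeral) (simp flip: ennreal_mult' mult.assoc)
      also have "\<dots> \<le> 2 * interaction p E (G - E) + ennreal e"
        using e' by (intro add_left_mono ennreal_leI)
      finally show "2 * (\<integral>\<^sup>+x. \<integral>\<^sup>+y. indicator E (x - z) * indicator (- E) (y - z) * indicator G y * riesz p (x - y) \<partial>lborel \<partial>lborel)
        \<le> 2 * interaction p E (G - E) + ennreal e" .
    qed
    finally show "energy p G (mollification (mollifier \<epsilon>) E) \<le> 2 * interaction p E (G - E) + ennreal e"
      unfolding int1 .
    have "(\<integral>\<^sup>+x. ennreal \<bar>mollification (mollifier \<epsilon>) E x - indicator E x\<bar> \<partial>lborel)
      \<le> (\<integral>\<^sup>+z. ennreal (mollifier \<epsilon> z) * (\<integral>\<^sup>+x. ennreal \<bar>indicator E (x - z) - indicator E x\<bar> \<partial>lborel) \<partial>lborel)"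
      using mollifier[OF \<epsilon>(1)] by (intro mollification_L1_le) auto
    also have "\<dots> \<le> (\<integral>\<^sup>+z. ennreal (mollifier \<epsilon> (z::'a)) * ennreal e \<partial>lborel)"
      using d'(2) e' by (intro nn_integral_mono small) (auto intro: order_trans ennreal_leI)
    finally show "(\<integral>\<^sup>+x. ennreal \<bar>mollification (mollifier \<epsilon>) E x - indicator E x\<bar> \<partial>lborel) \<le> ennreal e"
      unfolding int1 .
  qed
qed

subsection \<open>From the isoperimetric to the Sobolev inequality\<close>

text \<open>The positive part of \<open>v x - v y\<close> is the length of the set of levels t with
  \<open>v y \<le> t < v x\<close>, that is, of the levels that separate x from y. Fubini turns the
  integral over t into the one-sided energy, and exchanging x and y gives the other half.\<close>

lemma coarea:
  fixes v :: "'a::euclidean_space \<Rightarrow> real"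
  assumes [measurable]: "v \<in> borel_measurable borel" "G \<in> sets borel"
  shows "2 * (\<integral>\<^sup>+t. interaction p (G \<inter> {x. t < v x}) (G \<inter> {x. v x \<le> t}) \<partial>lborel) = energy p G v"
proof -
  let ?g = "\<lambda>x y. indicator G x * indicator G y * ennreal (v x - v y) * riesz p (x - y)"
  let ?k = "\<lambda>t x y. indicator G x * indicator G y * riesz p (x - y) * indicator {v y..<v x} t"
  have "(\<integral>\<^sup>+t. interaction p (G \<inter> {x. t < v x}) (G \<inter> {x. v x \<le> t}) \<partial>lborel)
    = (\<integral>\<^sup>+t. \<integral>\<^sup>+x. \<integral>\<^sup>+y. ?k t x y \<partial>lborel \<partial>lborel \<partial>lborel)"
    unfolding interaction_def by (intro nn_integral_cong) (auto simp: indicator_def)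
  also have "\<dots> = (\<integral>\<^sup>+x. \<integral>\<^sup>+t. \<integral>\<^sup>+y. ?k t x y \<partial>lborel \<partial>lborel \<partial>lborel)"
  proof (rule nn_integral_lborel_swap)
    \<comment> \<open>The interval has endpoints depending on x and y; written as a conditional, its
      indicator is within reach of \<open>measurable\<close>.\<close>
    have "(\<lambda>(t, x). \<integral>\<^sup>+y. indicator G x * indicator G y * riesz p (x - y) * (if v y \<le> t \<and> t < v x then 1 else 0) \<partial>lborel)
      \<in> borel_measurable (lborel \<Otimes>\<^sub>M lborel)"
      by measurable
    also have "(\<lambda>(t, x). \<integral>\<^sup>+y. indicator G x * indicator G y * riesz p (x - y) * (if v y \<le> t \<and> t < v x then 1 else 0) \<partial>lborel)
      = (\<lambda>(t, x). \<integral>\<^sup>+y. ?k t x y \<partial>lborel)"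
      by (auto simp: fun_eq_iff indicator_def intro!: nn_integral_cong)
    finally show "(\<lambda>(t, x). \<integral>\<^sup>+y. ?k t x y \<partial>lborel) \<in> borel_measurable (lborel \<Otimes>\<^sub>M lborel)" .
  qed
  also have "\<dots> = (\<integral>\<^sup>+x. \<integral>\<^sup>+y. \<integral>\<^sup>+t. ?k t x y \<partial>lborel \<partial>lborel \<partial>lborel)"
  proof (intro nn_integral_cong nn_integral_lborel_swap)
    fix x
    have "(\<lambda>(t, y). indicator G x * indicator G y * riesz p (x - y) * (if v y \<le> t \<and> t < v x then 1 else 0))
      \<in> borel_measurable (lborel \<Otimes>\<^sub>M lborel)"
      by measurable
    also have "(\<lambda>(t, y). indicator G x * indicator G y * riesz p (x - y) * (if v y \<le> t \<and> t < v x then 1 else 0))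
      = (\<lambda>(t, y). ?k t x y)"
      by (auto simp: fun_eq_iff indicator_def)
    finally show "(\<lambda>(t, y). ?k t x y) \<in> borel_measurable (lborel \<Otimes>\<^sub>M lborel)" .
  qed
  also have "\<dots> = (\<integral>\<^sup>+x. \<integral>\<^sup>+y. ?g x y \<partial>lborel \<partial>lborel)"
  proof (intro nn_integral_cong)
    fix x y
    have "(\<integral>\<^sup>+t. indicator {v y..<v x} t \<partial>lborel) = ennreal (v x - v y)"
      by (cases "v y \<le> v x") (auto simp: ennreal_neg)
    then show "(\<integral>\<^sup>+t. ?k t x y \<partial>lborel) = ?g x y"
      by (subst nn_integral_cmult) (auto simp: mult_ac)
  qed
  finally have 1: "(\<integral>\<^sup>+t. interaction p (G \<inter> {x. t < v x}) (G \<inter> {x. v x \<le> t}) \<partial>lborel)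
    = (\<integral>\<^sup>+x. \<integral>\<^sup>+y. ?g x y \<partial>lborel \<partial>lborel)" .
  have "energy p G v = (\<integral>\<^sup>+x. \<integral>\<^sup>+y. ?g x y + ?g y x \<partial>lborel \<partial>lborel)"
    unfolding energy_def
  proof (intro nn_integral_cong)
    fix x y
    have "ennreal \<bar>v x - v y\<bar> = ennreal (v x - v y) + ennreal (v y - v x)"
      by (cases "v x \<le> v y") (auto simp: ennreal_neg abs_if)
    then show "indicator G x * indicator G y * ennreal \<bar>v x - v y\<bar> * riesz p (x - y) = ?g x y + ?g y x"
      by (simp add: riesz_minus_commute[of p y x] algebra_simps)
  qed
  also have "\<dots> = (\<integral>\<^sup>+x. \<integral>\<^sup>+y. ?g x y \<partial>lborel \<partial>lborel) + (\<integral>\<^sup>+x. \<integral>\<^sup>+y. ?g y x \<partial>lborel \<partial>lborel)"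
    by (intro nn_integral_lborel_double_add) measurable
  also have "(\<integral>\<^sup>+x. \<integral>\<^sup>+y. ?g y x \<partial>lborel \<partial>lborel) = (\<integral>\<^sup>+x. \<integral>\<^sup>+y. ?g x y \<partial>lborel \<partial>lborel)"
    by (intro nn_integral_lborel_swap) measurable
  finally show ?thesis unfolding 1 by (simp add: mult_2)
qed

text \<open>Young's inequality with exponents q/(q-1) and q, after inserting powers of a free weight
  l that cancel in the product. The weight is optimised after integration.\<close>

lemma Young_powr_indicator:
  fixes a l q :: real
  assumes "0 \<le> a" "0 < l" "1 < q"
  shows "a powr (q - 1) \<le> (1 - 1/q) * (l * a powr q) + (1/q) * l powr (1 - q)"
proof (cases "a = 0")
  case False
  have "(l * a powr q) powr (1 - 1/q) = l powr (1 - 1/q) * a powr (q - 1)"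
    using assms False by (simp add: powr_mult powr_powr right_diff_distrib)
  moreover have "(l powr (1 - q)) powr (1/q) = l powr (1/q - 1)"
    using assms by (simp add: powr_powr diff_divide_distrib)
  ultimately have "a powr (q - 1) = (l * a powr q) powr (1 - 1/q) * (l powr (1 - q)) powr (1/q)"
    using assms by (simp add: mult.commute mult.left_commute flip: powr_add)
  also have "\<dots> \<le> (1 - 1/q) * (l * a powr q) + (1/q) * l powr (1 - q)"
    using assms False by (intro Youngs_inequality_0) auto
  finally show ?thesis .
qed (use assms in auto)

text \<open>Hoelder's inequality for \<open>v powr (q - 1)\<close> and the indicator of
  \<open>E\<close>, obtained by integrating the weighted Young inequality.\<close>

lemma Holder_powr_indicator:
  fixes v :: "'a::euclidean_space \<Rightarrow> real"
  assumes [measurable]: "v \<in> borel_measurable borel" "E \<in> sets borel"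
    and v: "\<And>x. 0 \<le> v x" and q: "1 < q"
    and E: "emeasure lborel E = ennreal m" "0 \<le> m"
    and L: "(\<integral>\<^sup>+x. ennreal (v x powr q) \<partial>lborel) = ennreal L" "0 < L"
  shows "(\<integral>\<^sup>+x. indicator E x * ennreal (v x powr (q - 1)) \<partial>lborel) \<le> ennreal (m powr (1/q) * L powr (1 - 1/q))"
proof (cases "m = 0")
  \<comment> \<open>For a null set the optimal weight would be 0, which Young's inequality
    excludes.\<close>
  case True
  then have "AE x in lborel. x \<notin> E" using E by (intro AE_not_in) (auto simp: null_sets_def)
  then have "(\<integral>\<^sup>+x. indicator E x * ennreal (v x powr (q - 1)) \<partial>lborel) = (\<integral>\<^sup>+x. 0 \<partial>(lborel :: 'a measure))"
    by (intro nn_integral_cong_AE) (auto elim!: eventually_mono)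
  then show ?thesis by simp
next
  case False
  then have m: "0 < m" using E by simp
  \<comment> \<open>the weight for which both terms of Young's inequality have the same integral, up to \<open>1 - 1/q\<close> and \<open>1/q\<close>\<close>
  define l where "l = (m / L) powr (1/q)"
  have l: "0 < l" using m L by (simp add: l_def)
  have "(\<integral>\<^sup>+x. indicator E x * ennreal (v x powr (q - 1)) \<partial>lborel)
    \<le> (\<integral>\<^sup>+x. ennreal ((1 - 1/q) * l) * ennreal (v x powr q) + ennreal ((1/q) * l powr (1 - q)) * indicator E x \<partial>lborel)"
  proof (intro nn_integral_mono)
    fix x
    show "indicator E x * ennreal (v x powr (q - 1))
      \<le> ennreal ((1 - 1/q) * l) * ennreal (v x powr q) + ennreal ((1/q) * l powr (1 - q)) * indicator E x"
      using Young_powr_indicator[OF v[of x] l q] q l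
      by (cases "x \<in> E") (simp_all add: mult.assoc flip: ennreal_mult' ennreal_plus)
  qed
  also have "\<dots> = ennreal ((1 - 1/q) * l) * ennreal L + ennreal ((1/q) * l powr (1 - q)) * ennreal m"
    using E L by (simp add: nn_integral_add nn_integral_cmult)
  also have "\<dots> = ennreal ((1 - 1/q) * (l * L) + (1/q) * (l powr (1 - q) * m))"
    using q l L m by (simp add: mult.assoc flip: ennreal_mult' ennreal_plus)
  also have "l * L = m powr (1/q) * L powr (1 - 1/q)"
    using m L by (simp add: l_def powr_divide powr_diff)
  also have "l powr (1 - q) = (m / L) powr (1/q - 1)"
    using q by (simp add: l_def powr_powr diff_divide_distrib)
  also have "(m / L) powr (1/q - 1) * m = m powr (1/q) * L powr (1 - 1/q)"
    using m L by (simp add: powr_divide powr_diff)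
  also have "(1 - 1/q) * (m powr (1/q) * L powr (1 - 1/q)) + (1/q) * (m powr (1/q) * L powr (1 - 1/q))
    = m powr (1/q) * L powr (1 - 1/q)"
    by (simp only: distrib_right[symmetric]) simp
  finally show ?thesis .
qed

text \<open>Write the integral L of \<open>v powr q\<close> as the integral over t of
  \<open>v powr (q - 1)\<close> on the set where v exceeds t. Hoelder bounds each slice by
  \<open>L powr (1 - 1/q)\<close> times the 1/q-th power of the measure of that set; the
  isoperimetric inequality and the coarea formula then give
  \<open>L \<le> C * L powr (1 - 1/q) * energy\<close>. Boundedness of v makes L finite, so that the
  power of L can be divided out, and the constant \<open>C\<close> is kept.\<close>

lemma Sobolev_of_isoperimetric_bounded:
  fixes v :: "'a::euclidean_space \<Rightarrow> real"
  assumes [measurable]: "v \<in> borel_measurable borel" "G \<in> sets borel"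
    and v: "\<And>x. 0 \<le> v x" "\<And>x. v x \<le> N" "\<And>x. x \<notin> K \<Longrightarrow> v x = 0"
    and K: "compact K" "K \<subseteq> G" and q: "1 < q" and C: "0 < C"
    and iso: "\<And>E. E \<in> sets borel \<Longrightarrow> E \<subseteq> K \<Longrightarrow>
      ennreal (measure lborel E powr (1/q)) \<le> ennreal (2 * C) * interaction p E (G - E)"
  obtains L where "0 \<le> L" "(\<integral>\<^sup>+x. ennreal (v x powr q) \<partial>lborel) = ennreal L"
    "ennreal (L powr (1/q)) \<le> ennreal C * energy p G v"
proof -
  have [measurable]: "K \<in> sets borel" using K by (simp add: borel_compact)
  have "(\<integral>\<^sup>+x. ennreal (v x powr q) \<partial>lborel) \<le> (\<integral>\<^sup>+x. ennreal (N powr q) * indicator K x \<partial>lborel)"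
    using v q by (intro nn_integral_mono) (auto simp: indicator_def intro!: ennreal_leI powr_mono2)
  also have "\<dots> < \<infinity>"
    using emeasure_bounded_finite[OF compact_imp_bounded[OF K(1)]] by (simp add: nn_integral_cmult ennreal_mult_less_top)
  finally obtain L where L: "0 \<le> L" "(\<integral>\<^sup>+x. ennreal (v x powr q) \<partial>lborel) = ennreal L"
    by (cases "\<integral>\<^sup>+x. ennreal (v x powr q) \<partial>lborel") auto
  show thesis
  proof (cases "L = 0")
    case True then show thesis using L q by (intro that[of L]) auto
  next
    case False
    then have L0: "0 < L" using L by simp
    let ?A = "\<lambda>t. G \<inter> {x. t < v x}" and ?B = "\<lambda>t. G \<inter> {x. v x \<le> t}"
    have "ennreal L = (\<integral>\<^sup>+x. \<integral>\<^sup>+t. indicator {0..<v x} t * ennreal (v x powr (q - 1)) \<partial>lborel \<partial>lborel)"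
      unfolding L(2)[symmetric]
    proof (intro nn_integral_cong)
      fix x
      have "v x powr q = v x * v x powr (q - 1)"
        using v(1)[of x] by (cases "v x = 0") (auto simp: powr_diff)
      then show "ennreal (v x powr q) = (\<integral>\<^sup>+t. indicator {0..<v x} t * ennreal (v x powr (q - 1)) \<partial>lborel)"
        using v(1)[of x] by (simp add: nn_integral_multc ennreal_mult')
    qed
    also have "\<dots> = (\<integral>\<^sup>+t. \<integral>\<^sup>+x. indicator {0..<v x} t * ennreal (v x powr (q - 1)) \<partial>lborel \<partial>lborel)"
    proof (rule nn_integral_lborel_swap)
      have "(\<lambda>(x, t). (if 0 \<le> t \<and> t < v x then 1 else 0) * ennreal (v x powr (q - 1))) \<in> borel_measurable (lborel \<Otimes>\<^sub>M lborel)"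
        by measurable
      also have "(\<lambda>(x, t). (if 0 \<le> t \<and> t < v x then 1 else 0) * ennreal (v x powr (q - 1)))
        = (\<lambda>(x, t). indicator {0..<v x} t * ennreal (v x powr (q - 1)))"
        by (auto simp: fun_eq_iff indicator_def)
      finally show "(\<lambda>(x, t). indicator {0..<v x} t * ennreal (v x powr (q - 1))) \<in> borel_measurable (lborel \<Otimes>\<^sub>M lborel)" .
    qed
    also have "\<dots> \<le> (\<integral>\<^sup>+t. ennreal (2 * C * L powr (1 - 1/q)) * interaction p (?A t) (?B t) \<partial>lborel)"
    proof (intro nn_integral_mono)
      fix t :: real
      show "(\<integral>\<^sup>+x. indicator {0..<v x} t * ennreal (v x powr (q - 1)) \<partial>lborel)
        \<le> ennreal (2 * C * L powr (1 - 1/q)) * interaction p (?A t) (?B t)"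
      \<comment> \<open>For negative t the superlevel set is not contained in \<open>K\<close>, but
        the left-hand side is 0.\<close>
      proof (cases "0 \<le> t")
        case True
        have A: "?A t \<subseteq> K" "?A t = {x. t < v x}" "G - ?A t = ?B t" using True v(3) K(2) by fastforce+
        have Ab: "?A t \<in> sets borel" by measurable
        obtain m where m: "0 \<le> m" "emeasure lborel (?A t) = ennreal m"
          using emeasure_bounded_finite[of "?A t"] bounded_subset[OF compact_imp_bounded[OF K(1)] A(1)]
          by (cases "emeasure lborel (?A t)") auto
        have "(\<integral>\<^sup>+x. indicator {0..<v x} t * ennreal (v x powr (q - 1)) \<partial>lborel)
          = (\<integral>\<^sup>+x. indicator (?A t) x * ennreal (v x powr (q - 1)) \<partial>lborel)"
          using True unfolding A(2) by (intro nn_integral_cong) (auto simp: indicator_def)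
        also have "\<dots> \<le> ennreal (m powr (1/q) * L powr (1 - 1/q))"
          by (rule Holder_powr_indicator) (use Ab v q m L L0 in auto)
        also have "\<dots> = ennreal (L powr (1 - 1/q)) * ennreal (measure lborel (?A t) powr (1/q))"
          using m by (simp add: measure_def ennreal_mult'[symmetric] mult.commute)
        also have "\<dots> \<le> ennreal (L powr (1 - 1/q)) * (ennreal (2 * C) * interaction p (?A t) (?B t))"
          using iso[OF Ab A(1)] unfolding A(3) by (rule mult_left_mono) simp
        also have "\<dots> = ennreal (2 * C * L powr (1 - 1/q)) * interaction p (?A t) (?B t)"
          using C by (simp add: ennreal_mult' mult_ac)
        finally show ?thesis .
      qed simp
    qed
    also have "\<dots> \<le> ennreal (C * L powr (1 - 1/q)) * energy p G v"
    proof -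
      have "(\<integral>\<^sup>+t. ennreal (2 * C * L powr (1 - 1/q)) * interaction p (?A t) (?B t) \<partial>lborel)
        = ennreal (2 * C * L powr (1 - 1/q)) * (\<integral>\<^sup>+t. interaction p (?A t) (?B t) \<partial>lborel)"
      proof (rule nn_integral_cmult)
        have "(\<lambda>t. \<integral>\<^sup>+x. \<integral>\<^sup>+y. indicator G x * indicator G y * riesz p (x - y) * (if v y \<le> t \<and> t < v x then 1 else 0) \<partial>lborel \<partial>lborel)
          \<in> borel_measurable lborel" by measurable
        also have "(\<lambda>t. \<integral>\<^sup>+x. \<integral>\<^sup>+y. indicator G x * indicator G y * riesz p (x - y) * (if v y \<le> t \<and> t < v x then 1 else 0) \<partial>lborel \<partial>lborel)
          = (\<lambda>t. interaction p (?A t) (?B t))"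
          unfolding interaction_def by (intro ext nn_integral_cong) (auto simp: indicator_def)
        finally show "(\<lambda>t. interaction p (?A t) (?B t)) \<in> borel_measurable lborel" .
      qed
      also have "\<dots> = ennreal (C * L powr (1 - 1/q)) * (2 * (\<integral>\<^sup>+t. interaction p (?A t) (?B t) \<partial>lborel))"
        using C by (simp add: ennreal_mult' mult_ac)
      also have "\<dots> = ennreal (C * L powr (1 - 1/q)) * energy p G v"
        by (subst coarea) auto
      finally show ?thesis by simp
    qed
    finally have le: "ennreal L \<le> ennreal (C * L powr (1 - 1/q)) * energy p G v" .
    have "ennreal (L powr (1 - 1/q)) * ennreal (L powr (1/q)) = ennreal L"
      using L0 by (simp flip: ennreal_mult' powr_add)
    also note le
    also have "ennreal (C * L powr (1 - 1/q)) * energy p G v = ennreal (L powr (1 - 1/q)) * (ennreal C * energy p G v)"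
      using C by (simp add: ennreal_mult' mult_ac)
    finally have "ennreal (L powr (1 - 1/q)) * ennreal (L powr (1/q)) \<le> ennreal (L powr (1 - 1/q)) * (ennreal C * energy p G v)" .
    then have "ennreal (L powr (1/q)) \<le> ennreal C * energy p G v"
      using L0 by (subst (asm) ennreal_mult_le_mult_iff) auto
    then show thesis using L by (intro that[of L]) auto
  qed
qed

text \<open>Truncation at height N does not increase the energy, since \<open>min\<close> with a
  constant is 1-Lipschitz; the bounds are uniform in N and pass to the limit by monotone
  convergence.\<close>

lemma Sobolev_of_isoperimetric:
  fixes v :: "'a::euclidean_space \<Rightarrow> real"
  assumes [measurable]: "v \<in> borel_measurable borel" "G \<in> sets borel"
    and v: "\<And>x. 0 \<le> v x" "\<And>x. x \<notin> K \<Longrightarrow> v x = 0"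
    and K: "compact K" "K \<subseteq> G" and q: "1 < q" and C: "0 < C"
    and iso: "\<And>E. E \<in> sets borel \<Longrightarrow> E \<subseteq> K \<Longrightarrow>
      ennreal (measure lborel E powr (1/q)) \<le> ennreal (2 * C) * interaction p E (G - E)"
  shows "enn_powr (\<integral>\<^sup>+x. ennreal (v x powr q) \<partial>lborel) (1/q) \<le> ennreal C * energy p G v"
proof (cases "energy p G v = \<infinity>")
  case True
  then show ?thesis using C by (simp add: ennreal_mult_top)
next
  case False
  then obtain s where s: "0 \<le> s" "energy p G v = ennreal s" by (cases "energy p G v") auto
  have bound: "(\<integral>\<^sup>+x. ennreal (min (v x) (real N) powr q) \<partial>lborel) \<le> ennreal ((C * s) powr q)" for N
  proof -
    obtain L where L: "0 \<le> L" "(\<integral>\<^sup>+x. ennreal (min (v x) (real N) powr q) \<partial>lborel) = ennreal L"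
      "ennreal (L powr (1/q)) \<le> ennreal C * energy p G (\<lambda>x. min (v x) (real N))"
      by (rule Sobolev_of_isoperimetric_bounded[of "\<lambda>x. min (v x) (real N)" G "real N" K q C p])
        (use v K q C iso in auto)
    have "energy p G (\<lambda>x. min (v x) (real N)) \<le> energy p G v"
      unfolding energy_def by (intro nn_integral_mono mult_mono ennreal_leI) auto
    then have "ennreal (L powr (1/q)) \<le> ennreal C * ennreal s"
      using L(3) unfolding s(2) by (meson mult_left_mono order_trans zero_le)
    then have "L powr (1/q) \<le> C * s" using C s by (simp flip: ennreal_mult')
    then have "(L powr (1/q)) powr q \<le> (C * s) powr q" using q by (intro powr_mono2) auto
    then show ?thesis using L q by (simp add: powr_powr ennreal_leI)
  qed
  have "(\<integral>\<^sup>+x. ennreal (v x powr q) \<partial>lborel) \<le> (\<integral>\<^sup>+x. (SUP N::nat. ennreal (min (v x) (real N) powr q)) \<partial>lborel)"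
  proof (intro nn_integral_mono)
    fix x
    obtain N :: nat where "v x \<le> real N" using real_arch_simple by blast
    then show "ennreal (v x powr q) \<le> (SUP N::nat. ennreal (min (v x) (real N) powr q))"
      by (intro SUP_upper2[of N]) (auto simp: min_def)
  qed
  also have "\<dots> = (SUP N::nat. \<integral>\<^sup>+x. ennreal (min (v x) (real N) powr q) \<partial>lborel)"
    using v q by (intro nn_integral_monotone_convergence_SUP)
      (auto simp: incseq_def le_fun_def intro!: ennreal_leI powr_mono2 min.mono)
  also have "\<dots> \<le> ennreal ((C * s) powr q)"
    by (intro SUP_least bound)
  finally have le: "(\<integral>\<^sup>+x. ennreal (v x powr q) \<partial>lborel) \<le> ennreal ((C * s) powr q)" .
  then obtain L where L: "0 \<le> L" "(\<integral>\<^sup>+x. ennreal (v x powr q) \<partial>lborel) = ennreal L"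
    by (cases "\<integral>\<^sup>+x. ennreal (v x powr q) \<partial>lborel") (auto simp: top_unique)
  with le have "L \<le> (C * s) powr q" by (simp add: ennreal_le_iff)
  then have "L powr (1/q) \<le> ((C * s) powr q) powr (1/q)" using L q by (intro powr_mono2) auto
  also have "\<dots> = C * s" using q C s by (simp add: powr_powr)
  finally show ?thesis
    using L C s by (simp add: enn_powr_def ennreal_leI flip: ennreal_mult')
qed

subsection \<open>Regular levels of polynomials\<close>

lemma Ck_on_cong:
  assumes "open S" "\<And>x. x \<in> S \<Longrightarrow> f x = g x" "Ck_on m f S"
  shows "Ck_on m g S"
  using assms(2,3)
proof (induction m arbitrary: f g)
  case 0
  then show ?case by (simp cong: continuous_on_cong)
next
  case (Suc m)
  have fd: "frechet_derivative f (at x) = frechet_derivative g (at x)" if "x \<in> S" for x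
  proof -
    have "f differentiable at x"
      using Suc.prems(2) that \<open>open S\<close> by (simp add: differentiable_on_eq_differentiable_at)
    then show ?thesis
      using that Suc.prems(1) \<open>open S\<close> by (intro frechet_derivative_transform_within_open) auto
  qed
  have "g differentiable_on S"
    using Suc.prems by (auto intro: differentiable_transform_within[of _ _ _ 1] simp: differentiable_on_def)
  moreover have "Ck_on m (\<lambda>x. frechet_derivative g (at x) b) S" if "b \<in> Basis" for b
    using Suc.IH[of "\<lambda>x. frechet_derivative f (at x) b" "\<lambda>x. frechet_derivative g (at x) b"] fd Suc.prems that by simp
  ultimately show ?case by simp
qed

lemma Ck_on_SucD: "Ck_on (Suc m) f S \<Longrightarrow> Ck_on m f S"
proof (induction m arbitrary: f)
  case 0
  then show ?case by (simp add: differentiable_imp_continuous_on)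
next
  case (Suc m)
  then show ?case by (metis Ck_on.simps(2))
qed

lemma Ck_on_const: "Ck_on m (\<lambda>x. c) S"
  by (induction m arbitrary: c) auto

text \<open>Allows an explicit formula for the derivative in place of
  \<open>frechet_derivative\<close>, as the later inductions on the order require.\<close>

lemma Ck_on_Suc_I:
  assumes "open S" "\<And>x. x \<in> S \<Longrightarrow> (f has_derivative f' x) (at x)"
    "\<And>b. b \<in> Basis \<Longrightarrow> Ck_on m (\<lambda>x. f' x b) S"
  shows "Ck_on (Suc m) f S"
proof -
  have "f differentiable_on S"
    using assms(1,2) by (auto simp: differentiable_on_eq_differentiable_at differentiable_def)
  moreover have "Ck_on m (\<lambda>x. frechet_derivative f (at x) b) S" if "b \<in> Basis" for b
    by (rule Ck_on_cong[OF assms(1) _ assms(3)[OF that]]) (use assms(2) frechet_derivative_at in metis)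
  ultimately show ?thesis by simp
qed

lemma Ck_on_linear: "bounded_linear f \<Longrightarrow> open S \<Longrightarrow> Ck_on m f S"
proof (cases m)
  case (Suc k)
  assume "bounded_linear f" "open S"
  then show ?thesis unfolding Suc
    by (intro Ck_on_Suc_I[where f'="\<lambda>_. f"] Ck_on_const) (auto intro: bounded_linear_imp_has_derivative)
qed (simp add: linear_continuous_on)

lemma has_derivative_frechet_Ck:
  "Ck_on (Suc m) f S \<Longrightarrow> open S \<Longrightarrow> x \<in> S \<Longrightarrow> (f has_derivative frechet_derivative f (at x)) (at x)"
  by (simp add: differentiable_on_eq_differentiable_at frechet_derivative_works)

lemma Ck_on_add: "open S \<Longrightarrow> Ck_on m f S \<Longrightarrow> Ck_on m g S \<Longrightarrow> Ck_on m (\<lambda>x. f x + g x) S"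
proof (induction m arbitrary: f g)
  case (Suc m)
  show ?case
  proof (rule Ck_on_Suc_I)
    fix x assume "x \<in> S"
    then show "((\<lambda>x. f x + g x) has_derivative (\<lambda>b. frechet_derivative f (at x) b + frechet_derivative g (at x) b)) (at x)"
      using Suc.prems by (intro has_derivative_add has_derivative_frechet_Ck)
  qed (use Suc in auto)
qed (auto intro: continuous_on_add)

lemma Ck_on_mult: "open S \<Longrightarrow> Ck_on m f S \<Longrightarrow> Ck_on m g S \<Longrightarrow> Ck_on m (\<lambda>x. f x * g x) S"
proof (induction m arbitrary: f g)
  case (Suc m)
  show ?case
  proof (rule Ck_on_Suc_I)
    fix x assume "x \<in> S"
    then show "((\<lambda>x. f x * g x) has_derivative
        (\<lambda>b. f x * frechet_derivative g (at x) b + frechet_derivative f (at x) b * g x)) (at x)"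
      using Suc.prems by (intro has_derivative_mult has_derivative_frechet_Ck)
  next
    fix b :: 'a assume "b \<in> Basis"
    then show "Ck_on m (\<lambda>x. f x * frechet_derivative g (at x) b + frechet_derivative f (at x) b * g x) S"
      using Suc.prems by (intro Ck_on_add Suc.IH) (auto dest: Ck_on_SucD simp del: Ck_on.simps(2), auto)
  qed (use Suc in auto)
qed (auto intro: continuous_on_mult)

lemma Ck_on_inverse:
  "open S \<Longrightarrow> (\<And>x. x \<in> S \<Longrightarrow> f x \<noteq> 0) \<Longrightarrow> Ck_on m f S \<Longrightarrow> Ck_on m (\<lambda>x. inverse (f x)) S"
proof (induction m arbitrary: f)
  case (Suc m)
  show ?case
  proof (rule Ck_on_Suc_I)
    fix x assume x: "x \<in> S"
    show "((\<lambda>x. inverse (f x)) has_derivative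
        (\<lambda>b. - 1 * (inverse (f x) * frechet_derivative f (at x) b * inverse (f x)))) (at x)"
      using Deriv.has_derivative_inverse[OF Suc.prems(2)[OF x] has_derivative_frechet_Ck[OF Suc.prems(3,1) x]] by simp
  next
    fix b :: 'a assume "b \<in> Basis"
    then show "Ck_on m (\<lambda>x. - 1 * (inverse (f x) * frechet_derivative f (at x) b * inverse (f x))) S"
      using Suc.prems Ck_on_SucD[OF Suc.prems(3)] by (intro Ck_on_mult Ck_on_const Suc.IH) auto
  qed (use Suc in auto)
qed (auto intro: continuous_on_inverse)

section \<open>Polynomials: derivatives and composition with graphs\<close>

lemma real_polynomial_function_frechet_derivative:
  fixes P :: "'a::euclidean_space \<Rightarrow> real"
  assumes "real_polynomial_function P"
  shows "real_polynomial_function (\<lambda>x. frechet_derivative P (at x) b)"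
  using assms
proof induction
  case (linear f)
  then have "frechet_derivative f (at x) = f" for x
    by (metis bounded_linear_imp_has_derivative frechet_derivative_at)
  then show ?case by (simp add: real_polynomial_function.intros)
next
  case (const c)
  then show ?case by (simp add: real_polynomial_function.intros)
next
  case (add f g)
  have "frechet_derivative (\<lambda>x. f x + g x) (at x) b = frechet_derivative f (at x) b + frechet_derivative g (at x) b" for x
    using add.hyps differentiable_at_real_polynomial_function[of _ x UNIV]
    by (subst frechet_derivative_at[OF has_derivative_add, symmetric]) (auto simp: frechet_derivative_works)
  then show ?case using add.IH by (simp add: real_polynomial_function.intros)
next
  case (mult f g)
  have "frechet_derivative (\<lambda>x. f x * g x) (at x) b = f x * frechet_derivative g (at x) b + frechet_derivative f (at x) b * g x" for x
    using mult.hyps differentiable_at_real_polynomial_function[of _ x UNIV]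
    by (subst frechet_derivative_at[OF has_derivative_mult, symmetric]) (auto simp: frechet_derivative_works)
  then show ?case using mult by (simp add: real_polynomial_function.intros)
qed

lemma real_polynomial_has_derivative:
  "real_polynomial_function P \<Longrightarrow> (P has_derivative frechet_derivative P (at x)) (at x)"
  using differentiable_at_real_polynomial_function[of P x UNIV] by (simp add: frechet_derivative_works)

text \<open>Along a graph every linear functional becomes a linear function plus a multiple of
  \<open>H\<close>, so induction over the polynomial reduces the claim to sums and products. This
  takes the place of a chain rule of order m.\<close>

lemma Ck_on_polynomial_graph:
  fixes Q :: "'a::euclidean_space \<Rightarrow> real" and H :: "'b::euclidean_space \<Rightarrow> real"
  assumes "real_polynomial_function Q" "open Z" "bounded_linear T" "Ck_on m H Z"
  shows "Ck_on m (\<lambda>z. Q (T z + H z *\<^sub>R e)) Z"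
  using assms(1)
proof induction
  case (linear f)
  interpret f: bounded_linear f by fact
  have "Ck_on m (\<lambda>z. f (T z) + H z * f e) Z"
    using assms bounded_linear_compose[OF linear assms(3)]
    by (intro Ck_on_add Ck_on_mult[OF _ _ Ck_on_const] Ck_on_linear[of "\<lambda>z. f (T z)"]) auto
  then show ?case by (simp add: f.add f.scaleR)
qed (use assms Ck_on_const Ck_on_add Ck_on_mult in auto)

section \<open>Splitting off one coordinate and the implicit function theorem\<close>

lemma hyperplane_proj_simps:
  "hyperplane_proj k (y + axis k t) = hyperplane_proj k y"
  "hyperplane_proj k z \<in> coord_hyperplane k"
  "y \<in> coord_hyperplane k \<Longrightarrow> hyperplane_proj k y = y"
  "hyperplane_proj k z + axis k (z $ k) = z"
  by (auto simp: hyperplane_proj_def coord_hyperplane_def vec_eq_iff axis_def)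

lemma bounded_linear_axis: "bounded_linear (axis k :: real \<Rightarrow> real ^ 'n)"
  by (auto intro!: linear_conv_bounded_linear[THEN iffD1] linearI simp: vec_eq_iff axis_def)

lemma axis_scaleR: "axis k t = t *\<^sub>R (axis k 1 :: real ^ 'n)"
  by (simp add: vec_eq_iff axis_def)

lemma bounded_linear_hyperplane_proj: "bounded_linear (hyperplane_proj k :: real ^ 'n \<Rightarrow> real ^ 'n)"
  unfolding hyperplane_proj_def[abs_def]
  by (intro bounded_linear_sub bounded_linear_ident bounded_linear_compose[OF bounded_linear_axis] bounded_linear_vec_nth)

lemma split_product_UNIV: "split_product k U UNIV = {z. hyperplane_proj k z \<in> U}"
  if "U \<subseteq> coord_hyperplane k"
proof -
  have "z \<in> split_product k U UNIV" if "hyperplane_proj k z \<in> U" for z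
    unfolding split_product_def using that hyperplane_proj_simps(4)[of k z, symmetric] by blast
  moreover have "hyperplane_proj k z \<in> U" if "z \<in> split_product k U UNIV" for z
    using that \<open>U \<subseteq> coord_hyperplane k\<close> by (auto simp: split_product_def hyperplane_proj_simps subset_iff)
  ultimately show ?thesis by blast
qed

text \<open>Bootstrapping: differentiating the level equation expresses the derivative of
  \<open>H\<close> as a quotient of partial derivatives of \<open>P\<close> along the graph of
  \<open>H\<close>. If \<open>H\<close> is of class C^m, so is this quotient, hence \<open>H\<close>
  is of class C^(m+1); mere differentiability starts the induction.\<close>

lemma smooth_implicit_function:
  fixes P :: "real ^ 'n \<Rightarrow> real"
  assumes P: "real_polynomial_function P" and "open Z"
    and H: "\<And>z. z \<in> Z \<Longrightarrow> H differentiable (at z)"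
    and level: "\<And>z. z \<in> Z \<Longrightarrow> P (hyperplane_proj k z + H z *\<^sub>R axis k 1) = t"
    and reg: "\<And>z. z \<in> Z \<Longrightarrow> frechet_derivative P (at (hyperplane_proj k z + H z *\<^sub>R axis k 1)) (axis k 1) \<noteq> 0"
  shows "smooth_on H Z"
  unfolding smooth_on_def
proof
  fix m
  define X where "X = (\<lambda>z. hyperplane_proj k z + H z *\<^sub>R (axis k 1 :: real ^ 'n))"
  define Q where "Q = (\<lambda>b x. frechet_derivative P (at x) b)"
  have Q: "real_polynomial_function (Q b)" for b
    unfolding Q_def by (rule real_polynomial_function_frechet_derivative[OF P])
  have der: "(H has_derivative (\<lambda>b. - 1 * (Q (hyperplane_proj k b) (X z) * inverse (Q (axis k 1) (X z))))) (at z)" if z: "z \<in> Z" for z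
  proof -
    let ?H' = "frechet_derivative H (at z)"
    have H': "(H has_derivative ?H') (at z)" using H[OF z] by (simp add: frechet_derivative_works)
    have X': "(X has_derivative (\<lambda>b. hyperplane_proj k b + ?H' b *\<^sub>R axis k 1)) (at z)"
      unfolding X_def
      by (intro has_derivative_add has_derivative_scaleR_left H' bounded_linear_imp_has_derivative bounded_linear_hyperplane_proj)
    have "((\<lambda>z. P (X z)) has_derivative (\<lambda>b. frechet_derivative P (at (X z)) (hyperplane_proj k b + ?H' b *\<^sub>R axis k 1))) (at z)"
      by (rule has_derivative_compose[OF X' real_polynomial_has_derivative[OF P]])
    moreover have "((\<lambda>z. P (X z)) has_derivative (\<lambda>b. 0)) (at z)"
    proof (rule has_derivative_transform_within_open[OF _ \<open>open Z\<close> z])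
      show "((\<lambda>z. t) has_derivative (\<lambda>b. 0)) (at z)" by simp
    qed (use level in \<open>simp add: X_def\<close>)
    ultimately have "(\<lambda>b. frechet_derivative P (at (X z)) (hyperplane_proj k b + ?H' b *\<^sub>R axis k 1)) = (\<lambda>b. 0)"
      by (rule has_derivative_unique)
    then have "frechet_derivative P (at (X z)) (hyperplane_proj k b + ?H' b *\<^sub>R axis k 1) = 0" for b by metis
    moreover have "linear (frechet_derivative P (at (X z)))"
      using differentiable_at_real_polynomial_function[OF P] by (rule linear_frechet_derivative)
    ultimately have "Q (hyperplane_proj k b) (X z) + ?H' b * Q (axis k 1) (X z) = 0" for b
      by (simp add: Q_def linear_add linear_cmul)
    then have "?H' b = - 1 * (Q (hyperplane_proj k b) (X z) * inverse (Q (axis k 1) (X z)))" for b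
      using reg[OF z] by (simp add: X_def Q_def field_simps eq_neg_iff_add_eq_0)
    then have "?H' = (\<lambda>b. - 1 * (Q (hyperplane_proj k b) (X z) * inverse (Q (axis k 1) (X z))))" by (intro ext)
    with H' show ?thesis by simp
  qed
  show "Ck_on m H Z"
  proof (induction m)
    case 0
    then show ?case
      using H by (simp add: continuous_at_imp_continuous_on differentiable_imp_continuous_within)
  next
    case (Suc m)
    have QX: "Ck_on m (\<lambda>z. Q b (X z)) Z" for b
      unfolding X_def by (rule Ck_on_polynomial_graph[OF Q \<open>open Z\<close> bounded_linear_hyperplane_proj Suc])
    have "Ck_on m (\<lambda>z. - 1 * (Q (hyperplane_proj k b) (X z) * inverse (Q (axis k 1) (X z)))) Z" for b
      using reg by (intro Ck_on_mult Ck_on_const Ck_on_inverse \<open>open Z\<close> QX) (auto simp: X_def Q_def)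
    then show ?case by (intro Ck_on_Suc_I[OF \<open>open Z\<close> der])
  qed
qed

lemma continuous_on_real_polynomial_function:
  "real_polynomial_function P \<Longrightarrow> continuous_on S (P :: 'a::euclidean_space \<Rightarrow> real)"
  by (simp add: continuous_on_polymonial_function real_polynomial_function_eq)

lemma norm_axis_real: "norm (axis k a :: real ^ 'n) = \<bar>a\<bar>"
  by (subst axis_scaleR) (simp add: norm_axis_1)

text \<open>The map \<Phi> that replaces the k-th coordinate of x by \<open>P x\<close> straightens
  the levels of \<open>P\<close>. It is locally invertible where the k-th partial derivative is
  nonzero, and g is the k-th coordinate of its inverse at height t. The inverse function theorem
  supplies only differentiability of g; smoothness comes from
  \<open>smooth_implicit_function\<close>.\<close>

lemma regular_level_local_graph:
  fixes P :: "real ^ 'n \<Rightarrow> real"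
  assumes P: "real_polynomial_function P" and "open B" "x0 \<in> B" "P x0 = t"
    and reg: "frechet_derivative P (at x0) (axis k 1) \<noteq> 0"
  obtains U V g where "openin (top_of_set (coord_hyperplane k)) U" "open V" "g ` U \<subseteq> V"
    "smooth_on_hyperplane k g U" "x0 \<in> split_product k U V" "split_product k U V \<subseteq> B"
    "{x \<in> split_product k U V. P x = t} = {y + axis k (g y) |y. y \<in> U}"
proof -
  define Q where "Q = (\<lambda>x. frechet_derivative P (at x))"
  have Qc: "continuous_on S (\<lambda>x. Q x b)" for S b
    unfolding Q_def by (intro continuous_on_real_polynomial_function real_polynomial_function_frechet_derivative P)
  have Ql: "bounded_linear (Q x)" for x
    unfolding Q_def by (rule has_derivative_bounded_linear[OF real_polynomial_has_derivative[OF P]])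
  have Pd: "(P has_derivative Q x) (at x)" for x
    unfolding Q_def by (rule real_polynomial_has_derivative[OF P])
  \<comment> \<open>The partial derivative must stay nonzero along the whole graph, not only at
    \<open>x0\<close>.\<close>
  define B' where "B' = {x \<in> B. Q x (axis k 1) \<noteq> 0}"
  have "open B'"
  proof -
    have "B' = B \<inter> (\<lambda>x. Q x (axis k 1)) -` (- {0})" by (auto simp: B'_def)
    then show ?thesis using continuous_open_preimage[OF Qc \<open>open B\<close>, of "- {0}"] by auto
  qed
  have "x0 \<in> B'" using assms by (simp add: B'_def Q_def)
  define \<Phi> where "\<Phi> = (\<lambda>x. hyperplane_proj k x + axis k (P x))"
  define \<Phi>' where "\<Phi>' = (\<lambda>x. Blinfun (\<lambda>h. hyperplane_proj k h + axis k (Q x h)))"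
  have bl: "bounded_linear (\<lambda>h. hyperplane_proj k h + axis k (Q x h))" for x
    by (intro bounded_linear_add bounded_linear_hyperplane_proj bounded_linear_compose[OF bounded_linear_axis] Ql)
  have \<Phi>'_apply: "blinfun_apply (\<Phi>' x) h = hyperplane_proj k h + axis k (Q x h)" for x h
    unfolding \<Phi>'_def using bl by (simp add: bounded_linear_Blinfun_apply)
  \<comment> \<open>The inverse of the derivative of \<Phi> at \<open>x0\<close>: the hyperplane
    component is kept and the k-th component is solved for.\<close>
  define inv' where "inv' = Blinfun (\<lambda>h. hyperplane_proj k h + axis k ((h $ k - Q x0 (hyperplane_proj k h)) / Q x0 (axis k 1)))"
  have inv'_apply: "blinfun_apply inv' h = hyperplane_proj k h + axis k ((h $ k - Q x0 (hyperplane_proj k h)) / Q x0 (axis k 1))" for h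
    unfolding inv'_def
    by (subst bounded_linear_Blinfun_apply)
      (intro bounded_linear_add bounded_linear_hyperplane_proj bounded_linear_compose[OF bounded_linear_axis]
        bounded_linear_divide[THEN bounded_linear_compose] bounded_linear_sub bounded_linear_vec_nth
        bounded_linear_compose[OF Ql], simp)
  have proj_k [simp]: "hyperplane_proj k h $ k = 0" for h by (simp add: hyperplane_proj_def axis_def)
  have axis_k [simp]: "(axis k s :: real ^ 'n) $ k = s" for s by (simp add: axis_def)
  have decomp: "Q x0 h = Q x0 (hyperplane_proj k h) + h $ k * Q x0 (axis k 1)" for h
  proof -
    have "h = hyperplane_proj k h + (h $ k) *\<^sub>R axis k 1"
      using hyperplane_proj_simps(4)[of k h] by (simp flip: axis_scaleR)
    then have "Q x0 h = Q x0 (hyperplane_proj k h + (h $ k) *\<^sub>R axis k 1)" by (rule arg_cong)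
    also have "\<dots> = Q x0 (hyperplane_proj k h) + h $ k * Q x0 (axis k 1)"
      using Ql[of x0, THEN bounded_linear.linear] by (simp add: linear_add linear_cmul)
    finally show ?thesis .
  qed
  have reg': "Q x0 (axis k 1) \<noteq> 0" using reg by (simp add: Q_def)
  have i1: "inv' o\<^sub>L \<Phi>' x0 = id_blinfun"
  proof (rule blinfun_eqI)
    fix h
    show "blinfun_apply (inv' o\<^sub>L \<Phi>' x0) h = blinfun_apply id_blinfun h"
      using reg' decomp[of h] hyperplane_proj_simps(3)[OF hyperplane_proj_simps(2)[of k h]]
      by (simp add: \<Phi>'_apply inv'_apply hyperplane_proj_simps)
  qed
  have i2: "(\<Phi> has_derivative blinfun_apply (\<Phi>' x)) (at x)" for x
    unfolding \<Phi>'_apply[abs_def] \<Phi>_def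
    by (intro has_derivative_add bounded_linear_imp_has_derivative bounded_linear_hyperplane_proj
        bounded_linear.has_derivative[OF bounded_linear_axis] Pd)
  have i3: "continuous_on B' \<Phi>'"
    by (rule continuous_on_blinfun_componentwise)
      (auto simp: \<Phi>'_apply intro!: continuous_intros Qc bounded_linear.continuous_on[OF bounded_linear_axis])
  obtain U' V' \<Psi> \<Psi>' where UV: "open U'" "U' \<subseteq> B'" "x0 \<in> U'" "open V'" "\<Phi> x0 \<in> V'"
    "homeomorphism U' V' \<Phi> \<Psi>" "\<And>y. y \<in> V' \<Longrightarrow> (\<Psi> has_derivative \<Psi>' y) (at y)"
  proof (rule inverse_function_theorem[OF \<open>open B'\<close> i2 i3 \<open>x0 \<in> B'\<close> i1])
    fix U1 V1 h h'
    assume "open U1" "U1 \<subseteq> B'" "x0 \<in> U1" "open V1" "\<Phi> x0 \<in> V1"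
      "homeomorphism U1 V1 \<Phi> h" "\<And>y. y \<in> V1 \<Longrightarrow> (h has_derivative h' y) (at y)"
    then show thesis by (rule that)
  qed
  have \<Psi>: "\<Psi> w \<in> U'" "hyperplane_proj k (\<Psi> w) = hyperplane_proj k w" "P (\<Psi> w) = w $ k" if "w \<in> V'" for w
  proof -
    show "\<Psi> w \<in> U'" using homeomorphism_image2[OF UV(6)] that by blast
    have e: "\<Phi> (\<Psi> w) = w" by (rule homeomorphism_apply2[OF UV(6) that])
    have "hyperplane_proj k (\<Phi> x) = hyperplane_proj k x" "\<Phi> x $ k = P x" for x
      using hyperplane_proj_simps(3)[OF hyperplane_proj_simps(2)[of k x]] by (simp_all add: \<Phi>_def hyperplane_proj_simps)
    then show "hyperplane_proj k (\<Psi> w) = hyperplane_proj k w" "P (\<Psi> w) = w $ k" using e by metis+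
  qed
  \<comment> \<open>An r-ball in the hyperplane times an interval of radius r lies in the ball of
    radius 2r, hence in the set where \<Phi> is injective.\<close>
  obtain r where r: "0 < r" "ball x0 (2 * r) \<subseteq> U'"
  proof -
    obtain e where "0 < e" "ball x0 e \<subseteq> U'" using UV by (meson open_contains_ball)
    then show thesis by (intro that[of "e/2"]) auto
  qed
  define g where "g = (\<lambda>y. \<Psi> (y + axis k t) $ k)"
  define W where "W = {z. z + axis k t \<in> V'}"
  have "open W"
  proof -
    have "W = (\<lambda>z. z + axis k t) -` V'" by (auto simp: W_def)
    then show ?thesis using UV(4) by (auto intro!: continuous_open_vimage continuous_intros)
  qed
  have gd: "g differentiable (at z)" if "z \<in> W" for z
  proof -
    have "(\<Psi> has_derivative \<Psi>' (z + axis k t)) (at (z + axis k t))" using UV(7) that by (simp add: W_def)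
    moreover have "((\<lambda>z. z + axis k t) has_derivative (\<lambda>h. h)) (at z)" by (auto intro!: derivative_eq_intros)
    ultimately have "((\<lambda>z. \<Psi> (z + axis k t)) has_derivative (\<lambda>h. \<Psi>' (z + axis k t) h)) (at z)"
      by (rule has_derivative_compose[rotated])
    then have "(g has_derivative (\<lambda>h. \<Psi>' (z + axis k t) h $ k)) (at z)"
      unfolding g_def by (rule bounded_linear.has_derivative[OF bounded_linear_vec_nth])
    then show ?thesis by (rule differentiableI)
  qed
  have gc: "continuous_on W g"
    using gd by (intro continuous_at_imp_continuous_on) (auto intro: differentiable_imp_continuous_within)
  define V where "V = ball (x0 $ k) r"
  \<comment> \<open>Three constraints on y: closeness to the projection of \<open>x0\<close>,
    membership of \<open>y + axis k t\<close> in the domain of the inverse, and \<open>g y\<close>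
    in the interval \<open>V\<close>.\<close>
  define O' where "O' = ball (hyperplane_proj k x0) r \<inter> (W \<inter> g -` V)"
  have "open O'" unfolding O'_def V_def
    by (intro open_Int open_ball continuous_open_preimage gc \<open>open W\<close>)
  define U where "U = coord_hyperplane k \<inter> O'"
  have sub: "y + axis k s \<in> U'" if "y \<in> U" "s \<in> V" for y s
  proof -
    have "norm (x0 - (y + axis k s)) = norm ((hyperplane_proj k x0 - y) + axis k (x0 $ k - s))"
      by (rule arg_cong[of _ _ norm]) (auto simp: vec_eq_iff hyperplane_proj_def axis_def)
    also have "\<dots> \<le> norm (hyperplane_proj k x0 - y) + \<bar>x0 $ k - s\<bar>"
      using norm_triangle_ineq[of "hyperplane_proj k x0 - y" "axis k (x0 $ k - s)"] by (simp only: norm_axis_real)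
    also have "norm (hyperplane_proj k x0 - y) < r"
      using that(1) by (simp add: U_def O'_def dist_norm)
    also have "\<bar>x0 $ k - s\<bar> < r"
      using that(2) by (simp add: V_def dist_real_def)
    finally have "y + axis k s \<in> ball x0 (2 * r)" by (simp add: dist_norm)
    then show ?thesis using r(2) by blast
  qed
  have graph: "\<Psi> (y + axis k t) = y + axis k (g y)" if "y \<in> U" for y
  proof -
    have "y + axis k t \<in> V'" "y \<in> coord_hyperplane k" using that by (auto simp: U_def O'_def W_def)
    then have "hyperplane_proj k (\<Psi> (y + axis k t)) = y" using \<Psi>(2) by (simp add: hyperplane_proj_simps)
    then show ?thesis using hyperplane_proj_simps(4)[of k "\<Psi> (y + axis k t)"] by (simp add: g_def)
  qed
  have Pg: "P (y + axis k (g y)) = t" if "y \<in> U" for y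
  proof -
    have "y + axis k t \<in> V'" "y $ k = 0" using that by (auto simp: U_def O'_def W_def coord_hyperplane_def)
    then show ?thesis using \<Psi>(3)[of "y + axis k t"] graph[OF that] by simp
  qed
  have gV: "g y \<in> V" if "y \<in> U" for y using that by (simp add: U_def O'_def)
  have uniq: "s = g y" if "y \<in> U" "s \<in> V" "P (y + axis k s) = t" for y s
  proof -
    have "y $ k = 0" using that by (auto simp: U_def coord_hyperplane_def)
    have "\<Phi> (y + axis k s) = y + axis k t"
      using that by (simp add: \<Phi>_def hyperplane_proj_simps U_def)
    then have "\<Psi> (y + axis k t) = y + axis k s"
      using homeomorphism_apply1[OF UV(6) sub[OF that(1,2)]] by simp
    then show ?thesis using \<open>y $ k = 0\<close> by (simp add: g_def)
  qed
  show thesis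
  proof
    show "openin (top_of_set (coord_hyperplane k)) U"
      unfolding U_def using \<open>open O'\<close> by (simp add: openin_open_Int)
    show "open V" by (simp add: V_def)
    show "g ` U \<subseteq> V" using gV by auto
    have Zeq: "split_product k U UNIV = hyperplane_proj k -` O'"
      using split_product_UNIV[of U k] by (auto simp: U_def hyperplane_proj_simps)
    show "smooth_on_hyperplane k g U"
      unfolding smooth_on_hyperplane_def
    proof (rule smooth_implicit_function[OF P, where k=k and t=t])
      show "open (split_product k U UNIV)"
        unfolding Zeq using \<open>open O'\<close>
        by (intro continuous_open_vimage linear_continuous_at bounded_linear_hyperplane_proj) auto
      fix z assume "z \<in> split_product k U UNIV"
      then have "hyperplane_proj k z \<in> O'" by (simp add: Zeq)
      then have z: "hyperplane_proj k z \<in> U" "hyperplane_proj k z \<in> W"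
        by (simp_all add: U_def hyperplane_proj_simps O'_def)
      show "(\<lambda>z. g (hyperplane_proj k z)) differentiable at z"
        using differentiable_compose[of g "hyperplane_proj k" z UNIV] gd[OF z(2)]
          bounded_linear_imp_differentiable[OF bounded_linear_hyperplane_proj]
        by (auto intro: differentiable_at_withinI)
      show "P (hyperplane_proj k z + g (hyperplane_proj k z) *\<^sub>R axis k 1) = t"
        using Pg[OF z(1)] by (simp flip: axis_scaleR)
      have "hyperplane_proj k z + axis k (g (hyperplane_proj k z)) \<in> B'"
        using sub[OF z(1) gV[OF z(1)]] UV(2) by auto
      then show "frechet_derivative P (at (hyperplane_proj k z + g (hyperplane_proj k z) *\<^sub>R axis k 1)) (axis k 1) \<noteq> 0"
        by (simp add: B'_def Q_def flip: axis_scaleR)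
    qed
    show "split_product k U V \<subseteq> B" using sub UV(2) by (fastforce simp: split_product_def B'_def)
    show "{x \<in> split_product k U V. P x = t} = {y + axis k (g y) |y. y \<in> U}"
      using uniq Pg gV by (fastforce simp: split_product_def)
    have x0: "\<Phi> x0 = hyperplane_proj k x0 + axis k t" using \<open>P x0 = t\<close> by (simp add: \<Phi>_def)
    then have "\<Psi> (hyperplane_proj k x0 + axis k t) = x0"
      using homeomorphism_apply1[OF UV(6,3)] by simp
    then have "g (hyperplane_proj k x0) = x0 $ k" by (simp add: g_def)
    then have "hyperplane_proj k x0 \<in> U"
      using UV(5) r x0 by (simp add: U_def O'_def W_def V_def hyperplane_proj_simps)
    moreover have "x0 $ k \<in> V" using r by (simp add: V_def)
    ultimately show "x0 \<in> split_product k U V"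
      unfolding split_product_def using hyperplane_proj_simps(4)[of k x0, symmetric] by blast
  qed
qed

lemma rotation_about_id: "rotation_about x (\<lambda>z. z)"
  unfolding rotation_about_def
  by (intro exI[of _ "mat 1"]) (simp add: rotation_matrix_def orthogonal_matrix_id)

text \<open>Regularity ensures that the frontier is the whole level set in \<open>B\<close>: from a
  regular point, moving along a coordinate axis in the direction of increase enters the superlevel
  set. Since the distinguished coordinate k may depend on the point, the identity serves as rotation
  everywhere. Hypothesis \<open>D\<close> keeps the frontier away from the boundary of
  \<open>B\<close>, where no equation is available.\<close>

lemma smooth_hypersurface_regular_level:
  fixes P :: "real ^ 'n \<Rightarrow> real"
  assumes P: "real_polynomial_function P" and "open B"
    and reg: "\<And>x. x \<in> B \<Longrightarrow> P x = t \<Longrightarrow> \<exists>k. frechet_derivative P (at x) (axis k 1) \<noteq> 0"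
    and D: "closure {x \<in> B. t < P x} \<subseteq> B \<inter> G"
  shows "smooth_hypersurface_in (frontier {x \<in> B. t < P x}) G"
proof -
  let ?D = "{x \<in> B. t < P x}"
  have Pc: "continuous_on S P" for S by (rule continuous_on_real_polynomial_function[OF P])
  have "open ?D"
    using continuous_open_preimage[OF Pc \<open>open B\<close>, of "{t<..}"] by (simp add: vimage_def Int_def)
  have front: "frontier ?D = closure ?D - ?D" using \<open>open ?D\<close> by (simp add: frontier_def interior_open)
  have eq: "frontier ?D = {x \<in> B. P x = t}"
  proof (intro subset_antisym subsetI)
    fix x assume x: "x \<in> frontier ?D"
    then have "x \<in> B" using D front by auto
    have "closure ?D \<subseteq> {x. t \<le> P x}"
      by (intro closure_minimal closed_Collect_le Pc continuous_intros) auto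
    with x front \<open>x \<in> B\<close> show "x \<in> {x \<in> B. P x = t}" by fastforce
  next
    fix x assume "x \<in> {x \<in> B. P x = t}"
    then have x: "x \<in> B" "P x = t" by auto
    obtain k where k: "frechet_derivative P (at x) (axis k 1) \<noteq> 0" using reg x by blast
    let ?c = "frechet_derivative P (at x) (axis k 1)"
    have lin: "((\<lambda>s. x + s *\<^sub>R axis k 1) has_derivative (\<lambda>s. s *\<^sub>R axis k 1)) (at 0)"
      by (auto intro!: derivative_eq_intros)
    have "((\<lambda>s. P (x + s *\<^sub>R axis k 1)) has_derivative (\<lambda>s. frechet_derivative P (at x) (s *\<^sub>R axis k 1))) (at 0)"
      using has_derivative_compose[OF lin, of P "frechet_derivative P (at x)"] real_polynomial_has_derivative[OF P, of x] by simp
    moreover have "linear (frechet_derivative P (at x))"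
      using differentiable_at_real_polynomial_function[OF P] by (rule linear_frechet_derivative)
    ultimately have d: "((\<lambda>s. P (x + s *\<^sub>R axis k 1)) has_real_derivative ?c) (at 0)"
      by (simp add: has_field_derivative_def linear_cmul mult_commute_abs)
    \<comment> \<open>The sign of the partial derivative selects the direction in which
      \<open>P\<close> increases.\<close>
    have "\<exists>d>0. \<forall>h. 0 < h \<and> h < d \<longrightarrow> t < P (x + (sgn ?c * h) *\<^sub>R axis k 1)"
    proof (cases "0 < ?c")
      case True
      then show ?thesis using DERIV_pos_inc_right[OF d True] x by auto
    next
      case False
      then have "?c < 0" using k by simp
      then show ?thesis using DERIV_neg_dec_left[OF d] x by auto
    qed
    then obtain d where d: "0 < d" "\<And>h. 0 < h \<Longrightarrow> h < d \<Longrightarrow> t < P (x + (sgn ?c * h) *\<^sub>R axis k 1)" by blast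
    have "x \<in> closure ?D"
      unfolding closure_approachable
    proof safe
      fix e :: real assume "0 < e"
      obtain e' where e': "0 < e'" "ball x e' \<subseteq> B" using \<open>open B\<close> x by (meson open_contains_ball)
      define h where "h = min (d/2) (min (e/2) (e'/2))"
      have h: "0 < h" "h < d" "h < e" "h < e'" using \<open>0 < e\<close> e' d by (auto simp: h_def)
      let ?y = "x + (sgn ?c * h) *\<^sub>R axis k 1"
      have "dist ?y x = h" using h k by (simp add: dist_norm abs_mult abs_sgn_eq)
      then have "?y \<in> ?D" "dist ?y x < e" using e' h d(2)[of h] by (auto simp: subset_iff dist_commute)
      then show "\<exists>y\<in>?D. dist y x < e" by blast
    qed
    then show "x \<in> frontier ?D" using front x by auto
  qed
  have "closedin (top_of_set G) (frontier ?D)"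
    using D front by (intro closed_subset frontier_closed) auto
  moreover have "\<exists>k U V g \<psi>. openin (top_of_set (coord_hyperplane k)) U \<and> open V \<and>
        g ` U \<subseteq> V \<and> smooth_on_hyperplane k g U \<and> rotation_about x \<psi> \<and> x \<in> \<psi> ` split_product k U V \<and>
        frontier ?D \<inter> \<psi> ` split_product k U V = {\<psi> (y + axis k (g y)) | y. y \<in> U}"
    if x: "x \<in> frontier ?D" for x
  proof -
    have xB: "x \<in> B" "P x = t" using x eq by auto
    obtain k where k: "frechet_derivative P (at x) (axis k 1) \<noteq> 0" using reg xB by blast
    obtain U V g where *: "openin (top_of_set (coord_hyperplane k)) U" "open V" "g ` U \<subseteq> V"
      "smooth_on_hyperplane k g U" "x \<in> split_product k U V" "split_product k U V \<subseteq> B"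
      "{x \<in> split_product k U V. P x = t} = {y + axis k (g y) |y. y \<in> U}"
      by (rule regular_level_local_graph[OF P \<open>open B\<close> xB k])
    have "frontier ?D \<inter> split_product k U V = {x \<in> split_product k U V. P x = t}"
      using *(6) eq by auto
    then show ?thesis using * rotation_about_id[of x]
      by (intro exI[of _ k] exI[of _ U] exI[of _ V] exI[of _ g] exI[of _ "\<lambda>z. z"]) auto
  qed
  ultimately show ?thesis unfolding smooth_hypersurface_in_def by blast
qed

text \<open>By Fubini a null set of pairs \<open>(a, t)\<close> has null sections for almost every
  a, and a ball around 0 is not null; so an a of arbitrarily small norm has only a null set of
  critical values.\<close>

lemma generic_linear_perturbation:
  fixes P :: "real ^ 'n \<Rightarrow> real"
  assumes P: "real_polynomial_function P" and "0 < r"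
  obtains a where "norm a < r"
    "AE t in lborel. \<forall>x. P x - a \<bullet> x = t \<longrightarrow> (\<exists>k. frechet_derivative (\<lambda>x. P x - a \<bullet> x) (at x) (axis k 1) \<noteq> 0)"
proof -
  define grad where "grad = (\<lambda>x. \<chi> k. frechet_derivative P (at x) (axis k 1))"
  \<comment> \<open>\<open>t\<close> is a critical value of \<open>P x - a \<bullet> x\<close> iff \<open>(a, t)\<close> lies in the range of \<open>\<Phi>\<close>\<close>
  define \<Phi> where "\<Phi> = (\<lambda>x. (grad x, P x - grad x \<bullet> x))"
  have "(\<lambda>x. frechet_derivative P (at x) b) differentiable_on UNIV" for b
    by (intro differentiable_on_real_polynomial_function real_polynomial_function_frechet_derivative P)
  then have gd: "grad differentiable_on UNIV"
    unfolding differentiable_on_def by (subst differentiable_componentwise_within)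
      (auto simp: Basis_vec_def inner_axis grad_def)
  have "\<Phi> differentiable_on UNIV"
    unfolding \<Phi>_def using gd differentiable_on_real_polynomial_function[OF P, of UNIV]
    by (auto simp: differentiable_on_def intro!: differentiable_Pair differentiable_diff differentiable_inner)
  then have "negligible (range \<Phi>)"
    by (rule negligible_differentiable_image_lowdim[rotated]) simp
  then have "range \<Phi> \<in> null_sets lebesgue" by (simp add: negligible_iff_null_sets)
  then have "AE z in lborel. z \<notin> range \<Phi>"
    by (subst AE_completion_iff[symmetric]) (rule AE_not_in)
  then have "AE z in lborel \<Otimes>\<^sub>M lborel. z \<notin> range \<Phi>" unfolding lborel_prod .
  then have ae: "AE a in lborel. AE t in lborel. (a, t) \<notin> range \<Phi>"
    by (rule lborel_pair.AE_pair)
  have "\<exists>a. norm a < r \<and> (AE t in lborel. (a, t) \<notin> range \<Phi>)"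
  proof (rule ccontr)
    assume "\<not> ?thesis"
    then have "AE a in lborel. a \<notin> ball (0 :: real ^ 'n) r"
      using ae by (auto elim!: eventually_mono)
    then have "emeasure lborel (ball (0 :: real ^ 'n) r) = 0"
      by (subst (asm) AE_iff_measurable[of "ball 0 r"]) auto
    then show False using content_ball_pos[OF \<open>0 < r\<close>, of "0 :: real ^ 'n"] by (simp add: measure_def)
  qed
  then obtain a where a: "norm a < r" "AE t in lborel. (a, t) \<notin> range \<Phi>" by blast
  show thesis
  proof (rule that[OF a(1)])
    show "AE t in lborel. \<forall>x. P x - a \<bullet> x = t \<longrightarrow> (\<exists>k. frechet_derivative (\<lambda>x. P x - a \<bullet> x) (at x) (axis k 1) \<noteq> 0)"
      using a(2)
    proof eventually_elim
      case (elim t)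
      show ?case
      proof (intro allI impI, rule ccontr)
        fix x assume x: "P x - a \<bullet> x = t" "\<not> (\<exists>k. frechet_derivative (\<lambda>x. P x - a \<bullet> x) (at x) (axis k 1) \<noteq> 0)"
        have "((\<lambda>x. P x - a \<bullet> x) has_derivative (\<lambda>h. frechet_derivative P (at x) h - a \<bullet> h)) (at x)"
          by (intro has_derivative_diff real_polynomial_has_derivative P bounded_linear_imp_has_derivative bounded_linear_inner_right)
        then have "frechet_derivative (\<lambda>x. P x - a \<bullet> x) (at x) = (\<lambda>h. frechet_derivative P (at x) h - a \<bullet> h)"
          by (rule frechet_derivative_at[symmetric])
        with x(2) have "grad x = a" by (simp add: grad_def vec_eq_iff inner_axis)
        with x(1) have "(a, t) = \<Phi> x" by (simp add: \<Phi>_def)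
        with elim show False by blast
      qed
    qed
  qed
qed

subsection \<open>Approximation of sets by sets with smooth boundary\<close>

lemma integrable_indicator_continuous:
  fixes E :: "'a::euclidean_space set" and h :: "'a \<Rightarrow> real"
  assumes "E \<in> sets borel" "bounded E" "continuous_on UNIV h"
  shows "integrable lborel (\<lambda>y. indicator E y * h y)"
proof -
  have "compact (closure E)" using assms by simp
  then have "bounded (h ` closure E)"
    using compact_continuous_image[OF continuous_on_subset[OF assms(3)]] compact_imp_bounded by blast
  then obtain B where "\<And>y. y \<in> E \<Longrightarrow> \<bar>h y\<bar> \<le> B"
    unfolding bounded_iff using closure_subset[of E] by (auto simp: subset_iff)
  then show ?thesis
    using assms borel_measurable_continuous_onI[OF assms(3)] by (intro integrable_indicator_mult_bounded) auto
qed

lemma abs_integral_indicator_le: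
  fixes E :: "'a::euclidean_space set" and h :: "'a \<Rightarrow> real"
  assumes E: "E \<in> sets borel" "bounded E" and h: "continuous_on UNIV h"
    and B: "\<And>y. y \<in> E \<Longrightarrow> \<bar>h y\<bar> \<le> B"
  shows "\<bar>\<integral>y. indicator E y * h y \<partial>lborel\<bar> \<le> B * measure lborel E"
proof -
  note i = integrable_indicator_continuous[OF E h]
  have "\<bar>\<integral>y. indicator E y * h y \<partial>lborel\<bar> \<le> (\<integral>y. \<bar>indicator E y * h y\<bar> \<partial>lborel)"
    using integral_norm_bound[of lborel "\<lambda>y. indicator E y * h y"] by simp
  also have "\<dots> \<le> (\<integral>y. indicator E y * B \<partial>lborel)"
    by (intro integral_mono integrable_abs i integrable_indicator_continuous E) (use B in \<open>auto simp: indicator_def\<close>)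
  also have "\<dots> = B * measure lborel E" using E by simp
  finally show ?thesis .
qed

lemma real_polynomial_function_inner_self: "real_polynomial_function (\<lambda>x::'a::euclidean_space. x \<bullet> x)"
proof -
  have "(\<lambda>x::'a. x \<bullet> x) = (\<lambda>x. \<Sum>j\<in>Basis. (x \<bullet> j) * (x \<bullet> j))"
    by (intro ext) (rule euclidean_inner)
  then show ?thesis
    by (simp only:) (intro real_polynomial_function_sum finite_Basis real_polynomial_function.intros(4)
      real_polynomial_function.intros(1)[OF bounded_linear_inner_left])
qed

text \<open>One factor of the squared distance is expanded as
  \<open>x \<bullet> x - 2 * (x \<bullet> y) + y \<bullet> y\<close>. The parts in x leave the
  integral and the parts in y join the weight, which is why the induction keeps b arbitrary.\<close>

lemma real_polynomial_integral_dist_power: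
  fixes E :: "'a::euclidean_space set"
  assumes E: "E \<in> sets borel" "bounded E"
  shows "continuous_on UNIV b \<Longrightarrow>
    real_polynomial_function (\<lambda>x. \<integral>y. indicator E y * (((norm (x - y))\<^sup>2) ^ i * b y) \<partial>lborel)"
proof (induction i arbitrary: b)
  case 0
  then show ?case by (simp add: real_polynomial_function.intros)
next
  case (Suc i)
  let ?I = "\<lambda>b x. \<integral>y. indicator E y * (((norm (x - y))\<^sup>2) ^ i * b y) \<partial>lborel"
  have int: "integrable lborel (\<lambda>y. indicator E y * (((norm (x - y))\<^sup>2) ^ i * c y))"
    if "continuous_on UNIV c" for c x
    using that by (intro integrable_indicator_continuous E continuous_intros)
  have "(\<integral>y. indicator E y * (((norm (x - y))\<^sup>2) ^ Suc i * b y) \<partial>lborel)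
    = (x \<bullet> x) * ?I b x - (\<Sum>j\<in>Basis. (2 * (x \<bullet> j)) * ?I (\<lambda>y. (y \<bullet> j) * b y) x) + ?I (\<lambda>y. (y \<bullet> y) * b y) x" for x
  proof -
    have "(\<integral>y. indicator E y * (((norm (x - y))\<^sup>2) ^ Suc i * b y) \<partial>lborel)
      = (\<integral>y. (x \<bullet> x) * (indicator E y * (((norm (x - y))\<^sup>2) ^ i * b y))
        - (\<Sum>j\<in>Basis. (2 * (x \<bullet> j)) * (indicator E y * (((norm (x - y))\<^sup>2) ^ i * ((y \<bullet> j) * b y))))
        + indicator E y * (((norm (x - y))\<^sup>2) ^ i * ((y \<bullet> y) * b y)) \<partial>lborel)"
    proof (rule Bochner_Integration.integral_cong[OF refl])
      fix y
      have sum: "(\<Sum>j\<in>Basis. (2 * (x \<bullet> j)) * (indicator E y * (((norm (x - y))\<^sup>2) ^ i * ((y \<bullet> j) * b y))))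
        = 2 * (x \<bullet> y) * (indicator E y * (((norm (x - y))\<^sup>2) ^ i * b y))"
      proof -
        have "(\<Sum>j\<in>Basis. (2 * (x \<bullet> j)) * (u * (v * ((y \<bullet> j) * w)))) = 2 * (\<Sum>j\<in>Basis. (x \<bullet> j) * (y \<bullet> j)) * (u * (v * w))"
          for u v w :: real
          by (simp add: sum_distrib_left sum_distrib_right mult_ac)
        then show ?thesis unfolding euclidean_inner[of x y] .
      qed
      have N: "(norm (x - y))\<^sup>2 = x \<bullet> x - 2 * (x \<bullet> y) + y \<bullet> y"
        by (simp add: power2_norm_eq_inner inner_diff inner_commute)
      have e: "N * A = a * A - 2 * c * A + d * A" if "N = a - 2 * c + d" for N A a c d :: real
        unfolding that by (simp add: algebra_simps)
      show "indicator E y * (((norm (x - y))\<^sup>2) ^ Suc i * b y)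
        = (x \<bullet> x) * (indicator E y * (((norm (x - y))\<^sup>2) ^ i * b y))
        - (\<Sum>j\<in>Basis. (2 * (x \<bullet> j)) * (indicator E y * (((norm (x - y))\<^sup>2) ^ i * ((y \<bullet> j) * b y))))
        + indicator E y * (((norm (x - y))\<^sup>2) ^ i * ((y \<bullet> y) * b y))"
        unfolding sum using e[OF N, of "indicator E y * (((norm (x - y))\<^sup>2) ^ i * b y)"] by (simp add: mult_ac)
    qed
    also have "\<dots> = (x \<bullet> x) * ?I b x - (\<Sum>j\<in>Basis. (2 * (x \<bullet> j)) * ?I (\<lambda>y. (y \<bullet> j) * b y) x) + ?I (\<lambda>y. (y \<bullet> y) * b y) x"
    proof -
      have 1: "integrable lborel (\<lambda>y. (x \<bullet> x) * (indicator E y * (((norm (x - y))\<^sup>2) ^ i * b y)))"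
        by (intro integrable_mult_right int Suc.prems)
      have 2: "integrable lborel (\<lambda>y. (2 * (x \<bullet> j)) * (indicator E y * (((norm (x - y))\<^sup>2) ^ i * ((y \<bullet> j) * b y))))" for j
        by (intro integrable_mult_right int Suc.prems continuous_intros)
      have 3: "integrable lborel (\<lambda>y. indicator E y * (((norm (x - y))\<^sup>2) ^ i * ((y \<bullet> y) * b y)))"
        by (intro int Suc.prems continuous_intros)
      show ?thesis
        by (simp only: Bochner_Integration.integral_add[OF Bochner_Integration.integrable_diff[OF 1 Bochner_Integration.integrable_sum[OF 2]] 3]
            Bochner_Integration.integral_diff[OF 1 Bochner_Integration.integrable_sum[OF 2]]
            Bochner_Integration.integral_sum[OF 2] integral_mult_right_zero)
    qed
    finally show ?thesis .
  qed
  moreover have "real_polynomial_function (\<lambda>x. (x \<bullet> x) * ?I b x - (\<Sum>j\<in>Basis. (2 * (x \<bullet> j)) * ?I (\<lambda>y. (y \<bullet> j) * b y) x)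
      + ?I (\<lambda>y. (y \<bullet> y) * b y) x)"
    by (intro real_polynomial_function.intros(3) real_polynomial_function_diff real_polynomial_function_sum
        real_polynomial_function.intros(4) real_polynomial_function_inner_self Suc.IH Suc.prems continuous_intros
        real_polynomial_function.intros(2) real_polynomial_function.intros(1) bounded_linear_inner_left finite_Basis)
  ultimately show ?case by simp
qed

lemma real_polynomial_integral_dist:
  fixes E :: "'a::euclidean_space set" and Q :: "real \<Rightarrow> real"
  assumes E: "E \<in> sets borel" "bounded E" and Q: "real_polynomial_function Q"
  shows "real_polynomial_function (\<lambda>x. \<integral>y. indicator E y * Q ((norm (x - y))\<^sup>2) \<partial>lborel)"
proof -
  obtain a N where a: "Q = (\<lambda>s. \<Sum>i\<le>N::nat. a i * s ^ i)"
    using real_polynomial_function_imp_sum[OF Q] by blast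
  have "(\<integral>y. indicator E y * Q ((norm (x - y))\<^sup>2) \<partial>lborel)
    = (\<Sum>i\<le>N. \<integral>y. indicator E y * (((norm (x - y))\<^sup>2) ^ i * a i) \<partial>lborel)" for x
  proof -
    have "(\<integral>y. indicator E y * Q ((norm (x - y))\<^sup>2) \<partial>lborel)
      = (\<integral>y. (\<Sum>i\<le>N. indicator E y * (((norm (x - y))\<^sup>2) ^ i * a i)) \<partial>lborel)"
      by (simp add: a sum_distrib_left mult_ac)
    also have "\<dots> = (\<Sum>i\<le>N. \<integral>y. indicator E y * (((norm (x - y))\<^sup>2) ^ i * a i) \<partial>lborel)"
      by (intro Bochner_Integration.integral_sum integrable_indicator_continuous E continuous_intros)
    finally show ?thesis .
  qed
  moreover have "real_polynomial_function (\<lambda>x. \<Sum>i\<le>N. \<integral>y. indicator E y * (((norm (x - y))\<^sup>2) ^ i * a i) \<partial>lborel)"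
    by (intro real_polynomial_function_sum real_polynomial_integral_dist_power E continuous_intros) auto
  ultimately show ?thesis by simp
qed

text \<open>The first-order remainder is at most the square of h for every combination of signs of u
  and \<open>u + h\<close>, which covers the kink at 0 as well.\<close>

lemma DERIV_max_0_power2: "((\<lambda>u. (max 0 u)\<^sup>2) has_real_derivative 2 * max 0 u) (at u)"
  unfolding DERIV_def
proof (rule LIM_zero_cancel, rule Lim_null_comparison)
  show "\<forall>\<^sub>F h in at 0. norm (((max 0 (u + h))\<^sup>2 - (max 0 u)\<^sup>2) / h - 2 * max 0 u) \<le> \<bar>h\<bar>"
    unfolding eventually_at
  proof (intro exI[of _ 1] conjI ballI impI)
    fix h :: real assume "h \<noteq> 0 \<and> dist h 0 < 1"
    then have h: "h \<noteq> 0" by simp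
    have "\<bar>(max 0 (u + h))\<^sup>2 - (max 0 u)\<^sup>2 - 2 * max 0 u * h\<bar> \<le> h\<^sup>2"
    proof (cases "0 \<le> u"; cases "0 \<le> u + h")
      assume "0 \<le> u" "\<not> 0 \<le> u + h"
      moreover from this have "u * (u + h) \<le> 0" by (simp add: mult_nonneg_nonpos)
      moreover have "0 \<le> (u + h)\<^sup>2" by simp
      \<comment> \<open>Here the remainder is
        \<open>- (u\<^sup>2 + 2 * u * h) = h\<^sup>2 - (u + h)\<^sup>2\<close>, which lies between 0
        and \<open>h\<^sup>2\<close>.\<close>
      moreover have "u\<^sup>2 + 2 * u * h \<le> 0" using calculation(1-3) mult_nonneg_nonpos[of u "u + 2 * h"] by (simp add: power2_eq_square algebra_simps)
      ultimately show ?thesis by (simp add: max_def power2_sum)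
    next
      assume "\<not> 0 \<le> u" "0 \<le> u + h"
      then have "(u + h)\<^sup>2 \<le> h\<^sup>2" by (intro power_mono) auto
      then show ?thesis using \<open>\<not> 0 \<le> u\<close> \<open>0 \<le> u + h\<close> by (simp add: max_def)
    qed (auto simp: max_def power2_eq_square algebra_simps)
    then have "\<bar>(max 0 (u + h))\<^sup>2 - (max 0 u)\<^sup>2 - 2 * max 0 u * h\<bar> / \<bar>h\<bar> \<le> \<bar>h\<bar>"
      using h by (simp add: divide_le_eq power2_eq_square abs_mult[symmetric])
    moreover have "((max 0 (u + h))\<^sup>2 - (max 0 u)\<^sup>2) / h - 2 * max 0 u = ((max 0 (u + h))\<^sup>2 - (max 0 u)\<^sup>2 - 2 * max 0 u * h) / h"
      using h by (simp add: field_simps)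
    ultimately show "norm (((max 0 (u + h))\<^sup>2 - (max 0 u)\<^sup>2) / h - 2 * max 0 u) \<le> \<bar>h\<bar>"
      by (simp add: abs_divide)
  qed simp
  show "(\<lambda>h::real. \<bar>h\<bar>) \<midarrow>0\<rightarrow> 0" by (rule tendsto_rabs_zero) simp
qed

text \<open>Weierstrass is applied to the derivative of the profile, and \<open>Q\<close> is a
  primitive of the approximating polynomial; a uniform bound on the difference of the derivatives is
  a Lipschitz bound on the difference of the functions.\<close>

lemma bump_profile_polynomial_approx:
  fixes \<epsilon> T \<eta> :: real
  assumes "0 < \<epsilon>" "0 \<le> T" "0 < \<eta>"
  obtains Q where "real_polynomial_function Q"
    "\<And>s s'. s \<in> {0..T} \<Longrightarrow> s' \<in> {0..T} \<Longrightarrow>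
      \<bar>((max 0 (1 - s / \<epsilon>\<^sup>2))\<^sup>2 - Q s) - ((max 0 (1 - s' / \<epsilon>\<^sup>2))\<^sup>2 - Q s')\<bar> \<le> \<eta> * \<bar>s - s'\<bar>"
    "\<And>s. s \<in> {0..T} \<Longrightarrow> \<bar>(max 0 (1 - s / \<epsilon>\<^sup>2))\<^sup>2 - Q s\<bar> \<le> \<eta> * T"
proof -
  define \<theta> where "\<theta> = (\<lambda>s. (max 0 (1 - s / \<epsilon>\<^sup>2))\<^sup>2)"
  define \<theta>' where "\<theta>' = (\<lambda>s. 2 * max 0 (1 - s / \<epsilon>\<^sup>2) * (- (1 / \<epsilon>\<^sup>2)))"
  have \<theta>: "(\<theta> has_real_derivative \<theta>' s) (at s)" for s
  proof -
    have "((\<lambda>s. 1 - s / \<epsilon>\<^sup>2) has_real_derivative 0 - 1 / \<epsilon>\<^sup>2) (at s)"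
      by (intro DERIV_diff DERIV_const DERIV_cdivide DERIV_ident)
    then show ?thesis
      unfolding \<theta>_def \<theta>'_def using DERIV_chain2[OF DERIV_max_0_power2] by fastforce
  qed
  have "continuous_on {0..T} \<theta>'" unfolding \<theta>'_def using assms by (auto intro!: continuous_intros)
  then obtain q where q: "real_polynomial_function q" "\<And>s. s \<in> {0..T} \<Longrightarrow> \<bar>\<theta>' s - q s\<bar> < \<eta>"
    by (rule Stone_Weierstrass_real_polynomial_function[OF compact_Icc _ \<open>0 < \<eta>\<close>]) auto
  obtain a N where a: "q = (\<lambda>s. \<Sum>i\<le>N::nat. a i * s ^ i)"
    using real_polynomial_function_imp_sum[OF q(1)] by blast
  \<comment> \<open>The constant 1 is the value of the profile at 0, so the difference vanishes
    there and the Lipschitz bound also yields the uniform one.\<close>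
  define Q where "Q = (\<lambda>s. 1 + (\<Sum>i\<le>N. (a i / (i + 1)) * s ^ Suc i))"
  have Qp: "real_polynomial_function Q"
    unfolding Q_def
    by (intro real_polynomial_function.intros(3) real_polynomial_function.intros(2) real_polynomial_function_sum
        real_polynomial_function.intros(4) real_polynomial_function_power real_polynomial_function.intros(1) bounded_linear_ident) auto
  have Q: "(Q has_real_derivative q s) (at s)" for s
  proof -
    have "(Q has_real_derivative (0 + (\<Sum>i\<le>N. (a i / (i + 1)) * (real (Suc i) * s ^ i)))) (at s)"
      unfolding Q_def
      by (intro DERIV_add DERIV_const DERIV_sum DERIV_cmult) (use DERIV_pow[of "Suc _" s UNIV] in simp)
    also have "0 + (\<Sum>i\<le>N. (a i / (i + 1)) * (real (Suc i) * s ^ i)) = q s"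
      unfolding a by (auto intro!: sum.cong simp: field_simps)
    finally show ?thesis .
  qed
  have lip: "\<bar>(\<theta> s - Q s) - (\<theta> s' - Q s')\<bar> \<le> \<eta> * \<bar>s - s'\<bar>" if "s \<in> {0..T}" "s' \<in> {0..T}" for s s'
  proof -
    have "norm ((\<theta> s - Q s) - (\<theta> s' - Q s')) \<le> \<eta> * norm (s - s')"
    proof (rule field_differentiable_bound[of "{0..T}" "\<lambda>s. \<theta> s - Q s" "\<lambda>s. \<theta>' s - q s"])
      show "((\<lambda>s. \<theta> s - Q s) has_field_derivative \<theta>' z - q z) (at z within {0..T})" for z
        by (rule has_field_derivative_at_within[OF DERIV_diff[OF \<theta> Q]])
      show "norm (\<theta>' z - q z) \<le> \<eta>" if "z \<in> {0..T}" for z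
        using q(2)[OF that] by simp
    qed (use that in auto)
    then show ?thesis by simp
  qed
  show thesis
  proof (rule that[OF Qp])
    show "\<bar>((max 0 (1 - s / \<epsilon>\<^sup>2))\<^sup>2 - Q s) - ((max 0 (1 - s' / \<epsilon>\<^sup>2))\<^sup>2 - Q s')\<bar> \<le> \<eta> * \<bar>s - s'\<bar>"
      if "s \<in> {0..T}" "s' \<in> {0..T}" for s s'
      using lip[OF that] by (simp add: \<theta>_def)
    show "\<bar>(max 0 (1 - s / \<epsilon>\<^sup>2))\<^sup>2 - Q s\<bar> \<le> \<eta> * T" if "s \<in> {0..T}" for s
    proof -
      have "\<bar>\<theta> s - Q s\<bar> \<le> \<eta> * \<bar>s - 0\<bar>"
        using lip[OF that, of 0] assms by (simp add: \<theta>_def Q_def)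
      also have "\<dots> \<le> \<eta> * T" using that assms by (intro mult_left_mono) auto
      finally show ?thesis by (simp add: \<theta>_def)
    qed
  qed
qed

text \<open>\<open>P\<close> arises by replacing the profile by \<open>Q\<close> under the
  convolution integral. For x in the ball and y in \<open>E\<close> the squared distance stays in
  \<open>{0..(2 * R)\<^sup>2}\<close>, and as a function of x it is Lipschitz with constant
  \<open>4 * R\<close>.\<close>

lemma mollification_polynomial_approx:
  fixes E :: "'a::euclidean_space set"
  assumes E: "E \<in> sets borel" "E \<subseteq> ball 0 R" and "0 < \<epsilon>" "0 < \<eta>" "0 < R"
  obtains P where "real_polynomial_function P"
    "\<And>x x'. x \<in> ball 0 R \<Longrightarrow> x' \<in> ball 0 R \<Longrightarrow>
      \<bar>(mollification (mollifier \<epsilon>) E x - P x) - (mollification (mollifier \<epsilon>) E x' - P x')\<bar> \<le> \<eta> * norm (x - x')"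
    "\<And>x. x \<in> ball 0 R \<Longrightarrow> \<bar>mollification (mollifier \<epsilon>) E x - P x\<bar> \<le> \<eta>"
proof -
  define Z where "Z = (\<integral>z. bump \<epsilon> (z::'a) \<partial>lborel)"
  define m where "m = measure lborel E"
  \<comment> \<open>Dominates both constants that occur: \<open>4 * R\<close> in the Lipschitz bound
    and \<open>(2 * R)\<^sup>2\<close> in the uniform bound. The factor \<open>m + 1\<close> below
    avoids division by 0 for null \<open>E\<close>.\<close>
  define c where "c = 4 * R + (2 * R)\<^sup>2"
  define \<eta>' where "\<eta>' = \<eta> * Z / ((m + 1) * c)"
  have Z: "0 < Z" unfolding Z_def by (rule integral_bump_pos) fact
  have m: "0 \<le> m" by (simp add: m_def)
  have c: "0 < c" "4 * R \<le> c" "(2 * R)\<^sup>2 \<le> c" using \<open>0 < R\<close> by (auto simp: c_def intro: add_pos_pos)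
  have \<eta>': "0 < \<eta>'" using assms Z m c by (simp add: \<eta>'_def)
  have "m * (\<eta>' * c) \<le> (m + 1) * (\<eta>' * c)" using \<eta>' c by (intro mult_right_mono) auto
  also have "\<dots> = \<eta> * Z" using m c by (simp add: \<eta>'_def)
  finally have key: "m * (\<eta>' * c) / Z \<le> \<eta>" using Z by (simp add: divide_le_eq)
  have bE: "bounded E" using E(2) bounded_subset bounded_ball by blast
  define \<theta> where "\<theta> = (\<lambda>s. (max 0 (1 - s / \<epsilon>\<^sup>2))\<^sup>2)"
  obtain Q where Q: "real_polynomial_function Q"
    "\<And>s s'. s \<in> {0..(2 * R)\<^sup>2} \<Longrightarrow> s' \<in> {0..(2 * R)\<^sup>2} \<Longrightarrow> \<bar>(\<theta> s - Q s) - (\<theta> s' - Q s')\<bar> \<le> \<eta>' * \<bar>s - s'\<bar>"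
    "\<And>s. s \<in> {0..(2 * R)\<^sup>2} \<Longrightarrow> \<bar>\<theta> s - Q s\<bar> \<le> \<eta>' * (2 * R)\<^sup>2"
    unfolding \<theta>_def by (rule bump_profile_polynomial_approx[OF \<open>0 < \<epsilon>\<close> _ \<eta>', of "(2 * R)\<^sup>2"]) auto
  have \<theta>c: "continuous_on UNIV (\<lambda>y. \<theta> ((norm (x - y))\<^sup>2))" for x :: 'a
    unfolding \<theta>_def using \<open>0 < \<epsilon>\<close> by (auto intro!: continuous_intros)
  have Qc: "continuous_on UNIV (\<lambda>y. Q ((norm (x - y))\<^sup>2))" for x :: 'a
    by (rule continuous_on_compose2[OF continuous_on_real_polynomial_function[OF Q(1), of UNIV]]) (auto intro!: continuous_intros)
  define P where "P = (\<lambda>x. (\<integral>y. indicator E y * Q ((norm (x - y))\<^sup>2) \<partial>lborel) / Z)"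
  have diff: "mollification (mollifier \<epsilon>) E x - P x
    = (\<integral>y. indicator E y * (\<theta> ((norm (x - y))\<^sup>2) - Q ((norm (x - y))\<^sup>2)) \<partial>lborel) / Z" for x
  proof -
    have "mollifier \<epsilon> \<in> borel_measurable (borel :: 'a measure)"
      by (rule borel_measurable_continuous_onI) (rule mollifier(5)[OF \<open>0 < \<epsilon>\<close>])
    then have "mollification (mollifier \<epsilon>) E x = (\<integral>y. indicator E y * \<theta> ((norm (x - y))\<^sup>2) \<partial>lborel) / Z"
      using E by (simp add: mollification_conv mollifier_def bump_def \<theta>_def Z_def)
    then show ?thesis
      using integrable_indicator_continuous[OF E(1) bE \<theta>c] integrable_indicator_continuous[OF E(1) bE Qc]
      by (simp add: P_def right_diff_distrib diff_divide_distrib)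
  qed
  have range: "(norm (x - y))\<^sup>2 \<in> {0..(2 * R)\<^sup>2}" if "x \<in> ball 0 R" "y \<in> E" for x y
  proof -
    have "norm (x - y) \<le> 2 * R" using that E(2) norm_triangle_ineq4[of x y] by (force simp: subset_iff)
    from power_mono[OF this norm_ge_zero, of 2] show ?thesis by simp
  qed
  show thesis
  proof (rule that)
    show "real_polynomial_function P"
      unfolding P_def by (intro real_polynomial_function_divide real_polynomial_integral_dist E bE Q)
    show "\<bar>mollification (mollifier \<epsilon>) E x - P x\<bar> \<le> \<eta>" if x: "x \<in> ball 0 R" for x
    proof -
      have "\<bar>\<integral>y. indicator E y * (\<theta> ((norm (x - y))\<^sup>2) - Q ((norm (x - y))\<^sup>2)) \<partial>lborel\<bar> \<le> \<eta>' * (2 * R)\<^sup>2 * m"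
        unfolding m_def using Q(3) range[OF x]
        by (intro abs_integral_indicator_le E bE continuous_on_diff \<theta>c Qc) auto
      also have "\<dots> \<le> m * (\<eta>' * c)" using \<eta>' c m by (simp add: mult.commute mult_left_mono)
      finally have "\<bar>mollification (mollifier \<epsilon>) E x - P x\<bar> \<le> m * (\<eta>' * c) / Z"
        using Z by (simp add: diff abs_divide divide_right_mono)
      with key show ?thesis by linarith
    qed
    show "\<bar>(mollification (mollifier \<epsilon>) E x - P x) - (mollification (mollifier \<epsilon>) E x' - P x')\<bar> \<le> \<eta> * norm (x - x')"
      if x: "x \<in> ball 0 R" and x': "x' \<in> ball 0 R" for x x'
    proof -
      let ?r = "\<lambda>x y. \<theta> ((norm (x - y))\<^sup>2) - Q ((norm (x - y))\<^sup>2)"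
      have "(mollification (mollifier \<epsilon>) E x - P x) - (mollification (mollifier \<epsilon>) E x' - P x')
        = (\<integral>y. indicator E y * (?r x y - ?r x' y) \<partial>lborel) / Z"
        using integrable_indicator_continuous[OF E(1) bE continuous_on_diff[OF \<theta>c[of x] Qc[of x]]]
          integrable_indicator_continuous[OF E(1) bE continuous_on_diff[OF \<theta>c[of x'] Qc[of x']]]
        by (simp add: diff right_diff_distrib[of "indicator E _" "?r x _" "?r x' _"] diff_divide_distrib)
      moreover have "\<bar>\<integral>y. indicator E y * (?r x y - ?r x' y) \<partial>lborel\<bar> \<le> (\<eta>' * (4 * R * norm (x - x'))) * m"
        unfolding m_def
      proof (intro abs_integral_indicator_le E bE continuous_on_diff \<theta>c Qc)
        fix y assume y: "y \<in> E"
        have nb: "norm (x - y) \<le> 2 * R" "norm (x' - y) \<le> 2 * R"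
          using range[OF x y] range[OF x' y] \<open>0 < R\<close> by (auto intro: power2_le_imp_le)
        have "\<bar>(norm (x - y))\<^sup>2 - (norm (x' - y))\<^sup>2\<bar> = \<bar>norm (x - y) - norm (x' - y)\<bar> * (norm (x - y) + norm (x' - y))"
          by (simp add: power2_eq_square square_diff_square_factored abs_mult mult.commute)
        also have "\<dots> \<le> norm (x - x') * (4 * R)"
          using nb norm_triangle_ineq3[of "x - y" "x' - y"] \<open>0 < R\<close> by (intro mult_mono) auto
        finally have "\<eta>' * \<bar>(norm (x - y))\<^sup>2 - (norm (x' - y))\<^sup>2\<bar> \<le> \<eta>' * (4 * R * norm (x - x'))"
          using \<eta>' by (simp add: mult_left_mono mult_ac)
        with Q(2)[OF range[OF x y] range[OF x' y]]
        show "\<bar>?r x y - ?r x' y\<bar> \<le> \<eta>' * (4 * R * norm (x - x'))" by linarith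
      qed
      ultimately have "\<bar>(mollification (mollifier \<epsilon>) E x - P x) - (mollification (mollifier \<epsilon>) E x' - P x')\<bar>
        \<le> (\<eta>' * (4 * R * norm (x - x'))) * m / Z"
        using Z by (simp add: abs_divide divide_right_mono)
      also have "\<dots> = (m * (\<eta>' * (4 * R)) / Z) * norm (x - x')" by (simp add: field_simps)
      also have "\<dots> \<le> (m * (\<eta>' * c) / Z) * norm (x - x')"
        using c \<eta>' m Z by (intro mult_right_mono divide_right_mono mult_left_mono) auto
      also have "\<dots> \<le> \<eta> * norm (x - x')" using key by (intro mult_right_mono) auto
      finally show ?thesis .
    qed
  qed
qed

text \<open>Markov's inequality: at points of \<open>E\<close> outside the superlevel set f differs
  from the indicator by at least r.\<close>

lemma emeasure_superlevel_approx:
  fixes f :: "'a::euclidean_space \<Rightarrow> real"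
  assumes [measurable]: "E \<in> sets borel" "f \<in> borel_measurable borel"
    and L1: "(\<integral>\<^sup>+x. ennreal \<bar>f x - indicator E x\<bar> \<partial>lborel) \<le> ennreal (r * e)" and "0 < r" "0 \<le> e"
  shows "emeasure lborel E \<le> emeasure lborel {x \<in> E. 1 - r < f x} + ennreal e"
proof -
  let ?A = "{x \<in> E. 1 - r < f x}"
  have "ennreal r * emeasure lborel (E - ?A) = (\<integral>\<^sup>+x. ennreal r * indicator (E - ?A) x \<partial>lborel)"
    by (subst nn_integral_cmult_indicator) auto
  also have "\<dots> \<le> (\<integral>\<^sup>+x. ennreal \<bar>f x - indicator E x\<bar> \<partial>lborel)"
    by (intro nn_integral_mono) (auto simp: indicator_def intro!: ennreal_leI)
  also have "\<dots> \<le> ennreal r * ennreal e" using L1 \<open>0 < r\<close> by (simp add: ennreal_mult')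
  finally have "emeasure lborel (E - ?A) \<le> ennreal e"
    using \<open>0 < r\<close> by (subst (asm) ennreal_mult_le_mult_iff) auto
  moreover have "emeasure lborel E \<le> emeasure lborel ?A + emeasure lborel (E - ?A)"
    by (rule order_trans[OF emeasure_mono emeasure_subadditive]) auto
  ultimately show ?thesis by (meson add_left_mono order_trans)
qed

text \<open>The order \<open>p - 1\<close> is below the dimension, so the kernel is locally
  integrable, and differences of points of \<open>S\<close> stay in a fixed ball.\<close>

lemma riesz_double_integral_finite:
  fixes S :: "'a::euclidean_space set"
  assumes [measurable]: "S \<in> sets borel" and "bounded S" and p: "1 \<le> p" "p < real DIM('a) + 1"
  shows "(\<integral>\<^sup>+x. \<integral>\<^sup>+y. indicator S x * indicator S y * riesz (p - 1) (x - y) \<partial>lborel \<partial>lborel) < \<infinity>"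
proof -
  obtain R where R: "0 < R" "\<And>x. x \<in> S \<Longrightarrow> norm x \<le> R" using \<open>bounded S\<close> unfolding bounded_pos by blast
  let ?F = "\<lambda>w::'a. indicator (cball 0 (2 * R)) w * riesz (p - 1) w"
  have "(\<integral>\<^sup>+x. \<integral>\<^sup>+y. indicator S x * indicator S y * riesz (p - 1) (x - y) \<partial>lborel \<partial>lborel)
    \<le> (\<integral>\<^sup>+x. \<integral>\<^sup>+y. indicator S x * ?F (x - y) \<partial>lborel \<partial>lborel)"
  proof (intro nn_integral_mono)
    fix x y
    show "indicator S x * indicator S y * riesz (p - 1) (x - y) \<le> indicator S x * ?F (x - y)"
    proof (cases "x \<in> S \<and> y \<in> S")
      case True
      then have "norm (x - y) \<le> 2 * R" using R(2)[of x] R(2)[of y] norm_triangle_ineq4[of x y] by linarith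
      then show ?thesis using True by simp
    qed auto
  qed
  also have "\<dots> = emeasure lborel S * (\<integral>\<^sup>+w. ?F w \<partial>lborel)"
  proof -
    have "?F \<in> borel_measurable borel"
      by (intro borel_measurable_times_ennreal borel_measurable_indicator borel_measurable_riesz) simp
    from nn_integral_convolution_mult[OF _ this, of "indicator S"] show ?thesis by simp
  qed
  also have "\<dots> < \<infinity>"
    using riesz_locally_integrable[of "p - 1" "2 * R", where 'a='a] emeasure_bounded_finite[OF \<open>bounded S\<close>] p R
    by (simp add: ennreal_mult_less_top)
  finally show ?thesis .
qed

text \<open>The set \<open>D\<close> is a superlevel set of a perturbed polynomial at a level found
  by averaging: the perimeters of the levels in an interval of length \<open>1 - 2 * r\<close>
  integrate to at most \<open>I + e1\<close>, so not almost all of them can exceed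
  \<open>I + e\<close>, while almost all levels are regular.\<close>

lemma smooth_set_approx:
  fixes E G K :: "(real ^ 'n) set"
  assumes Eb [measurable]: "E \<in> sets borel" and "open G" "compact K" "E \<subseteq> K" "K \<subseteq> G"
    and p: "real CARD('n) < p" "p < real CARD('n) + 1"
    and I: "interaction p E (G - E) = ennreal I" "0 \<le> I" and "0 < e"
  obtains D where "open D" "compact (closure D)" "closure D \<subseteq> G" "smooth_hypersurface_in (frontier D) G"
    "emeasure lborel E \<le> emeasure lborel D + ennreal e" "interaction p D (G - D) \<le> ennreal (I + e)"
proof -
  have [measurable]: "G \<in> sets borel" using \<open>open G\<close> by simp
  \<comment> \<open>Chosen so that shortening the unit interval of levels by \<open>2 * r\<close>
    costs at most e/4 in the averaging argument.\<close>
  define r where "r = min (1/4) (e / (8 * (I + e)))"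
  have r: "0 < r" "r \<le> 1/4" "2 * r * (I + e) \<le> e / 4"
  proof -
    show "0 < r" using I \<open>0 < e\<close> by (simp add: r_def)
    show "r \<le> 1/4" unfolding r_def by (rule min.cobounded1)
    have "r * (I + e) \<le> e / (8 * (I + e)) * (I + e)" using I \<open>0 < e\<close> by (intro mult_right_mono) (auto simp: r_def)
    also have "\<dots> = e / 8"
    proof -
      have "e / (8 * c) * c = e / 8" if "0 < c" for c using that by simp
      from this[of "I + e"] show ?thesis using I \<open>0 < e\<close> by linarith
    qed
    finally show "2 * r * (I + e) \<le> e / 4" by linarith
  qed
  \<comment> \<open>The bound e/4 serves the energy budget, the bound \<open>r * e\<close> serves
    Markov's inequality with threshold r.\<close>
  define e1 where "e1 = min (e / 4) (r * e)"
  have e1: "0 < e1" "e1 \<le> e / 4" "e1 \<le> r * e" using r \<open>0 < e\<close> by (auto simp: e1_def)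
  obtain \<epsilon> where \<epsilon>: "0 < \<epsilon>" "(\<Union>x\<in>K. cball x \<epsilon>) \<subseteq> G"
    "energy p G (mollification (mollifier \<epsilon>) E) \<le> 2 * interaction p E (G - E) + ennreal e1"
    "(\<integral>\<^sup>+x. ennreal \<bar>mollification (mollifier \<epsilon>) E x - indicator E x\<bar> \<partial>lborel) \<le> ennreal e1"
    by (rule mollification_approx[OF assms(1-5) _ e1(1), of p]) (use p in auto)
  define f where "f = mollification (mollifier \<epsilon>) E"
  define S where "S = (\<Union>x\<in>K. cball x \<epsilon>)"
  have S: "compact S" "S \<subseteq> G" "E \<subseteq> S"
    using compact_cball_neighborhood[OF \<open>compact K\<close>] \<epsilon> \<open>E \<subseteq> K\<close> by (auto simp: S_def)
  have [measurable]: "S \<in> sets borel" using S by (simp add: borel_compact)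
  have bE: "bounded E" using \<open>E \<subseteq> K\<close> \<open>compact K\<close> bounded_subset compact_imp_bounded by blast
  have [measurable]: "f \<in> borel_measurable borel"
    unfolding f_def by (intro borel_measurable_continuous_onI continuous_on_mollification Eb bE \<epsilon>)
  have f0: "f x = 0" if "x \<notin> S" for x
  proof (rule ccontr)
    assume "f x \<noteq> 0"
    then obtain y where "y \<in> E" "dist y x < \<epsilon>" unfolding f_def using mollification_support[OF \<epsilon>(1)] by metis
    then have "x \<in> S" using \<open>E \<subseteq> K\<close> unfolding S_def by (intro UN_I[of y]) auto
    with that show False by simp
  qed
  obtain R where R: "0 < R" "S \<subseteq> ball 0 R"
  proof -
    obtain b where "0 < b" "\<And>x. x \<in> S \<Longrightarrow> norm x \<le> b"
      using compact_imp_bounded[OF S(1)] unfolding bounded_pos by blast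
    then show thesis by (intro that[of "b + 1"]) force+
  qed
  obtain J where J: "0 \<le> J"
    "(\<integral>\<^sup>+x. \<integral>\<^sup>+y. indicator S x * indicator S y * riesz (p - 1) (x - y) \<partial>lborel \<partial>lborel) = ennreal J"
  proof -
    have "1 \<le> real CARD('n)" using zero_less_card_finite[where 'a='n] by linarith
    then have "1 \<le> p" using p by linarith
    then have "(\<integral>\<^sup>+x. \<integral>\<^sup>+y. indicator S x * indicator S y * riesz (p - 1) (x - y) \<partial>lborel \<partial>lborel) < \<infinity>"
      using p by (intro riesz_double_integral_finite compact_imp_bounded S) auto
    then show thesis
      by (cases "\<integral>\<^sup>+x. \<integral>\<^sup>+y. indicator S x * indicator S y * riesz (p - 1) (x - y) \<partial>lborel \<partial>lborel")
        (auto intro: that)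
  qed
  \<comment> \<open>The bound r/2 leaves room for the levels between \<eta> and
    \<open>1 - r - \<eta>\<close>; the other one makes the Lipschitz error in the energy at most
    \<open>e1\<close>.\<close>
  define \<eta> where "\<eta> = min (r / 2) (e1 / (J + 1))"
  have \<eta>: "0 < \<eta>" "\<eta> \<le> r / 2" "\<eta> * J \<le> e1"
  proof -
    show "0 < \<eta>" using r e1 J by (auto simp: \<eta>_def)
    show "\<eta> \<le> r / 2" unfolding \<eta>_def by (rule min.cobounded1)
    have "\<eta> * J \<le> e1 / (J + 1) * J" using J by (intro mult_right_mono) (auto simp: \<eta>_def)
    also have "\<dots> \<le> e1" using J e1 by (simp add: field_simps)
    finally show "\<eta> * J \<le> e1" .
  qed
  have "E \<subseteq> ball 0 R" "0 < \<eta> / 2" using S R \<eta> by auto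
  then obtain P0 where P0: "real_polynomial_function P0"
    "\<And>x x'. x \<in> ball 0 R \<Longrightarrow> x' \<in> ball 0 R \<Longrightarrow> \<bar>(f x - P0 x) - (f x' - P0 x')\<bar> \<le> \<eta> / 2 * norm (x - x')"
    "\<And>x. x \<in> ball 0 R \<Longrightarrow> \<bar>f x - P0 x\<bar> \<le> \<eta> / 2"
    unfolding f_def using mollification_polynomial_approx[OF Eb _ \<epsilon>(1) _ R(1), of "\<eta> / 2"] by metis
  \<comment> \<open>With this norm the linear form has both Lipschitz constant and size on the ball
    at most \<eta>/2, the share left over by \<open>P0\<close>.\<close>
  have \<eta>R: "0 < \<eta> / (2 * (R + 1))" using \<eta> R by simp
  obtain a where a: "norm a < \<eta> / (2 * (R + 1))"
    and ae: "AE t in lborel. \<forall>x. P0 x - a \<bullet> x = t \<longrightarrow> (\<exists>k. frechet_derivative (\<lambda>x. P0 x - a \<bullet> x) (at x) (axis k 1) \<noteq> 0)"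
    by (rule generic_linear_perturbation[OF P0(1) \<eta>R])
  define P where "P = (\<lambda>x. P0 x - a \<bullet> x)"
  have Pp: "real_polynomial_function P"
    unfolding P_def by (intro real_polynomial_function_diff P0 real_polynomial_function.intros(1) bounded_linear_inner_right)
  have Pc: "continuous_on A P" for A by (rule continuous_on_real_polynomial_function[OF Pp])
  have [measurable]: "P \<in> borel_measurable borel" by (rule borel_measurable_continuous_onI[OF Pc])
  have a1: "norm a \<le> \<eta> / 2" "norm a * R \<le> \<eta> / 2"
  proof -
    have "norm a * (R + 1) \<le> \<eta> / (2 * (R + 1)) * (R + 1)" using a R by (intro mult_right_mono) auto
    also have "\<dots> = \<eta> / 2" using R by (simp add: field_simps)
    finally have "norm a * (R + 1) \<le> \<eta> / 2" .
    moreover have "norm a \<le> norm a * (R + 1)" "norm a * R \<le> norm a * (R + 1)"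
      using R by (auto simp: algebra_simps)
    ultimately show "norm a \<le> \<eta> / 2" "norm a * R \<le> \<eta> / 2" by linarith+
  qed
  have P1: "\<bar>f x - P x\<bar> \<le> \<eta>" if "x \<in> ball 0 R" for x
  proof -
    have "\<bar>a \<bullet> x\<bar> \<le> norm a * R"
      using that by (intro order_trans[OF Cauchy_Schwarz_ineq2] mult_left_mono) auto
    then show ?thesis using P0(3)[OF that] a1 unfolding P_def by linarith
  qed
  have P2: "\<bar>P x - P x'\<bar> \<le> \<bar>f x - f x'\<bar> + \<eta> * norm (x - x')" if "x \<in> ball 0 R" "x' \<in> ball 0 R" for x x'
  proof -
    have "\<bar>a \<bullet> (x - x')\<bar> \<le> \<eta> / 2 * norm (x - x')"
      using a1 by (intro order_trans[OF Cauchy_Schwarz_ineq2] mult_right_mono) auto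
    moreover have "\<eta> / 2 * norm (x - x') = (\<eta> * norm (x - x')) / 2" by simp
    ultimately show ?thesis using P0(2)[OF that] unfolding P_def inner_diff_right by linarith
  qed
  \<comment> \<open>\<open>w\<close> has compactly supported oscillation, and above the level \<open>\<eta>\<close> the same superlevel sets as \<open>P\<close>\<close>
  define w where "w = (\<lambda>x. if x \<in> S then max \<eta> (P x) else \<eta>)"
  have [measurable]: "w \<in> borel_measurable borel" unfolding w_def by measurable
  have fr: "0 \<le> f x" for x unfolding f_def by (rule mollification_range[OF Eb \<epsilon>(1)])
  have wdiff: "\<bar>w x - w y\<bar> \<le> \<bar>f x - f y\<bar> + indicator S x * indicator S y * (\<eta> * norm (x - y))" for x y
  proof -
    have inB: "z \<in> ball 0 R" if "z \<in> S" for z using R(2) that by (rule subsetD)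
    \<comment> \<open>Across the boundary of \<open>S\<close> the jump of \<open>w\<close> is
      controlled by f, which vanishes outside: \<open>P z \<le> f z + \<eta>\<close> and
      \<open>f z \<ge> 0\<close>.\<close>
    have one: "\<bar>max \<eta> (P z) - \<eta>\<bar> \<le> \<bar>f z\<bar>" if "z \<in> S" for z
      using P1[OF inB[OF that]] fr[of z] unfolding max_def by (cases "\<eta> \<le> P z"; simp; linarith)
    show ?thesis
    proof (cases "x \<in> S")
      case x: True
      show ?thesis
      proof (cases "y \<in> S")
        case True
        have "\<bar>max \<eta> (P x) - max \<eta> (P y)\<bar> \<le> \<bar>P x - P y\<bar>" by (auto simp: max_def)
        also note P2[OF inB[OF x] inB[OF True]]
        finally show ?thesis using x True by (simp add: w_def)
      qed (use x one[OF x] f0[of y] in \<open>simp add: w_def\<close>)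
    next
      case x: False
      show ?thesis
      proof (cases "y \<in> S")
        case True
        then show ?thesis using x one[OF True] f0[of x] by (simp add: w_def abs_minus_commute)
      qed (use x in \<open>simp add: w_def\<close>)
    qed
  qed
  have "energy p G w \<le> (\<integral>\<^sup>+x. \<integral>\<^sup>+y. indicator G x * indicator G y * ennreal \<bar>f x - f y\<bar> * riesz p (x - y)
      + ennreal \<eta> * (indicator S x * indicator S y * riesz (p - 1) (x - y)) \<partial>lborel \<partial>lborel)"
    unfolding energy_def
  proof (intro nn_integral_mono)
    fix x y
    have "ennreal \<bar>w x - w y\<bar> \<le> ennreal \<bar>f x - f y\<bar> + indicator S x * indicator S y * (ennreal \<eta> * ennreal (norm (x - y)))"
      using ennreal_leI[OF wdiff[of x y]] \<eta> by (auto simp: indicator_def ennreal_mult' split: if_splits)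
    then have "ennreal \<bar>w x - w y\<bar> * riesz p (x - y)
      \<le> (ennreal \<bar>f x - f y\<bar> + indicator S x * indicator S y * (ennreal \<eta> * ennreal (norm (x - y)))) * riesz p (x - y)"
      by (rule mult_right_mono) simp
    also have "\<dots> = ennreal \<bar>f x - f y\<bar> * riesz p (x - y)
      + ennreal \<eta> * (indicator S x * indicator S y * (ennreal (norm (x - y)) * riesz p (x - y)))"
      by (simp only: distrib_right) (simp add: mult_ac)
    also have "\<dots> \<le> ennreal \<bar>f x - f y\<bar> * riesz p (x - y)
      + ennreal \<eta> * (indicator S x * indicator S y * riesz (p - 1) (x - y))"
      by (intro add_left_mono mult_left_mono riesz_pred_le) auto
    finally show "indicator G x * indicator G y * ennreal \<bar>w x - w y\<bar> * riesz p (x - y)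
      \<le> indicator G x * indicator G y * ennreal \<bar>f x - f y\<bar> * riesz p (x - y)
      + ennreal \<eta> * (indicator S x * indicator S y * riesz (p - 1) (x - y))"
      by (cases "x \<in> G \<and> y \<in> G") auto
  qed
  also have "\<dots> = energy p G f + ennreal \<eta> * ennreal J"
    unfolding energy_def J(2)[symmetric] by (subst nn_integral_lborel_double_add) (auto simp: nn_integral_cmult)
  also have "\<dots> \<le> (2 * ennreal I + ennreal e1) + ennreal e1"
    using \<epsilon>(3) \<eta> J unfolding f_def[symmetric] I(1) by (intro add_mono) (auto simp: ennreal_mult'[symmetric] intro: ennreal_leI)
  also have "2 * ennreal I = ennreal (2 * I)" using I by (simp add: ennreal_mult')
  also have "ennreal (2 * I) + ennreal e1 + ennreal e1 = ennreal (2 * I + e1 + e1)"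
    using I e1 by (simp only: ennreal_plus[symmetric] add_nonneg_nonneg mult_nonneg_nonneg less_imp_le zero_le_numeral)
  also have "2 * I + e1 + e1 = 2 * (I + e1)" by simp
  finally have ew: "energy p G w \<le> ennreal (2 * (I + e1))" .
  define D where "D = (\<lambda>t. {x \<in> ball 0 R. t < P x})"
  \<comment> \<open>Outside \<open>S\<close> f vanishes, so \<open>P\<close> is at most \<eta>
    there.\<close>
  have DS: "D t \<subseteq> S" if "\<eta> \<le> t" for t
  proof
    fix x assume x: "x \<in> D t"
    then show "x \<in> S" using P1[of x] f0[of x] that by (force simp: D_def)
  qed
  have Dw: "G \<inter> {x. t < w x} = D t" "G \<inter> {x. w x \<le> t} = G - D t" if "\<eta> \<le> t" for t
  proof -
    have "{x. t < w x} = D t"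
      using DS[OF that] R that by (auto simp: w_def D_def split: if_splits)
    then show eq: "G \<inter> {x. t < w x} = D t" using DS[OF that] S by auto
    show "G \<inter> {x. w x \<le> t} = G - D t" unfolding eq[symmetric] by auto
  qed
  have "\<exists>t. \<eta> \<le> t \<and> t < \<eta> + (1 - 2 * r) \<and> interaction p (D t) (G - D t) \<le> ennreal (I + e) \<and>
    (\<forall>x. P x = t \<longrightarrow> (\<exists>k. frechet_derivative P (at x) (axis k 1) \<noteq> 0))"
  proof (rule ccontr)
    assume no: "\<not> ?thesis"
    have "ennreal ((1 - 2 * r) * (I + e)) = ennreal (I + e) * ennreal (1 - 2 * r)"
      using r I \<open>0 < e\<close> by (subst ennreal_mult[symmetric]) (auto simp: mult.commute)
    also have "ennreal (1 - 2 * r) = emeasure lborel {\<eta>..<\<eta> + (1 - 2 * r)}"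
      using r by simp
    also have "ennreal (I + e) * \<dots> = (\<integral>\<^sup>+t. ennreal (I + e) * indicator {\<eta>..<\<eta> + (1 - 2 * r)} t \<partial>lborel)"
      by (rule nn_integral_cmult_indicator[symmetric]) simp
    also have "\<dots> \<le> (\<integral>\<^sup>+t. interaction p (G \<inter> {x. t < w x}) (G \<inter> {x. w x \<le> t}) \<partial>lborel)"
    proof (rule nn_integral_mono_AE)
      show "AE t in lborel. ennreal (I + e) * indicator {\<eta>..<\<eta> + (1 - 2 * r)} t \<le> interaction p (G \<inter> {x. t < w x}) (G \<inter> {x. w x \<le> t})"
        using ae
      proof eventually_elim
        case (elim t)
        then have reg: "\<forall>x. P x = t \<longrightarrow> (\<exists>k. frechet_derivative P (at x) (axis k 1) \<noteq> 0)" by (simp add: P_def)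
        show ?case
        proof (cases "t \<in> {\<eta>..<\<eta> + (1 - 2 * r)}")
          case True
          then have "\<not> interaction p (D t) (G - D t) \<le> ennreal (I + e)" using no reg by auto
          then show ?thesis using True Dw[of t] by simp
        qed simp
      qed
    qed
    finally have "2 * ennreal ((1 - 2 * r) * (I + e)) \<le> energy p G w"
      by (subst coarea[of w G p, symmetric]) (auto intro: mult_left_mono)
    also note ew
    also have "ennreal (2 * (I + e1)) = 2 * ennreal (I + e1)" using I e1 by (simp add: ennreal_mult')
    finally have "ennreal ((1 - 2 * r) * (I + e)) \<le> ennreal (I + e1)"
      by (subst (asm) ennreal_mult_le_mult_iff) auto
    moreover have "0 \<le> I + e1" using I e1 by simp
    ultimately have "(1 - 2 * r) * (I + e) \<le> I + e1" by (simp only: ennreal_le_iff)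
    then have "I + e - 2 * r * (I + e) \<le> I + e1" by (simp add: algebra_simps)
    \<comment> \<open>The left side is at least \<open>I + 3/4 * e\<close>, the right side at most
      \<open>I + e/4\<close>.\<close>
    then show False using r(3) e1 \<open>0 < e\<close> by linarith
  qed
  then obtain t where t: "\<eta> \<le> t" "t < \<eta> + (1 - 2 * r)" "interaction p (D t) (G - D t) \<le> ennreal (I + e)"
    "\<And>x. P x = t \<Longrightarrow> \<exists>k. frechet_derivative P (at x) (axis k 1) \<noteq> 0" by blast
  have cl: "closure (D t) \<subseteq> S" using DS[OF t(1)] compact_imp_closed[OF S(1)] by (rule closure_minimal)
  show thesis
  proof
    have "D t = ball 0 R \<inter> P -` {t<..}" by (auto simp: D_def)
    then show "open (D t)" using continuous_open_preimage[OF Pc, of "ball 0 R" "{t<..}"] by simp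
    show "compact (closure (D t))" using cl S(1) by (meson bounded_subset compact_imp_bounded compact_eq_bounded_closed closed_closure)
    show "closure (D t) \<subseteq> G" using cl S by blast
    show "smooth_hypersurface_in (frontier (D t)) G"
      unfolding D_def by (rule smooth_hypersurface_regular_level[OF Pp]) (use t cl R S in \<open>auto simp: D_def\<close>)
    show "interaction p (D t) (G - D t) \<le> ennreal (I + e)" by fact
    have "emeasure lborel E \<le> emeasure lborel {x \<in> E. 1 - r < f x} + ennreal e"
    proof (rule emeasure_superlevel_approx)
      show "(\<integral>\<^sup>+x. ennreal \<bar>f x - indicator E x\<bar> \<partial>lborel) \<le> ennreal (r * e)"
        using \<epsilon>(4) e1 unfolding f_def by (meson ennreal_leI order_trans)
    qed (use r \<open>0 < e\<close> in auto)
    also have "emeasure lborel {x \<in> E. 1 - r < f x} \<le> emeasure lborel (D t)"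
    proof (rule emeasure_mono)
      show "{x \<in> E. 1 - r < f x} \<subseteq> D t"
      proof
        fix x assume "x \<in> {x \<in> E. 1 - r < f x}"
        then have x: "x \<in> ball 0 R" "1 - r < f x" using S R by auto
        \<comment> \<open>The chain is \<open>t < 1 - 2 * r + \<eta> \<le> 1 - r - \<eta> < f x -
          \<eta> \<le> P x\<close>, using \<open>2 * \<eta> \<le> r\<close>.\<close>
        then show "x \<in> D t" using P1[of x] t(2) \<eta>(2) by (auto simp: D_def abs_le_iff)
      qed
      show "D t \<in> sets lborel" using \<open>open (D t)\<close> by simp
    qed
    finally show "emeasure lborel E \<le> emeasure lborel (D t) + ennreal e" by (simp add: add_right_mono)
  qed
qed

subsection \<open>The equivalences\<close>

lemma energy_cmult:
  fixes u :: "'a::euclidean_space \<Rightarrow> real"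
  assumes [measurable]: "u \<in> borel_measurable borel" "G \<in> sets borel"
  shows "energy p G (\<lambda>x. c * u x) = ennreal \<bar>c\<bar> * energy p G u"
proof -
  have "energy p G (\<lambda>x. c * u x) = (\<integral>\<^sup>+x. \<integral>\<^sup>+y. ennreal \<bar>c\<bar> * (indicator G x * indicator G y * ennreal \<bar>u x - u y\<bar> * riesz p (x - y)) \<partial>lborel \<partial>lborel)"
    unfolding energy_def right_diff_distrib[symmetric] abs_mult
    by (intro nn_integral_cong) (simp add: ennreal_mult' mult_ac)
  then show ?thesis unfolding energy_def by (simp add: nn_integral_cmult)
qed

text \<open>Permits replacing a Lebesgue measurable function by a Borel representative.\<close>

lemma energy_cong_AE:
  fixes u v :: "'a::euclidean_space \<Rightarrow> real"
  assumes "AE x in lborel. x \<in> G \<longrightarrow> u x = v x"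
  shows "energy p G u = energy p G v"
proof -
  have "(\<integral>\<^sup>+y. indicator G x * indicator G y * ennreal \<bar>u x - u y\<bar> * riesz p (x - y) \<partial>lborel)
    = (\<integral>\<^sup>+y. indicator G x * indicator G y * ennreal \<bar>v x - v y\<bar> * riesz p (x - y) \<partial>lborel)"
    if "x \<in> G \<longrightarrow> u x = v x" for x
    by (rule nn_integral_cong_AE, use assms in eventually_elim) (use that in \<open>auto simp: indicator_def\<close>)
  then show ?thesis
    unfolding energy_def by (intro nn_integral_cong_AE) (use assms in eventually_elim, blast)
qed

lemma enn_powr_mono: "a \<le> b \<Longrightarrow> 0 \<le> p \<Longrightarrow> enn_powr a p \<le> enn_powr b p"
  by (cases a; cases b) (auto simp: enn_powr_def top_unique ennreal_le_iff intro!: ennreal_leI powr_mono2)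

text \<open>Removes the error e at the end of both approximation arguments; \<open>max 0\<close>
  keeps the base of \<open>powr\<close> non-negative when e exceeds m.\<close>

lemma powr_le_of_tendsto:
  fixes m \<alpha> L :: real
  assumes h: "\<forall>\<^sub>F e in at_right 0. max 0 (m - e) powr \<alpha> \<le> h e" "(h \<longlongrightarrow> L) (at_right 0)"
    and "0 \<le> m" "0 < \<alpha>"
  shows "m powr \<alpha> \<le> L"
proof (rule tendsto_le[OF _ h(2) _ h(1)])
  have "((\<lambda>e. max 0 (m - e)) \<longlongrightarrow> max 0 (m - 0)) (at_right 0)"
    by (intro tendsto_intros)
  then have "((\<lambda>e. max 0 (m - e)) \<longlongrightarrow> m) (at_right 0)" using \<open>0 \<le> m\<close> by simp
  then show "((\<lambda>e. max 0 (m - e) powr \<alpha>) \<longlongrightarrow> m powr \<alpha>) (at_right 0)"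
    using \<open>0 < \<alpha>\<close> by (intro tendsto_powr' tendsto_const) auto
qed simp

text \<open>The sets \<open>E\<close> below are bounded, so that \<open>measure\<close> never takes its junk value \<open>0\<close>.\<close>

definition borel_isoperimetric_inequality :: "real \<Rightarrow> (real ^ 'n) set \<Rightarrow> real \<Rightarrow> bool" where
  "borel_isoperimetric_inequality \<delta> G C \<longleftrightarrow> (\<forall>E K. E \<in> sets borel \<and> compact K \<and> E \<subseteq> K \<and> K \<subseteq> G \<longrightarrow>
     ennreal (measure lborel E powr ((real CARD('n) - \<delta>) / real CARD('n)))
       \<le> ennreal (2 * C) * interaction (real CARD('n) + \<delta>) E (G - E))"

lemma bounded_borel_measure:
  fixes E :: "'a::euclidean_space set"
  assumes "bounded E"
  shows "emeasure lborel E = ennreal (measure lborel E)"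
  using emeasure_bounded_finite[OF assms] by (intro emeasure_eq_ennreal_measure) auto

lemma measure_approx_le:
  fixes D E :: "'a::euclidean_space set"
  assumes "emeasure lborel E \<le> emeasure lborel D + ennreal e" "bounded E" "bounded D" "0 \<le> e"
  shows "max 0 (measure lborel E - e) \<le> measure lborel D"
proof -
  have "ennreal (measure lborel E) \<le> ennreal (measure lborel D + e)"
    using assms by (simp add: bounded_borel_measure)
  then show ?thesis using assms(4) by (subst (asm) ennreal_le_iff) (auto simp: add_nonneg_nonneg)
qed

text \<open>With f the mollification, \<open>f / (1 - r)\<close> is admissible for the compact set
  \<open>L\<close> where f is at least \<open>1 - r\<close>. This bounds the capacity of
  \<open>L\<close> by nearly twice the perimeter of \<open>E\<close>, while \<open>L\<close> has
  nearly the measure of \<open>E\<close>; then r tends to 0.\<close>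

lemma capacity_imp_borel_isoperimetric:
  fixes G :: "(real ^ 'n) set"
  assumes "open G" "0 < \<delta>" "\<delta> < real CARD('n)" "0 < C"
    and cap: "frac_isocapacitary_inequality \<delta> G C"
  shows "borel_isoperimetric_inequality \<delta> G C"
  unfolding borel_isoperimetric_inequality_def
proof (intro allI impI, elim conjE)
  fix E K :: "(real ^ 'n) set"
  assume E [measurable]: "E \<in> sets borel" and K: "compact K" "E \<subseteq> K" "K \<subseteq> G"
  define p where "p = real CARD('n) + \<delta>"
  define \<alpha> where "\<alpha> = (real CARD('n) - \<delta>) / real CARD('n)"
  have \<alpha>: "0 < \<alpha>" using assms by (simp add: \<alpha>_def)
  have [measurable]: "G \<in> sets borel" using \<open>open G\<close> by simp
  have bE: "bounded E" using K bounded_subset compact_imp_bounded by blast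
  show "ennreal (measure lborel E powr ((real CARD('n) - \<delta>) / real CARD('n)))
       \<le> ennreal (2 * C) * interaction (real CARD('n) + \<delta>) E (G - E)"
    unfolding p_def[symmetric] \<alpha>_def[symmetric]
  proof (cases "interaction p E (G - E)")
    case top
    then show "ennreal (measure lborel E powr \<alpha>) \<le> ennreal (2 * C) * interaction p E (G - E)"
      using \<open>0 < C\<close> by (simp add: ennreal_mult_top)
  next
    case (real I)
    have bound: "max 0 (measure lborel E - r) powr \<alpha> \<le> C * ((1 / (1 - r)) * (2 * I + r * r))" if r: "0 < r" "r < 1" for r
    proof -
      \<comment> \<open>An error of \<open>r * r\<close> makes Markov's inequality with threshold r
        lose only measure r.\<close>
      have rr: "0 < r * r" using r by simp
      obtain \<epsilon> where \<epsilon>: "0 < \<epsilon>" "(\<Union>x\<in>K. cball x \<epsilon>) \<subseteq> G"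
        "energy p G (mollification (mollifier \<epsilon>) E) \<le> 2 * interaction p E (G - E) + ennreal (r * r)"
        "(\<integral>\<^sup>+x. ennreal \<bar>mollification (mollifier \<epsilon>) E x - indicator E x\<bar> \<partial>lborel) \<le> ennreal (r * r)"
        by (rule mollification_approx[OF E \<open>open G\<close> K _ rr, of p]) (use \<open>0 < \<delta>\<close> in \<open>auto simp: p_def\<close>)
      define f where "f = mollification (mollifier \<epsilon>) E"
      define S where "S = (\<Union>x\<in>K. cball x \<epsilon>)"
      have S: "compact S" "S \<subseteq> G" using compact_cball_neighborhood[OF K(1)] \<epsilon> by (auto simp: S_def)
      have fc: "continuous_on A f" for A
        unfolding f_def by (rule continuous_on_subset[OF continuous_on_mollification[OF E bE \<epsilon>(1)]]) simp
      have [measurable]: "f \<in> borel_measurable borel" by (rule borel_measurable_continuous_onI[OF fc])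
      have fS: "x \<in> S" if nz: "f x \<noteq> 0" for x
      proof -
        obtain y where "y \<in> E" "dist y x < \<epsilon>"
          by (rule mollification_support[OF \<epsilon>(1) nz[unfolded f_def]])
        then show ?thesis using K(2) unfolding S_def by (intro UN_I[of y]) auto
      qed
      define L where "L = {x. 1 - r \<le> f x}"
      \<comment> \<open>As \<open>r < 1\<close>, f is nonzero on \<open>L\<close>.\<close>
      have LS: "L \<subseteq> S" using fS r by (force simp: L_def)
      have "closed L" unfolding L_def by (intro closed_Collect_le continuous_on_const fc)
      moreover have "S \<inter> L = L" using LS by blast
      ultimately have L: "compact L" using compact_Int_closed[OF S(1), of L] by simp
      define u where "u = (\<lambda>x. 1 / (1 - r) * f x)"
      have "support_on G u \<subseteq> S" using fS by (auto simp: support_on_def u_def)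
      then have "closure (support_on G u) \<subseteq> S" using compact_imp_closed[OF S(1)] by (rule closure_minimal)
      then have "has_compact_support_in G u"
        unfolding has_compact_support_in_def using S
        by (meson bounded_subset closed_closure compact_eq_bounded_closed subset_trans)
      moreover have "continuous_on G u"
        unfolding u_def by (intro continuous_on_mult continuous_on_const fc)
      ultimately have "u \<in> C0_functions G" by (simp add: C0_functions_def)
      moreover have "\<forall>x\<in>L. 1 \<le> u x" using r by (auto simp: L_def u_def field_simps)
      ultimately have "frac_capacity \<delta> L G \<le> energy p G u"
        unfolding frac_capacity_def p_def frac_seminorm_eq_energy[symmetric] by (intro INF_lower) auto
      also have "energy p G u = ennreal (1 / (1 - r)) * energy p G f"
        unfolding u_def using r by (subst energy_cmult) auto
      also have "\<dots> \<le> ennreal (1 / (1 - r)) * ennreal (2 * I + r * r)"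
        using \<epsilon>(3) real r unfolding f_def[symmetric]
        by (intro mult_left_mono) (auto simp: ennreal_mult')
      also have "\<dots> = ennreal (1 / (1 - r) * (2 * I + r * r))"
        using r by (intro ennreal_mult'[symmetric]) simp
      finally have capL: "frac_capacity \<delta> L G \<le> ennreal (1 / (1 - r) * (2 * I + r * r))" .
      have bL: "bounded L" using L compact_imp_bounded by blast
      have "ennreal (measure lborel L powr \<alpha>) = enn_powr (emeasure lebesgue L) \<alpha>"
        using L by (simp add: enn_powr_def bounded_borel_measure[OF bL] borel_compact)
      also have "\<dots> \<le> ennreal C * frac_capacity \<delta> L G"
        using cap L LS S(2) unfolding frac_isocapacitary_inequality_def \<alpha>_def by auto
      also have "\<dots> \<le> ennreal C * ennreal (1 / (1 - r) * (2 * I + r * r))"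
        by (intro mult_left_mono capL) simp
      also have "\<dots> = ennreal (C * (1 / (1 - r) * (2 * I + r * r)))"
        using \<open>0 < C\<close> by (intro ennreal_mult'[symmetric]) simp
      finally have mL: "measure lborel L powr \<alpha> \<le> C * (1 / (1 - r) * (2 * I + r * r))"
        using real r \<open>0 < C\<close> by (subst (asm) ennreal_le_iff) auto
      have "emeasure lborel E \<le> emeasure lborel {x \<in> E. 1 - r < f x} + ennreal r"
        using \<epsilon>(4) r unfolding f_def[symmetric] by (intro emeasure_superlevel_approx) auto
      also have "\<dots> \<le> emeasure lborel L + ennreal r"
        using borel_compact[OF L] by (intro add_right_mono emeasure_mono) (auto simp: L_def)
      finally have "max 0 (measure lborel E - r) \<le> measure lborel L"
        using bE bL r by (intro measure_approx_le) auto
      then have "max 0 (measure lborel E - r) powr \<alpha> \<le> measure lborel L powr \<alpha>"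
        using \<alpha> by (intro powr_mono2) auto
      with mL show ?thesis by linarith
    qed
    have "measure lborel E powr \<alpha> \<le> 2 * C * I"
    proof (rule powr_le_of_tendsto[OF _ _ _ \<alpha>])
      show "\<forall>\<^sub>F r in at_right 0. max 0 (measure lborel E - r) powr \<alpha> \<le> C * ((1 / (1 - r)) * (2 * I + r * r))"
        unfolding eventually_at_right_field using bound by (intro exI[of _ 1]) auto
      have "((\<lambda>r::real. C * ((1 / (1 - r)) * (2 * I + r * r))) \<longlongrightarrow> C * ((1 / (1 - 0)) * (2 * I + 0 * 0))) (at_right 0)"
        by (intro tendsto_intros) simp
      then show "((\<lambda>r. C * ((1 / (1 - r)) * (2 * I + r * r))) \<longlongrightarrow> 2 * C * I) (at_right 0)"
        by (simp add: mult_ac)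
    qed simp
    then show "ennreal (measure lborel E powr \<alpha>) \<le> ennreal (2 * C) * interaction p E (G - E)"
      using real \<open>0 < C\<close> by (simp add: ennreal_leI flip: ennreal_mult')
  qed
qed

text \<open>Apply the hypothesis to the smooth sets of \<open>smooth_set_approx\<close> and let e
  tend to 0; sets of infinite perimeter are trivial.\<close>

lemma smooth_isoperimetric_imp_borel_isoperimetric:
  fixes G :: "(real ^ 'n) set"
  assumes "open G" "0 < \<delta>" "\<delta> < 1" "0 < C"
    and iso: "frac_isoperimetric_inequality \<delta> G C"
  shows "borel_isoperimetric_inequality \<delta> G C"
  unfolding borel_isoperimetric_inequality_def
proof (intro allI impI, elim conjE)
  fix E K :: "(real ^ 'n) set"
  assume E: "E \<in> sets borel" and K: "compact K" "E \<subseteq> K" "K \<subseteq> G"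
  define p where "p = real CARD('n) + \<delta>"
  define \<alpha> where "\<alpha> = (real CARD('n) - \<delta>) / real CARD('n)"
  have "1 \<le> real CARD('n)" using zero_less_card_finite[where 'a='n] by linarith
  then have "\<delta> < real CARD('n)" using assms by linarith
  then have \<alpha>: "0 < \<alpha>" by (simp add: \<alpha>_def)
  have bE: "bounded E" using K bounded_subset compact_imp_bounded by blast
  show "ennreal (measure lborel E powr ((real CARD('n) - \<delta>) / real CARD('n)))
       \<le> ennreal (2 * C) * interaction (real CARD('n) + \<delta>) E (G - E)"
    unfolding p_def[symmetric] \<alpha>_def[symmetric]
  proof (cases "interaction p E (G - E)")
    case top
    then show "ennreal (measure lborel E powr \<alpha>) \<le> ennreal (2 * C) * interaction p E (G - E)"
      using \<open>0 < C\<close> by (simp add: ennreal_mult_top)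
  next
    case (real I)
    have p: "real CARD('n) < p" "p < real CARD('n) + 1" using assms by (auto simp: p_def)
    have bound: "max 0 (measure lborel E - e) powr \<alpha> \<le> 2 * C * (I + e)" if e: "0 < e" for e
    proof -
      obtain D where D: "open D" "compact (closure D)" "closure D \<subseteq> G" "smooth_hypersurface_in (frontier D) G"
        "emeasure lborel E \<le> emeasure lborel D + ennreal e" "interaction p D (G - D) \<le> ennreal (I + e)"
        by (rule smooth_set_approx[OF E \<open>open G\<close> K p real(2,1) e])
      have bD: "bounded D" using D(2) closure_subset compact_imp_bounded bounded_subset by metis
      have "ennreal (measure lborel D powr \<alpha>) = enn_powr (emeasure lebesgue D) \<alpha>"
        using D(1) by (simp add: enn_powr_def bounded_borel_measure[OF bD])
      also have "\<dots> \<le> ennreal (2 * C) * interaction p D (G - D)"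
        using iso D unfolding frac_isoperimetric_inequality_def \<alpha>_def p_def frac_perimeter_eq_interaction by blast
      also have "\<dots> \<le> ennreal (2 * C) * ennreal (I + e)"
        by (intro mult_left_mono D) simp
      also have "\<dots> = ennreal (2 * C * (I + e))"
        using \<open>0 < C\<close> by (intro ennreal_mult'[symmetric]) simp
      finally have "measure lborel D powr \<alpha> \<le> 2 * C * (I + e)"
        using real e \<open>0 < C\<close> by (subst (asm) ennreal_le_iff) auto
      moreover have "max 0 (measure lborel E - e) powr \<alpha> \<le> measure lborel D powr \<alpha>"
        using \<alpha> e bE bD D(5) by (intro powr_mono2 measure_approx_le) auto
      ultimately show ?thesis by linarith
    qed
    have "measure lborel E powr \<alpha> \<le> 2 * C * I"
    proof (rule powr_le_of_tendsto[OF _ _ _ \<alpha>])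
      show "\<forall>\<^sub>F e in at_right 0. max 0 (measure lborel E - e) powr \<alpha> \<le> 2 * C * (I + e)"
        unfolding eventually_at_right_field using bound by (intro exI[of _ 1]) auto
      have "((\<lambda>e::real. 2 * C * (I + e)) \<longlongrightarrow> 2 * C * (I + 0)) (at_right 0)"
        by (intro tendsto_intros)
      then show "((\<lambda>e. 2 * C * (I + e)) \<longlongrightarrow> 2 * C * I) (at_right 0)" by simp
    qed simp
    then show "ennreal (measure lborel E powr \<alpha>) \<le> ennreal (2 * C) * interaction p E (G - E)"
      using real \<open>0 < C\<close> by (simp add: ennreal_leI flip: ennreal_mult')
  qed
qed

lemma borel_isoperimetric_imp_smooth_isoperimetric:
  fixes G :: "(real ^ 'n) set"
  assumes "borel_isoperimetric_inequality \<delta> G C"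
  shows "frac_isoperimetric_inequality \<delta> G C"
  unfolding frac_isoperimetric_inequality_def
proof (intro allI impI, elim conjE)
  fix D :: "(real ^ 'n) set"
  assume D: "open D" "compact (closure D)" "closure D \<subseteq> G"
  have bD: "bounded D" using D(2) closure_subset compact_imp_bounded bounded_subset by metis
  have "enn_powr (emeasure lebesgue D) ((real CARD('n) - \<delta>) / real CARD('n))
    = ennreal (measure lborel D powr ((real CARD('n) - \<delta>) / real CARD('n)))"
    using D(1) by (simp add: enn_powr_def bounded_borel_measure[OF bD])
  also have "\<dots> \<le> ennreal (2 * C) * frac_perimeter \<delta> D G"
    unfolding frac_perimeter_eq_interaction
    by (rule assms[unfolded borel_isoperimetric_inequality_def, rule_format, of D "closure D"])
      (use D closure_subset in auto)
  finally show "enn_powr (emeasure lebesgue D) ((real CARD('n) - \<delta>) / real CARD('n)) \<le> ennreal (2 * C) * frac_perimeter \<delta> D G" .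
qed

lemma borel_isoperimetric_imp_Sobolev:
  fixes G :: "(real ^ 'n) set"
  assumes "open G" "0 < \<delta>" "\<delta> < real CARD('n)" "0 < C"
    and iso: "borel_isoperimetric_inequality \<delta> G C"
  shows "frac_Sobolev_inequality \<delta> G C"
  unfolding frac_Sobolev_inequality_def
proof (intro allI impI, elim conjE)
  fix u :: "real ^ 'n \<Rightarrow> real"
  assume u: "u \<in> borel_measurable (lebesgue_on G)" "has_compact_support_in G u"
  define p where "p = real CARD('n) + \<delta>"
  define q where "q = real CARD('n) / (real CARD('n) - \<delta>)"
  have q: "1 < q" "(real CARD('n) - \<delta>) / real CARD('n) = 1 / q" using assms by (auto simp: q_def field_simps)
  have Gb [measurable]: "G \<in> sets borel" using \<open>open G\<close> by simp
  define K where "K = closure (support_on G u)"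
  have K: "compact K" "K \<subseteq> G" using u(2) by (auto simp: has_compact_support_in_def K_def)
  have [measurable]: "K \<in> sets borel" using K by (simp add: borel_compact)
  have uK: "u x = 0" if "x \<in> G" "x \<notin> K" for x
    using that closure_subset[of "support_on G u"] by (auto simp: K_def support_on_def)
  have "(\<lambda>x. if x \<in> G then u x else 0) \<in> borel_measurable lebesgue"
    using borel_measurable_if_I[of u G] u(1) Gb by simp
  then obtain u' where u': "u' \<in> borel_measurable lborel" "AE x in lborel. (if x \<in> G then u x else 0) = u' x"
    using completion_ex_borel_measurable_real by blast
  then have [measurable]: "u' \<in> borel_measurable borel" by simp
  \<comment> \<open>The factor \<open>indicator K\<close> makes \<open>v\<close> vanish at every
    point off \<open>K\<close>, whereas \<open>u'\<close> is known to vanish there only almost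
    everywhere.\<close>
  define v where "v = (\<lambda>x. indicator K x * \<bar>u' x\<bar>)"
  have [measurable]: "v \<in> borel_measurable borel" unfolding v_def by measurable
  have v: "AE x in lborel. x \<in> G \<longrightarrow> \<bar>u x\<bar> = v x"
    using u'(2) by eventually_elim (auto simp: v_def indicator_def uK)
  have v0: "v x = 0" if "x \<notin> K" for x using that by (simp add: v_def)
  have "(\<integral>\<^sup>+x\<in>G. ennreal (\<bar>u x\<bar> powr q) \<partial>lebesgue) = (\<integral>\<^sup>+x\<in>G. ennreal (\<bar>u x\<bar> powr q) \<partial>lborel)"
    by (simp add: nn_integral_completion)
  also have "\<dots> = (\<integral>\<^sup>+x. ennreal (v x powr q) \<partial>lborel)"
    by (rule nn_integral_cong_AE, use v in eventually_elim) (use K v0 in \<open>auto simp: indicator_def\<close>)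
  finally have "enn_powr (\<integral>\<^sup>+x\<in>G. ennreal (\<bar>u x\<bar> powr q) \<partial>lebesgue) (1 / q) = enn_powr (\<integral>\<^sup>+x. ennreal (v x powr q) \<partial>lborel) (1 / q)"
    by simp
  also have "\<dots> \<le> ennreal C * energy p G v"
  proof (rule Sobolev_of_isoperimetric[OF _ _ _ v0 K q(1) \<open>0 < C\<close>])
    show "ennreal (measure lborel E powr (1 / q)) \<le> ennreal (2 * C) * interaction p E (G - E)"
      if "E \<in> sets borel" "E \<subseteq> K" for E
      using iso that K unfolding borel_isoperimetric_inequality_def p_def q(2) by blast
  qed (auto simp: v_def)
  also have "energy p G v = energy p G (\<lambda>x. \<bar>u x\<bar>)"
    by (rule energy_cong_AE[symmetric]) (rule v)
  \<comment> \<open>Passing to absolute values does not increase differences.\<close>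
  also have "ennreal C * \<dots> \<le> ennreal C * energy p G u"
    unfolding energy_def by (intro mult_left_mono nn_integral_mono mult_mono ennreal_leI abs_triangle_ineq3) auto
  finally show "enn_powr (\<integral>\<^sup>+x\<in>G. ennreal (\<bar>u x\<bar> powr (real CARD('n) / (real CARD('n) - \<delta>))) \<partial>lebesgue)
      ((real CARD('n) - \<delta>) / real CARD('n)) \<le> ennreal C * frac_seminorm \<delta> G u"
    unfolding q(2) q_def[symmetric] frac_seminorm_eq_energy p_def .
qed

text \<open>An admissible u is at least 1 on \<open>K\<close>, so the measure of \<open>K\<close> is
  at most the integral of the q-th power of its absolute value.\<close>

lemma Sobolev_imp_capacity:
  fixes G :: "(real ^ 'n) set"
  assumes "open G" "0 < \<delta>" "\<delta> < real CARD('n)" "0 < C"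
    and Sobolev: "frac_Sobolev_inequality \<delta> G C"
  shows "frac_isocapacitary_inequality \<delta> G C"
  unfolding frac_isocapacitary_inequality_def
proof (intro allI impI, elim conjE)
  fix K :: "(real ^ 'n) set" assume K: "compact K" "K \<subseteq> G"
  define q where "q = real CARD('n) / (real CARD('n) - \<delta>)"
  define \<alpha> where "\<alpha> = (real CARD('n) - \<delta>) / real CARD('n)"
  let ?c = "enn_powr (emeasure lebesgue K) \<alpha>"
  have q: "0 < q" and \<alpha>: "0 < \<alpha>" using assms by (auto simp: q_def \<alpha>_def)
  have "?c \<le> ennreal C * frac_seminorm \<delta> G u" if u: "u \<in> C0_functions G" "\<forall>x\<in>K. 1 \<le> u x" for u
  proof -
    have "u \<in> borel_measurable (lebesgue_on G)"
      using u(1) \<open>open G\<close> unfolding C0_functions_def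
      by (intro continuous_imp_measurable_on_sets_lebesgue) (auto intro: borel_open)
    moreover have "has_compact_support_in G u" using u(1) by (simp add: C0_functions_def)
    ultimately have "enn_powr (\<integral>\<^sup>+x\<in>G. ennreal (\<bar>u x\<bar> powr q) \<partial>lebesgue) \<alpha> \<le> ennreal C * frac_seminorm \<delta> G u"
      using Sobolev unfolding frac_Sobolev_inequality_def q_def \<alpha>_def by blast
    moreover have "emeasure lebesgue K \<le> (\<integral>\<^sup>+x\<in>G. ennreal (\<bar>u x\<bar> powr q) \<partial>lebesgue)"
    proof -
      have "emeasure lebesgue K = (\<integral>\<^sup>+x. indicator K x \<partial>lebesgue)"
        using K(1) by (subst nn_integral_indicator) (auto simp: borel_compact)
      also have "\<dots> \<le> (\<integral>\<^sup>+x\<in>G. ennreal (\<bar>u x\<bar> powr q) \<partial>lebesgue)"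
      proof (intro nn_integral_mono)
        fix x
        show "indicator K x \<le> ennreal (\<bar>u x\<bar> powr q) * indicator G x"
        proof (cases "x \<in> K")
          case True
          then have "1 \<le> \<bar>u x\<bar> powr q" using u(2) q by (intro ge_one_powr_ge_zero) auto
          then have "ennreal 1 \<le> ennreal (\<bar>u x\<bar> powr q)" by (rule ennreal_leI)
          then show ?thesis using True K(2) by (auto simp: indicator_def)
        qed simp
      qed
      finally show ?thesis .
    qed
    ultimately show ?thesis using \<alpha> by (meson enn_powr_mono less_imp_le order_trans)
  qed
  \<comment> \<open>Division by the positive finite \<open>C\<close> gives a lower bound for every
    term of the infimum; it also holds when the infimum is over the empty set.\<close>
  then have le: "?c / ennreal C \<le> frac_seminorm \<delta> G u" if "u \<in> C0_functions G" "\<forall>x\<in>K. 1 \<le> u x" for u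
    using that \<open>0 < C\<close> by (intro divide_le_posI_ennreal) auto
  have "?c / ennreal C \<le> frac_capacity \<delta> K G"
    unfolding frac_capacity_def by (rule INF_greatest) (use le in auto)
  then have "ennreal C * (?c / ennreal C) \<le> ennreal C * frac_capacity \<delta> K G" by (rule mult_left_mono) simp
  moreover have "ennreal C * (?c / ennreal C) = ?c"
    using \<open>0 < C\<close> by (simp add: ennreal_times_divide ennreal_mult_divide_eq mult.commute[of "ennreal C"])
  ultimately show "enn_powr (emeasure lebesgue K) ((real CARD('n) - \<delta>) / real CARD('n)) \<le> ennreal C * frac_capacity \<delta> K G"
    by (simp add: \<alpha>_def)
qed

theorem theorem1p1:
  fixes G :: "(real ^ 'n) set" and \<delta> C :: real
  assumes "CARD('n) \<ge> 2"
    and "open G"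
    and "0 < \<delta>" and "\<delta> < 1"
    and "C > 0"
  shows "(frac_Sobolev_inequality \<delta> G C \<longleftrightarrow> frac_isocapacitary_inequality \<delta> G C) \<and>
         (frac_isocapacitary_inequality \<delta> G C \<longleftrightarrow> frac_isoperimetric_inequality \<delta> G C)"
proof -
  have n: "\<delta> < real CARD('n)" using assms by linarith
  \<comment> \<open>The Borel, Sobolev and capacity inequalities imply one another in a cycle, and
    the smooth isoperimetric inequality is tied to the Borel one in both directions.\<close>
  note borel = borel_isoperimetric_imp_smooth_isoperimetric
    smooth_isoperimetric_imp_borel_isoperimetric[OF assms(2-5)]
    borel_isoperimetric_imp_Sobolev[OF assms(2,3) n assms(5)]
    capacity_imp_borel_isoperimetric[OF assms(2,3) n assms(5)]
  show ?thesis
    using borel Sobolev_imp_capacity[OF assms(2,3) n assms(5)] by blast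
qed

end
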